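(* For a symmetric multicategory $\mathcal M$ the following are equivalent: 1. $\mathcal M$ is sequential, that is $\mathcal M\cong\mathcal C_\blacktriangleright$ for some category $\mathcal C$. 2. $\mathcal M\cong(\mathcal M_-)_\blacktriangleright$. 3. $\mathcal M$ has a central monoid $1_\blacktriangleright\to[\mathcal M,\mathcal M]$. 4. $\mathcal M$ has a central unital magma. 5. The canonical functor $[1_\blacktriangleright,\mathcal M]\to\mathcal M$ is an isomorphism. 6. The canonical functor $\mathcal M\to1_\blacktriangleright\otimes\mathcal M$ is an isomorphism.
   Context: $\mathbf{sMlt}$ is the category of (small) symmetric multicategories and symmetric functors; a permutation $\sigma$ of the domain of an arrow $f$ gives an arrow $\sigma f$. $\mathcal M_-$ is the category of objects and unary arrows of $\mathcal M$. For a category $\mathcal C$: $\mathcal C^-$ has the objects of $\mathcal C$, $\mathcal C^-(X;Y)=\mathcal C(X;Y)$ and no $n$-ary arrows for $n\neq1$. $\mathcal C_\blacktriangleright$ has the objects of $\mathcal C$ and $\mathcal C_\blacktriangleright(X_1,\dots,X_n;X)=\mathcal C(X_1;X)\times\cdots\times\mathcal C(X_n;X)$, composition $\langle f_1,\dots,f_n\rangle(\langle g_{11},\dots,g_{1m_1}\rangle,\dots,\langle g_{n1},\dots,g_{nm_n}\rangle)=\langle f_1g_{11},\dots,f_1g_{1m_1},\dots,f_ng_{n1},\dots,f_ng_{nm_n}\rangle$, and symmetric structure given by permuting sequences. $1$ is the terminal category, so $1_\blacktriangleright$ is the terminal symmetric multicategory; symmetric functors $1_\blacktriangleright\to\mathcal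 M$ are commutative monoids in $\mathcal M$. $(\mathbf{sMlt},1^-,\otimes)$ is the Boardman–Vogt symmetric monoidal closed structure. The objects of $\mathcal M\otimes\mathcal N$ are pairs $\langle A,X\rangle$; its arrows are generated by $f_X:\langle A_1,X\rangle,\dots,\langle A_n,X\rangle\to\langle A,X\rangle$ for $f:A_1,\dots,A_n\to A$ in $\mathcal M$ and $h_A:\langle A,X_1\rangle,\dots,\langle A,X_m\rangle\to\langle A,X\rangle$ for $h:X_1,\dots,X_m\to X$ in $\mathcal N$, subject to the relations making $(-)_X:\mathcal M\to\mathcal M\otimes\mathcal N$ and $(-)_A:\mathcal N\to\mathcal M\otimes\mathcal N$ symmetric functors and to $f_X(h_{A_1},\dots,h_{A_n})=\sigma\,h_A(f_{X_1},\dots,f_{X_m})$, with $\sigma$ the evident permutation matching the domains. The internal hom $[\mathcal M,\mathcal N]$ has as objects the symmetric functors $\mathcal M\to\mathcal N$; an arrow $\alpha:F_1,\dots,F_n\to F$ is a family of arrows $\alpha_A:F_1A,\dots,F_nA\to FA$ ($A\in\mathcal M$) such that $Ff(\alpha_{A_1},\dots,\alpha_{A_m})=\sigma\,\alpha_A(F_1f,\dots,F_nf)$ for every $f:A_1,\dots,A_m\to A$ in $\mathcal M$, with $\sigma$ the evident permutation; composition and symmetric structure are pointwise. The unique functor $1^-\to1_\blacktriangleright$ induces the canonical functors $[1_\blacktriangleright,\mathcal M]\to[1^-,\mathcal M]\cong\mathcal M$ (forgetting the monoid structure) and $\mathcal M\cong1^-\otimes\mathcal M\to1_\blacktriangleright\otimes\mathcal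 M$ (sending $f$ to $f_\star$, $\star$ the object of $1_\blacktriangleright$). The center of $\mathcal M$ is the full sub-multicategory of $[\mathcal M,\mathcal M]$ on the single object $\mathrm{id}_{\mathcal M}$: an $n$-ary arrow is a family $\alpha_A:A,\dots,A\to A$ ($A\in\mathcal M$) with $f(\alpha_{A_1},\dots,\alpha_{A_m})=\sigma\,\alpha_A(f,\dots,f)$ for all $f:A_1,\dots,A_m\to A$. A central monoid in $\mathcal M$ is a commutative monoid in the center, i.e. a symmetric functor $1_\blacktriangleright\to[\mathcal M,\mathcal M]$ with value $\mathrm{id}_{\mathcal M}$ on the object. A central unital magma consists of a $0$-ary arrow $m^0$ and a $2$-ary arrow $m^2$ in the center with $m^2(m^0,\mathrm{id})=\mathrm{id}=m^2(\mathrm{id},m^0)$. *)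

theory Defs
  imports "HOL-Combinatorics.Permutations" "HOL-Library.FuncSet"
begin

section \<open>Categories and symmetric multicategories\<close>

record ('o, 'a) category =
  Ob :: "'o set"
  Mor :: "'a set"
  Src :: "'a \<Rightarrow> 'o"
  Tgt :: "'a \<Rightarrow> 'o"
  Ident :: "'o \<Rightarrow> 'a"
  Cmp :: "'a \<Rightarrow> 'a \<Rightarrow> 'a"

locale category =
  fixes C :: "('o, 'a) category"
  assumes Src: "f \<in> Mor C \<Longrightarrow> Src C f \<in> Ob C"
    and Tgt: "f \<in> Mor C \<Longrightarrow> Tgt C f \<in> Ob C"
    and Ident: "X \<in> Ob C \<Longrightarrow>
      Ident C X \<in> Mor C \<and> Src C (Ident C X) = X \<and> Tgt C (Ident C X) = X"
    and Cmp: "\<lbrakk>f \<in> Mor C; g \<in> Mor C; Src C f = Tgt C g\<rbrakk> \<Longrightarrow>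
      Cmp C f g \<in> Mor C \<and> Src C (Cmp C f g) = Src C g \<and> Tgt C (Cmp C f g) = Tgt C f"
    and Cmp_Ident_left: "f \<in> Mor C \<Longrightarrow> Cmp C (Ident C (Tgt C f)) f = f"
    and Cmp_Ident_right: "f \<in> Mor C \<Longrightarrow> Cmp C f (Ident C (Src C f)) = f"
    and Cmp_assoc: "\<lbrakk>f \<in> Mor C; g \<in> Mor C; h \<in> Mor C; Src C f = Tgt C g; Src C g = Tgt C h\<rbrakk> \<Longrightarrow>
      Cmp C (Cmp C f g) h = Cmp C f (Cmp C g h)"

definition terminal_category :: "(unit, unit) category" where
  "terminal_category = \<lparr>Ob = UNIV, Mor = UNIV, Src = (\<lambda>_. ()), Tgt = (\<lambda>_. ()),
     Ident = (\<lambda>_. ()), Cmp = (\<lambda>_ _. ())\<rparr>"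

text \<open>
  Permutations of \<open>n\<close> positions are functions \<open>\<sigma>\<close> with \<open>\<sigma> permutes {..<n}\<close>, acting on lists by
  \<^const>\<open>permute_list\<close>: the entry of \<open>permute_list \<sigma> xs\<close> at position \<open>p\<close> is \<open>xs ! \<sigma> p\<close>.
  For \<open>f : A\<^sub>0, \<dots>, A\<^sub>n\<^sub>-\<^sub>1 \<rightarrow> A\<close>, the arrow \<open>\<sigma>f\<close> accordingly has domain
  \<open>A\<^bsub>\<sigma> 0\<^esub>, \<dots>, A\<^bsub>\<sigma> (n-1)\<^esub>\<close>, and \<open>\<tau>(\<sigma>f) = (\<sigma> \<circ> \<tau>)f\<close>.

  \<open>list_perm is\<close> is the permutation with values \<open>is\<close>, so that
  \<open>permute_list (list_perm is) xs = map ((!) xs) is\<close> when \<open>length is = length xs\<close>.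
  \<open>index_blocks [n\<^sub>0, n\<^sub>1, \<dots>] = [[0..<n\<^sub>0], [n\<^sub>0..<n\<^sub>0+n\<^sub>1], \<dots>]\<close>.
  If \<open>ns = map length xss\<close>, then

  \<^item> \<open>permute_list (block_perm \<sigma> ns) (concat xss) = concat (permute_list \<sigma> xss)\<close>;
  \<^item> \<open>permute_list (sum_perm \<sigma>s ns) (concat xss) = concat (map2 permute_list \<sigma>s xss)\<close>.

  \<open>transpose_perm m n\<close> rearranges \<open>n\<close> blocks of length \<open>m\<close> into \<open>m\<close> blocks of length \<open>n\<close>:
  position \<open>j * n + i\<close> is filled from position \<open>i * m + j\<close> (\<open>i < n\<close>, \<open>j < m\<close>).
\<close>

definition list_perm :: "nat list \<Rightarrow> nat \<Rightarrow> nat" where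
  "list_perm is p = (if p < length is then is ! p else p)"

definition index_blocks :: "nat list \<Rightarrow> nat list list" where
  "index_blocks ns =
     map (\<lambda>i. [sum_list (take i ns)..<sum_list (take (Suc i) ns)]) [0..<length ns]"

definition block_perm :: "(nat \<Rightarrow> nat) \<Rightarrow> nat list \<Rightarrow> nat \<Rightarrow> nat" where
  "block_perm \<sigma> ns = list_perm (concat (permute_list \<sigma> (index_blocks ns)))"

definition sum_perm :: "(nat \<Rightarrow> nat) list \<Rightarrow> nat list \<Rightarrow> nat \<Rightarrow> nat" where
  "sum_perm \<sigma>s ns = list_perm (concat (map2 permute_list \<sigma>s (index_blocks ns)))"

definition transpose_perm :: "nat \<Rightarrow> nat \<Rightarrow> nat \<Rightarrow> nat" where
  "transpose_perm m n p = (if p < m * n then (p mod n) * m + p div n else p)"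

lemma permute_list_list_perm:
  "length is = length xs \<Longrightarrow> permute_list (list_perm is) xs = map ((!) xs) is"
  by (rule nth_equalityI) (simp_all add: permute_list_def list_perm_def)

lemma map_nth_index_blocks:
  "map (map ((!) (concat xss))) (index_blocks (map length xss)) = xss"
proof (rule nth_equalityI)
  fix i assume "i < length (map (map ((!) (concat xss))) (index_blocks (map length xss)))"
  then have i: "i < length xss"
    by (simp add: index_blocks_def)
  have eq: "concat xss = concat (take i xss) @ xss ! i @ concat (drop (Suc i) xss)"
    using i by (metis concat.simps(2) concat_append id_take_nth_drop)
  have s: "length (concat (take (Suc i) xss)) = length (concat (take i xss)) + length (xss ! i)"
    using i by (simp add: take_Suc_conv_app_nth)
  have *: "sum_list (take k (map length xss)) = length (concat (take k xss))" for k
    by (simp only: length_concat take_map)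
  let ?a = "length (concat (take i xss))"
  have "map (map ((!) (concat xss))) (index_blocks (map length xss)) ! i =
      map ((!) (concat xss)) [?a..<?a + length (xss ! i)]"
    using i s by (simp add: index_blocks_def * del: length_concat)
  also have "\<dots> = xss ! i"
  proof (rule nth_equalityI)
    fix j assume "j < length (map ((!) (concat xss)) [?a..<?a + length (xss ! i)])"
    then have j: "j < length (xss ! i)"
      by simp
    have "concat xss ! (?a + j) = xss ! i ! j"
      unfolding eq nth_append_length_plus using j by (simp only: nth_append if_True)
    then show "map ((!) (concat xss)) [?a..<?a + length (xss ! i)] ! j = xss ! i ! j"
      using j by simp
  qed simp
  finally show "map (map ((!) (concat xss))) (index_blocks (map length xss)) ! i = xss ! i" .
qed (simp add: index_blocks_def)

lemma length_concat_permute: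
  "\<sigma> permutes {..<length xss} \<Longrightarrow> length (concat (permute_list \<sigma> xss)) = length (concat xss)"
  by (metis length_concat mset_map mset_permute_list sum_mset_sum_list)

lemma length_concat_index_blocks:
  "length (concat (index_blocks (map length xss))) = length (concat xss)"
  using arg_cong[OF map_nth_index_blocks[of xss], of "\<lambda>x. length (concat x)"]
  by (simp add: length_concat comp_def)

lemma permute_block_perm:
  assumes "\<sigma> permutes {..<length xss}"
  shows "permute_list (block_perm \<sigma> (map length xss)) (concat xss) = concat (permute_list \<sigma> xss)"
proof -
  have "\<sigma> permutes {..<length (index_blocks (map length xss))}"
    using assms by (simp add: index_blocks_def)
  then show ?thesis
    unfolding block_perm_def
    by (simp add: permute_list_list_perm length_concat_permute length_concat_index_blocks
         map_concat map_nth_index_blocks flip: permute_list_map)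
qed

lemma permute_sum_perm:
  assumes "list_all2 (\<lambda>\<sigma> xs. \<sigma> permutes {..<length xs}) \<sigma>s xss"
  shows "permute_list (sum_perm \<sigma>s (map length xss)) (concat xss) = concat (map2 permute_list \<sigma>s xss)"
proof -
  let ?I = "index_blocks (map length xss)"
  have l: "length \<sigma>s = length ?I" "length \<sigma>s = length xss"
    using assms by (auto simp: index_blocks_def dest: list_all2_lengthD)
  have m: "map length ?I = map length xss"
    using arg_cong[OF map_nth_index_blocks[of xss], of "map length"] by (simp add: comp_def)
  have p: "\<sigma>s ! i permutes {..<length (?I ! i)}" if "i < length xss" for i
    using assms that m l by (metis list_all2_nthD2 nth_map)
  have 1: "map length (map2 permute_list \<sigma>s ?I) = map length ?I"
    using l by (auto simp: list_eq_iff_nth_eq)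
  have 2: "map (map ((!) (concat xss))) (map2 permute_list \<sigma>s ?I) = map2 permute_list \<sigma>s (map (map ((!) (concat xss))) ?I)"
    using l p by (auto simp: list_eq_iff_nth_eq permute_list_map simp flip: permute_list_map)
  show ?thesis
    unfolding sum_perm_def
    apply (subst permute_list_list_perm)
    subgoal using 1 m by (simp only: length_concat)
    subgoal using 2 by (simp only: map_concat map_nth_index_blocks)
    done
qed

record ('o, 'a) multicategory =
  Obj :: "'o set"
  Arr :: "'a set"
  Dom :: "'a \<Rightarrow> 'o list"
  Cod :: "'a \<Rightarrow> 'o"
  Idt :: "'o \<Rightarrow> 'a"
  Comp :: "'a \<Rightarrow> 'a list \<Rightarrow> 'a"
  Act :: "(nat \<Rightarrow> nat) \<Rightarrow> 'a \<Rightarrow> 'a"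

definition composable :: "('o, 'a) multicategory \<Rightarrow> 'a \<Rightarrow> 'a list \<Rightarrow> bool" where
  "composable M f gs \<longleftrightarrow> f \<in> Arr M \<and> set gs \<subseteq> Arr M \<and> map (Cod M) gs = Dom M f"

definition dom_permutes :: "('o, 'a) multicategory \<Rightarrow> (nat \<Rightarrow> nat) \<Rightarrow> 'a \<Rightarrow> bool" where
  "dom_permutes M \<sigma> f \<longleftrightarrow> \<sigma> permutes {..<length (Dom M f)}"

locale symmetric_multicategory =
  fixes M :: "('o, 'a) multicategory"
  assumes Dom: "f \<in> Arr M \<Longrightarrow> set (Dom M f) \<subseteq> Obj M"
    and Cod: "f \<in> Arr M \<Longrightarrow> Cod M f \<in> Obj M"
    and Idt: "A \<in> Obj M \<Longrightarrow> Idt M A \<in> Arr M \<and> Dom M (Idt M A) = [A] \<and> Cod M (Idt M A) = A"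
    and Comp: "composable M f gs \<Longrightarrow> Comp M f gs \<in> Arr M \<and>
      Dom M (Comp M f gs) = concat (map (Dom M) gs) \<and> Cod M (Comp M f gs) = Cod M f"
    and Act: "\<lbrakk>f \<in> Arr M; dom_permutes M \<sigma> f\<rbrakk> \<Longrightarrow> Act M \<sigma> f \<in> Arr M \<and>
      Dom M (Act M \<sigma> f) = permute_list \<sigma> (Dom M f) \<and> Cod M (Act M \<sigma> f) = Cod M f"
    and Comp_Idt_left: "f \<in> Arr M \<Longrightarrow> Comp M (Idt M (Cod M f)) [f] = f"
    and Comp_Idt_right: "f \<in> Arr M \<Longrightarrow> Comp M f (map (Idt M) (Dom M f)) = f"
    and Comp_assoc: "\<lbrakk>composable M f gs; list_all2 (composable M) gs hss\<rbrakk> \<Longrightarrow>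
      Comp M (Comp M f gs) (concat hss) = Comp M f (map2 (Comp M) gs hss)"
    and Act_id: "f \<in> Arr M \<Longrightarrow> Act M id f = f"
    and Act_Act: "\<lbrakk>f \<in> Arr M; dom_permutes M \<sigma> f; dom_permutes M \<tau> f\<rbrakk> \<Longrightarrow>
      Act M \<tau> (Act M \<sigma> f) = Act M (\<sigma> \<circ> \<tau>) f"
    and Comp_Act_left: "\<lbrakk>composable M f gs; dom_permutes M \<sigma> f\<rbrakk> \<Longrightarrow>
      Comp M (Act M \<sigma> f) (permute_list \<sigma> gs) =
      Act M (block_perm \<sigma> (map (length \<circ> Dom M) gs)) (Comp M f gs)"
    and Comp_Act_right: "\<lbrakk>composable M f gs; list_all2 (dom_permutes M) \<sigma>s gs\<rbrakk> \<Longrightarrow>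
      Comp M f (map2 (Act M) \<sigma>s gs) =
      Act M (sum_perm \<sigma>s (map (length \<circ> Dom M) gs)) (Comp M f gs)"

section \<open>Symmetric functors and isomorphisms\<close>

record ('o, 'a, 'p, 'b) multifunctor =
  obj_map :: "'o \<Rightarrow> 'p"
  arr_map :: "'a \<Rightarrow> 'b"

text \<open>
  Functors are extensional (\<^const>\<open>undefined\<close> off the carriers), so that \<open>=\<close> is equality of functors.
\<close>

definition symmetric_functor ::
  "('o, 'a) multicategory \<Rightarrow> ('p, 'b) multicategory \<Rightarrow> ('o, 'a, 'p, 'b) multifunctor \<Rightarrow> bool"
where
  "symmetric_functor M N F \<longleftrightarrow>
     obj_map F \<in> Obj M \<rightarrow>\<^sub>E Obj N \<and> arr_map F \<in> Arr M \<rightarrow>\<^sub>E Arr N \<and>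
     (\<forall>f \<in> Arr M. Dom N (arr_map F f) = map (obj_map F) (Dom M f) \<and>
        Cod N (arr_map F f) = obj_map F (Cod M f)) \<and>
     (\<forall>A \<in> Obj M. arr_map F (Idt M A) = Idt N (obj_map F A)) \<and>
     (\<forall>f gs. composable M f gs \<longrightarrow>
        arr_map F (Comp M f gs) = Comp N (arr_map F f) (map (arr_map F) gs)) \<and>
     (\<forall>f \<in> Arr M. \<forall>\<sigma>. dom_permutes M \<sigma> f \<longrightarrow> arr_map F (Act M \<sigma> f) = Act N \<sigma> (arr_map F f))"

definition id_functor :: "('o, 'a) multicategory \<Rightarrow> ('o, 'a, 'o, 'a) multifunctor" where
  "id_functor M = \<lparr>obj_map = (\<lambda>A \<in> Obj M. A), arr_map = (\<lambda>f \<in> Arr M. f)\<rparr>"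

definition comp_functor :: "('o, 'a) multicategory \<Rightarrow> ('p, 'b, 'q, 'c) multifunctor \<Rightarrow>
  ('o, 'a, 'p, 'b) multifunctor \<Rightarrow> ('o, 'a, 'q, 'c) multifunctor"
where
  "comp_functor M G F = \<lparr>obj_map = compose (Obj M) (obj_map G) (obj_map F),
     arr_map = compose (Arr M) (arr_map G) (arr_map F)\<rparr>"

definition isomorphism ::
  "('o, 'a) multicategory \<Rightarrow> ('p, 'b) multicategory \<Rightarrow> ('o, 'a, 'p, 'b) multifunctor \<Rightarrow> bool"
where
  "isomorphism M N F \<longleftrightarrow> symmetric_functor M N F \<and>
     (\<exists>G. symmetric_functor N M G \<and>
        comp_functor M G F = id_functor M \<and> comp_functor N F G = id_functor N)"

definition isomorphic :: "('o, 'a) multicategory \<Rightarrow> ('p, 'b) multicategory \<Rightarrow> bool"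
  (infix \<open>\<cong>\<close> 50)
where
  "M \<cong> N \<longleftrightarrow> (\<exists>F. isomorphism M N F)"

lemma symmetric_functor_comp:
  assumes M: "symmetric_multicategory M"
    and F: "symmetric_functor M N F" and G: "symmetric_functor N P G"
  shows "symmetric_functor M P (comp_functor M G F)"
proof -
  interpret symmetric_multicategory M by fact
  have F0: "A \<in> Obj M \<Longrightarrow> obj_map F A \<in> Obj N" for A
    using F by (auto simp: symmetric_functor_def)
  have F1: "f \<in> Arr M \<Longrightarrow> arr_map F f \<in> Arr N" for f
    using F by (auto simp: symmetric_functor_def)
  have Fd: "f \<in> Arr M \<Longrightarrow> Dom N (arr_map F f) = map (obj_map F) (Dom M f)"
    "f \<in> Arr M \<Longrightarrow> Cod N (arr_map F f) = obj_map F (Cod M f)" for f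
    using F by (auto simp: symmetric_functor_def)
  have Fc: "composable N (arr_map F f) (map (arr_map F) gs)" if c: "composable M f gs" for f gs
  proof -
    have "set gs \<subseteq> Arr M" "f \<in> Arr M" "map (Cod M) gs = Dom M f"
      using c by (auto simp: composable_def)
    moreover from this have "map (Cod N) (map (arr_map F) gs) = map (obj_map F) (map (Cod M) gs)"
      unfolding map_map by (intro map_cong[OF HOL.refl]) (use Fd(2) in auto)
    ultimately show ?thesis
      using F1 Fd(1) by (auto simp: composable_def)
  qed
  have Fp: "dom_permutes N \<sigma> (arr_map F f) = dom_permutes M \<sigma> f" if "f \<in> Arr M" for f \<sigma>
    using that Fd by (simp add: dom_permutes_def)
  have G0: "A \<in> Obj N \<Longrightarrow> obj_map G A \<in> Obj P" for A
    using G by (auto simp: symmetric_functor_def)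
  have G1: "f \<in> Arr N \<Longrightarrow> arr_map G f \<in> Arr P" for f
    using G by (auto simp: symmetric_functor_def)
  have CM: "map (arr_map (comp_functor M G F)) gs = map (arr_map G) (map (arr_map F) gs)"
    if "composable M f gs" for f gs
    using that by (auto simp: comp_functor_def compose_def composable_def)
  have OM: "map (obj_map (comp_functor M G F)) (Dom M f) = map (obj_map G) (map (obj_map F) (Dom M f))"
    if "f \<in> Arr M" for f
    using Dom[OF that] by (auto simp: comp_functor_def compose_def)
  show ?thesis
    unfolding symmetric_functor_def
  proof (intro conjI ballI allI impI)
    show "obj_map (comp_functor M G F) \<in> Obj M \<rightarrow>\<^sub>E Obj P" "arr_map (comp_functor M G F) \<in> Arr M \<rightarrow>\<^sub>E Arr P"
      using F0 F1 G0 G1 by (auto simp: comp_functor_def compose_def)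
  next
    fix f assume f: "f \<in> Arr M"
    show "Dom P (arr_map (comp_functor M G F) f) = map (obj_map (comp_functor M G F)) (Dom M f)"
      using f F1[OF f] G Fd OM[OF f] by (simp add: symmetric_functor_def comp_functor_def compose_def)
    show "Cod P (arr_map (comp_functor M G F) f) = obj_map (comp_functor M G F) (Cod M f)"
      using f F1[OF f] G Fd Cod[OF f] by (simp add: symmetric_functor_def comp_functor_def compose_def)
  next
    fix A assume "A \<in> Obj M"
    then show "arr_map (comp_functor M G F) (Idt M A) = Idt P (obj_map (comp_functor M G F) A)"
      using F G F0 Idt by (simp add: symmetric_functor_def comp_functor_def compose_def)
  next
    fix f gs assume c: "composable M f gs"
    then show "arr_map (comp_functor M G F) (Comp M f gs) =
        Comp P (arr_map (comp_functor M G F) f) (map (arr_map (comp_functor M G F)) gs)"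
      unfolding CM[OF c] using F G Fc[OF c] Comp[OF c]
      by (simp add: symmetric_functor_def comp_functor_def compose_def composable_def del: map_map)
  next
    fix f \<sigma> assume f: "f \<in> Arr M" "dom_permutes M \<sigma> f"
    then show "arr_map (comp_functor M G F) (Act M \<sigma> f) =
        Act P \<sigma> (arr_map (comp_functor M G F) f)"
      using F G Fp[OF f(1)] Act[OF f] F1
      by (simp add: symmetric_functor_def comp_functor_def compose_def)
  qed
qed

lemma comp_functor_assoc:
  assumes "symmetric_functor M N F"
  shows "comp_functor M H (comp_functor M G F) = comp_functor M (comp_functor N H G) F"
  using assms by (auto simp: comp_functor_def compose_def symmetric_functor_def fun_eq_iff PiE_iff)

lemma comp_functor_id_left:
  assumes "symmetric_functor M N F"
  shows "comp_functor M (id_functor N) F = F"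
  using assms
  by (auto simp: comp_functor_def id_functor_def compose_def symmetric_functor_def fun_eq_iff
      PiE_iff extensional_def intro!: multifunctor.equality)

lemma isomorphic_trans:
  assumes M: "symmetric_multicategory M" and N: "symmetric_multicategory N"
    and P: "symmetric_multicategory P" and "M \<cong> N" "N \<cong> P"
  shows "M \<cong> P"
proof -
  obtain F G where F: "symmetric_functor M N F" "symmetric_functor N M G"
      "comp_functor M G F = id_functor M" "comp_functor N F G = id_functor N"
    using \<open>M \<cong> N\<close> unfolding isomorphic_def isomorphism_def by blast
  obtain F' G' where F': "symmetric_functor N P F'" "symmetric_functor P N G'"
      "comp_functor N G' F' = id_functor N" "comp_functor P F' G' = id_functor P"
    using \<open>N \<cong> P\<close> unfolding isomorphic_def isomorphism_def by blast
  have FF: "symmetric_functor M P (comp_functor M F' F)" "symmetric_functor P M (comp_functor P G G')"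
    using M P F F' by (auto intro: symmetric_functor_comp)
  have "comp_functor M (comp_functor P G G') (comp_functor M F' F) =
      comp_functor M (comp_functor N (comp_functor P G G') F') F"
    by (rule comp_functor_assoc) fact
  also have "comp_functor N (comp_functor P G G') F' = comp_functor N G (comp_functor N G' F')"
    by (rule comp_functor_assoc[symmetric]) fact
  also have "comp_functor M \<dots> F = comp_functor M G (comp_functor M (comp_functor N G' F') F)"
    by (rule comp_functor_assoc[symmetric]) fact
  also have "\<dots> = id_functor M"
    by (simp add: F' F comp_functor_id_left[OF F(1)])
  finally have 1: "comp_functor M (comp_functor P G G') (comp_functor M F' F) = id_functor M" .
  have "comp_functor P (comp_functor M F' F) (comp_functor P G G') =
      comp_functor P (comp_functor N (comp_functor M F' F) G) G'"
    by (rule comp_functor_assoc) fact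
  also have "comp_functor N (comp_functor M F' F) G = comp_functor N F' (comp_functor N F G)"
    by (rule comp_functor_assoc[symmetric]) fact
  also have "comp_functor P \<dots> G' = comp_functor P F' (comp_functor P (comp_functor N F G) G')"
    by (rule comp_functor_assoc[symmetric]) fact
  also have "\<dots> = id_functor P"
    by (simp add: F' F comp_functor_id_left[OF F'(2)])
  finally have "comp_functor P (comp_functor M F' F) (comp_functor P G G') = id_functor P" .
  with 1 FF show ?thesis
    unfolding isomorphic_def isomorphism_def by blast
qed

section \<open>Sequential multicategories\<close>

text \<open>
  The arrow \<open>\<langle>f\<^sub>1, \<dots>, f\<^sub>n\<rangle> : X\<^sub>1, \<dots>, X\<^sub>n \<rightarrow> X\<close> of \<open>C\<^sub>\<blacktriangleright>\<close> is \<open>([f\<^sub>1, \<dots>, f\<^sub>n], X)\<close>;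
  the codomain has to be recorded since it is not determined by the list when \<open>n = 0\<close>.
\<close>

definition seq :: "('o, 'a) category \<Rightarrow> ('o, 'a list \<times> 'o) multicategory" where
  "seq C = \<lparr>
     Obj = Ob C,
     Arr = {(fs, X). X \<in> Ob C \<and> set fs \<subseteq> {f \<in> Mor C. Tgt C f = X}},
     Dom = (\<lambda>(fs, X). map (Src C) fs),
     Cod = snd,
     Idt = (\<lambda>X. ([Ident C X], X)),
     Comp = (\<lambda>(fs, X) gs. (concat (map2 (\<lambda>f g. map (Cmp C f) (fst g)) fs gs), X)),
     Act = (\<lambda>\<sigma> (fs, X). (permute_list \<sigma> fs, X))\<rparr>"

definition unary :: "('o, 'a) multicategory \<Rightarrow> ('o, 'a) category" where
  "unary M = \<lparr>
     Ob = Obj M,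
     Mor = {f \<in> Arr M. length (Dom M f) = 1},
     Src = (\<lambda>f. hd (Dom M f)),
     Tgt = Cod M,
     Ident = Idt M,
     Cmp = (\<lambda>f g. Comp M f [g])\<rparr>"

abbreviation one_seq :: "(unit, unit list \<times> unit) multicategory" where
  "one_seq \<equiv> seq terminal_category"

definition sequential :: "('o, 'a) multicategory \<Rightarrow> bool" where
  "sequential M \<longleftrightarrow> (\<exists>C :: ('o, 'a) category. category C \<and> M \<cong> seq C)"

lemma composable_seqD:
  assumes "composable (seq C) (fs, X) gs"
  shows "X \<in> Ob C" "set fs \<subseteq> Mor C" "\<And>f. f \<in> set fs \<Longrightarrow> Tgt C f = X" "length gs = length fs"
    "\<And>f g. (f, g) \<in> set (zip fs gs) \<Longrightarrow> snd g = Src C f"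
    "\<And>g. g \<in> set gs \<Longrightarrow> set (fst g) \<subseteq> Mor C"
    "\<And>g h. g \<in> set gs \<Longrightarrow> h \<in> set (fst g) \<Longrightarrow> Tgt C h = snd g"
proof -
  have m: "map snd gs = map (Src C) fs"
    using assms by (simp add: composable_def seq_def)
  show l: "length gs = length fs"
    using m by (metis length_map)
  show "(f, g) \<in> set (zip fs gs) \<Longrightarrow> snd g = Src C f" for f g
    using m l by (auto simp: set_zip list_eq_iff_nth_eq)
qed (use assms in \<open>fastforce simp: composable_def seq_def\<close>)+

lemma Comp_seq_in_Arr:
  assumes C: "category C" and a: "composable (seq C) (fs, X) gs"
  shows "(concat (map2 (\<lambda>f g. map (Cmp C f) (fst g)) fs gs), X) \<in> Arr (seq C)"
proof -
  interpret category C by fact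
  note fg = composable_seqD[OF a]
  have "l \<in> Mor C \<and> Tgt C l = X" if l: "l \<in> set (concat (map2 (\<lambda>f g. map (Cmp C f) (fst g)) fs gs))" for l
  proof -
    obtain f g k where *: "(f, g) \<in> set (zip fs gs)" "k \<in> set (fst g)" "l = Cmp C f k"
      using l by auto
    have "f \<in> set fs" "g \<in> set gs"
      using *(1) by (auto dest: set_zip_leftD set_zip_rightD)
    then show ?thesis
      using Cmp[of f k] fg(2,3) fg(5)[OF *(1)] fg(6,7)[of g] *(2,3) by auto
  qed
  then have "set (concat (map2 (\<lambda>f g. map (Cmp C f) (fst g)) fs gs)) \<subseteq> {f \<in> Mor C. Tgt C f = X}"
    by blast
  then show ?thesis
    using fg(1) by (simp add: seq_def del: set_concat)
qed

text \<open>Functors of categories, given by a pair of maps, act on sequential multicategories.\<close>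

lemma symmetric_functor_seq:
  assumes C: "category C"
    and o: "\<And>X. X \<in> Ob C \<Longrightarrow> p X \<in> Ob D"
    and u: "\<And>f. f \<in> Mor C \<Longrightarrow> u f \<in> Mor D \<and> Src D (u f) = p (Src C f) \<and> Tgt D (u f) = p (Tgt C f)"
    and i: "\<And>X. X \<in> Ob C \<Longrightarrow> u (Ident C X) = Ident D (p X)"
    and c: "\<And>f g. \<lbrakk>f \<in> Mor C; g \<in> Mor C; Src C f = Tgt C g\<rbrakk> \<Longrightarrow> u (Cmp C f g) = Cmp D (u f) (u g)"
  shows "symmetric_functor (seq C) (seq D)
    \<lparr>obj_map = (\<lambda>X \<in> Ob C. p X), arr_map = (\<lambda>(fs, X) \<in> Arr (seq C). (map u fs, p X))\<rparr>"
    (is "symmetric_functor _ _ ?F")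
proof -
  interpret category C by fact
  have arr: "(fs, X) \<in> Arr (seq C) \<longleftrightarrow> X \<in> Ob C \<and> (\<forall>f \<in> set fs. f \<in> Mor C \<and> Tgt C f = X)" for fs X
    by (auto simp: seq_def)
  have comp: "arr_map ?F (Comp (seq C) f gs) = Comp (seq D) (arr_map ?F f) (map (arr_map ?F) gs)"
    if "composable (seq C) f gs" for f gs
  proof -
    obtain fs X where f: "f = (fs, X)" by fastforce
    note fg = composable_seqD[OF that[unfolded f]]
    have fA: "f \<in> Arr (seq C)" and gA: "set gs \<subseteq> Arr (seq C)"
      using that by (auto simp: composable_def)
    have 1: "map (\<lambda>(f, g). map u (map (Cmp C f) (fst g))) (zip fs gs)
      = map (\<lambda>(f, g). map (Cmp D (u f)) (map u (fst g))) (zip fs gs)"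
    proof (rule map_cong[OF HOL.refl])
      fix x assume x: "x \<in> set (zip fs gs)"
      obtain f' g where x': "x = (f', g)" by (rule prod.exhaust)
      have "f' \<in> Mor C" "g \<in> set gs" "snd g = Src C f'"
        using x fg(2) fg(5) by (auto simp: x' dest: set_zip_leftD set_zip_rightD)
      then show "(\<lambda>(f, g). map u (map (Cmp C f) (fst g))) x =
          (\<lambda>(f, g). map (Cmp D (u f)) (map u (fst g))) x"
        using fg(6,7)[of g] c by (auto simp: x')
    qed
    have 2: "map (arr_map ?F) gs = map (\<lambda>g. (map u (fst g), p (snd g))) gs"
      using gA by (auto simp: case_prod_beta)
    have 3: "(concat (map2 (\<lambda>f g. map (Cmp C f) (fst g)) fs gs), X) \<in> Arr (seq C)"
      using Comp_seq_in_Arr[OF C] that f by blast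
    have 4: "map2 (\<lambda>f g. map (Cmp D f) (fst g)) (map u fs) (map (\<lambda>g. (map u (fst g), p (snd g))) gs) =
       map (\<lambda>(f, g). map (Cmp D (u f)) (map u (fst g))) (zip fs gs)"
      by (simp add: zip_map_map case_prod_beta comp_def)
    have 5: "map u (concat (map2 (\<lambda>f g. map (Cmp C f) (fst g)) fs gs)) =
       concat (map (\<lambda>(f, g). map u (map (Cmp C f) (fst g))) (zip fs gs))"
      unfolding map_concat by (rule arg_cong[where f = concat]) auto
    have "arr_map ?F (Comp (seq C) f gs) =
        (map u (concat (map2 (\<lambda>f g. map (Cmp C f) (fst g)) fs gs)), p X)"
      using 3 by (simp add: seq_def f)
    also have "\<dots> = Comp (seq D) (map u fs, p X) (map (\<lambda>g. (map u (fst g), p (snd g))) gs)"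
      unfolding 5 1 by (simp add: seq_def 4)
    also have "(map u fs, p X) = arr_map ?F f"
      using fA f by simp
    finally show ?thesis
      unfolding 2 .
  qed
  show ?thesis
    unfolding symmetric_functor_def
  proof (intro conjI ballI allI impI)
    show "obj_map ?F \<in> Obj (seq C) \<rightarrow>\<^sub>E Obj (seq D)"
      using o by (auto simp: seq_def)
    show "arr_map ?F \<in> Arr (seq C) \<rightarrow>\<^sub>E Arr (seq D)"
      using o u by (auto simp: seq_def subset_iff)
  next
    fix A assume "A \<in> Obj (seq C)"
    then show "arr_map ?F (Idt (seq C) A) = Idt (seq D) (obj_map ?F A)"
      using Ident i by (auto simp: seq_def)
  next
    fix f \<sigma> assume "f \<in> Arr (seq C)" "dom_permutes (seq C) \<sigma> f"
    then show "arr_map ?F (Act (seq C) \<sigma> f) = Act (seq D) \<sigma> (arr_map ?F f)"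
      by (auto simp: seq_def dom_permutes_def permute_list_map)
  next
    fix f assume "f \<in> Arr (seq C)"
    then show "Dom (seq D) (arr_map ?F f) = map (obj_map ?F) (Dom (seq C) f)"
       "Cod (seq D) (arr_map ?F f) = obj_map ?F (Cod (seq C) f)"
      using o u Src by (auto simp: seq_def subset_iff)
  qed (fact comp)
qed

lemma seq_assoc:
  assumes "category C" "length fs = length gs" "length gs = length hss"
    "\<forall>(f, g, hs) \<in> set (zip fs (zip gs hss)). f \<in> Mor C \<and> length hs = length g \<and>
      (\<forall>(k, h) \<in> set (zip g hs). k \<in> Mor C \<and> Src C f = Tgt C k \<and>
        (\<forall>l \<in> set (fst h). l \<in> Mor C \<and> Src C k = Tgt C l))"
  shows "concat (map2 (\<lambda>f h. map (Cmp C f) (fst h)) (concat (map2 (\<lambda>f g. map (Cmp C f) g) fs gs)) (concat hss)) =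
    concat (map2 (\<lambda>f l. map (Cmp C f) l) fs
      (map2 (\<lambda>g hs. concat (map2 (\<lambda>k h. map (Cmp C k) (fst h)) g hs)) gs hss))"
  using assms(2-)
proof (induction fs gs hss rule: list_induct3)
  case (Cons f fs g gs hs hss)
  interpret category C by fact
  have "concat (map2 (\<lambda>f h. map (Cmp C f) (fst h)) (map (Cmp C f) g) hs) =
      map (Cmp C f) (concat (map2 (\<lambda>k h. map (Cmp C k) (fst h)) g hs))"
    if "length g = length hs" "f \<in> Mor C" "\<forall>(k, h) \<in> set (zip g hs). k \<in> Mor C \<and> Src C f = Tgt C k \<and>
        (\<forall>l \<in> set (fst h). l \<in> Mor C \<and> Src C k = Tgt C l)"
    using that by (induction g hs rule: list_induct2) (auto simp: Cmp_assoc)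
  with Cons show ?case
    by simp
qed simp

lemma symmetric_multicategory_seq:
  assumes "category C"
  shows "symmetric_multicategory (seq C)"
proof -
  interpret category C by fact
  let ?h = "\<lambda>f g. map (Cmp C f) (fst g)"
  have D: "map (length \<circ> Dom (seq C)) gs = map length (map2 ?h fs gs)" if "length gs = length fs"
    for gs and fs :: "'b list"
    using that by (auto simp: list_eq_iff_nth_eq seq_def case_prod_beta)
  show ?thesis
  proof
    fix f gs hss assume a: "composable (seq C) f gs" "list_all2 (composable (seq C)) gs hss"
    obtain fs X where f: "f = (fs, X)" by fastforce
    note fg = composable_seqD[OF a(1)[unfolded f]]
    have l: "length fs = length gs" "length gs = length hss"
      using fg a(2) by (auto dest: list_all2_lengthD)
    have "\<forall>(f, g, hs) \<in> set (zip fs (zip (map fst gs) hss)). f \<in> Mor C \<and> length hs = length g \<and>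
      (\<forall>(k, h) \<in> set (zip g hs). k \<in> Mor C \<and> Src C f = Tgt C k \<and>
        (\<forall>l \<in> set (fst h). l \<in> Mor C \<and> Src C k = Tgt C l))"
    proof clarify
      fix f g hs assume z: "(f, g, hs) \<in> set (zip fs (zip (map fst gs) hss))"
      then obtain i where i: "i < length fs" "f = fs ! i" "g = fst (gs ! i)" "hs = hss ! i"
        using l by (auto simp: set_zip)
      have z': "(f, gs ! i) \<in> set (zip fs gs)" and g: "gs ! i \<in> set gs" and fm: "f \<in> set fs"
        using i l by (auto simp: set_zip)
      have "composable (seq C) (g, snd (gs ! i)) hs"
        using i a(2) l by (simp add: list_all2_conv_all_nth)
      note gh = composable_seqD[OF this]
      show "f \<in> Mor C \<and> length hs = length g \<and>
      (\<forall>(k, h) \<in> set (zip g hs). k \<in> Mor C \<and> Src C f = Tgt C k \<and>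
        (\<forall>l \<in> set (fst h). l \<in> Mor C \<and> Src C k = Tgt C l))"
      proof (intro conjI ballI, goal_cases)
        case (3 x)
        obtain k h where x: "x = (k, h)" by (rule prod.exhaust)
        have kh: "k \<in> set g" "h \<in> set hs" "snd h = Src C k"
          using 3 gh(5) by (auto simp: x dest: set_zip_leftD set_zip_rightD)
        have "k \<in> Mor C" "Src C f = Tgt C k"
          using kh(1) gh(2,3) fg(5)[OF z'] by auto
        moreover have "l \<in> Mor C \<and> Src C k = Tgt C l" if "l \<in> set (fst h)" for l
          using gh(6,7)[OF kh(2)] that kh(3) by auto
        ultimately show ?case
          by (simp add: x)
      qed (use fm fg(2) gh(4) in auto)
    qed
    from seq_assoc[OF assms _ _ this] l
    have "concat (map2 ?h (concat (map2 (\<lambda>f g. map (Cmp C f) g) fs (map fst gs))) (concat hss)) =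
        concat (map2 (\<lambda>f l. map (Cmp C f) l) fs
          (map2 (\<lambda>g hs. concat (map2 ?h g hs)) (map fst gs) hss))"
      by simp
    also have "map2 (\<lambda>f g. map (Cmp C f) g) fs (map fst gs) = map2 ?h fs gs"
      using l by (simp add: list_eq_iff_nth_eq)
    also have "map2 (\<lambda>f l. map (Cmp C f) l) fs (map2 (\<lambda>g hs. concat (map2 ?h g hs)) (map fst gs) hss) =
       map2 ?h fs (map2 (Comp (seq C)) gs hss)"
      using l by (simp add: list_eq_iff_nth_eq seq_def case_prod_beta)
    finally show "Comp (seq C) (Comp (seq C) f gs) (concat hss) = Comp (seq C) f (map2 (Comp (seq C)) gs hss)"
      by (simp add: seq_def f)
  next
    fix f gs \<sigma> assume a: "composable (seq C) f gs" "dom_permutes (seq C) \<sigma> f"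
    obtain fs X where f: "f = (fs, X)" by fastforce
    have l: "length gs = length fs"
      using composable_seqD(4)[OF a(1)[unfolded f]] .
    have p: "\<sigma> permutes {..<length fs}"
      using a(2) by (simp add: dom_permutes_def f seq_def)
    have "map2 ?h (permute_list \<sigma> fs) (permute_list \<sigma> gs) = permute_list \<sigma> (map2 ?h fs gs)"
      using p l by (subst permute_list_map) (auto simp: permute_list_zip)
    then show "Comp (seq C) (Act (seq C) \<sigma> f) (permute_list \<sigma> gs) =
        Act (seq C) (block_perm \<sigma> (map (length \<circ> Dom (seq C)) gs)) (Comp (seq C) f gs)"
      using p l unfolding D[OF l] by (simp add: seq_def f permute_block_perm del: map_map)
  next
    fix f gs \<sigma>s assume a: "composable (seq C) f gs" "list_all2 (dom_permutes (seq C)) \<sigma>s gs"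
    obtain fs X where f: "f = (fs, X)" by fastforce
    have l: "length gs = length fs" "length \<sigma>s = length fs"
      using composable_seqD(4)[OF a(1)[unfolded f]] a(2) by (auto dest: list_all2_lengthD)
    have p: "\<sigma>s ! i permutes {..<length (fst (gs ! i))}" if "i < length fs" for i
      using a(2) that l by (auto simp: list_all2_conv_all_nth dom_permutes_def seq_def case_prod_beta)
    have 1: "list_all2 (\<lambda>\<sigma> xs. \<sigma> permutes {..<length xs}) \<sigma>s (map2 ?h fs gs)"
      using p l by (simp add: list_all2_conv_all_nth)
    have 2: "map2 ?h fs (map2 (Act (seq C)) \<sigma>s gs) = map2 permute_list \<sigma>s (map2 ?h fs gs)"
      using l p by (simp add: list_eq_iff_nth_eq[where xs="map2 _ _ _"] seq_def case_prod_beta permute_list_map)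
    show "Comp (seq C) f (map2 (Act (seq C)) \<sigma>s gs) =
        Act (seq C) (sum_perm \<sigma>s (map (length \<circ> Dom (seq C)) gs)) (Comp (seq C) f gs)"
      unfolding D[OF l(1)] using permute_sum_perm[OF 1] 2 by (simp add: seq_def f del: map_map)
  next
    fix f gs assume a: "composable (seq C) f gs"
    obtain fs X where f: "f = (fs, X)" by fastforce
    note fg = composable_seqD[OF a[unfolded f]]
    have "(concat (map2 ?h fs gs), X) \<in> Arr (seq C)"
      using Comp_seq_in_Arr[OF assms] a f by blast
    moreover have "map (Src C) (concat (map2 ?h fs gs)) = concat (map (\<lambda>g. map (Src C) (fst g)) gs)"
    proof -
      have "map (map (Src C)) (map2 ?h fs gs) = map (\<lambda>g. map (Src C) (fst g)) gs"
      proof (rule nth_equalityI)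
        fix i assume "i < length (map (map (Src C)) (map2 ?h fs gs))"
        then have i: "i < length fs" "i < length gs" by auto
        then have z: "(fs ! i, gs ! i) \<in> set (zip fs gs)" "gs ! i \<in> set gs" "fs ! i \<in> set fs"
          by (auto simp: set_zip)
        show "map (map (Src C)) (map2 ?h fs gs) ! i = map (\<lambda>g. map (Src C) (fst g)) gs ! i"
          using i fg(2) fg(5)[OF z(1)] fg(6,7)[OF z(2)] z(3) Cmp by (auto simp: subset_iff)
      qed (use fg in auto)
      then show ?thesis by (simp add: map_concat)
    qed
    ultimately show "Comp (seq C) f gs \<in> Arr (seq C) \<and>
          Dom (seq C) (Comp (seq C) f gs) = concat (map (Dom (seq C)) gs) \<and>
          Cod (seq C) (Comp (seq C) f gs) = Cod (seq C) f"
      by (simp add: seq_def f case_prod_unfold del: set_concat map_concat)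
  next
    fix f assume "f \<in> Arr (seq C)"
    then obtain fs X where f: "f = (fs, X)" "set fs \<subseteq> Mor C" by (auto simp: seq_def)
    have "map2 ?h fs (map (\<lambda>X. ([Ident C X], X)) (map (Src C) fs)) = map (\<lambda>f. [f]) fs"
      using f(2) by (induction fs) (auto simp: Cmp_Ident_right)
    then show "Comp (seq C) f (map (Idt (seq C)) (Dom (seq C) f)) = f"
      by (simp add: seq_def f del: map_map)
  next
    fix f \<sigma> \<tau> assume "f \<in> Arr (seq C)" "dom_permutes (seq C) \<sigma> f" "dom_permutes (seq C) \<tau> f"
    then show "Act (seq C) \<tau> (Act (seq C) \<sigma> f) = Act (seq C) (\<sigma> \<circ> \<tau>) f"
      by (auto simp: seq_def dom_permutes_def permute_list_compose)
  next
    fix f assume "f \<in> Arr (seq C)"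
    then show "Comp (seq C) (Idt (seq C) (Cod (seq C) f)) [f] = f"
      by (auto simp: seq_def subset_iff intro!: map_idI Cmp_Ident_left)
  next
    fix f \<sigma> assume "f \<in> Arr (seq C)" "dom_permutes (seq C) \<sigma> f"
    then show "Act (seq C) \<sigma> f \<in> Arr (seq C) \<and>
        Dom (seq C) (Act (seq C) \<sigma> f) = permute_list \<sigma> (Dom (seq C) f) \<and>
        Cod (seq C) (Act (seq C) \<sigma> f) = Cod (seq C) f"
      by (auto simp: seq_def dom_permutes_def permute_list_map)
  next
    fix f assume "f \<in> Arr (seq C)"
    then show "set (Dom (seq C) f) \<subseteq> Obj (seq C)" "Cod (seq C) f \<in> Obj (seq C)"
      "Act (seq C) id f = f"
      using Src by (auto simp: seq_def)
  next
    fix A assume "A \<in> Obj (seq C)"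
    then show "Idt (seq C) A \<in> Arr (seq C) \<and> Dom (seq C) (Idt (seq C) A) = [A] \<and>
        Cod (seq C) (Idt (seq C) A) = A"
      using Ident by (auto simp: seq_def)
  qed
qed

text \<open>
  The definition of \<^const>\<open>sequential\<close> can only quantify over categories on the types of \<open>M\<close>;
  this loses nothing, since a category on any other types would do as well.
\<close>

lemma sequentialI:
  fixes M :: "('o, 'a) multicategory" and C :: "('p, 'b) category"
  assumes M: "symmetric_multicategory M" and C: "category C" and iso: "M \<cong> seq C"
  shows "sequential M"
proof -
  obtain F G where F: "symmetric_functor M (seq C) F" and G: "symmetric_functor (seq C) M G"
    and GF: "comp_functor M G F = id_functor M"
    and FG: "comp_functor (seq C) F G = id_functor (seq C)"
    using iso unfolding isomorphic_def isomorphism_def by blast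
  define u v p w where u: "u = (\<lambda>c. arr_map G ([c], Tgt C c))" and v: "v = (\<lambda>a. hd (fst (arr_map F a)))"
    and p: "p = obj_map G" and w: "w = obj_map F"
  interpret M: symmetric_multicategory M by fact
  interpret C: category C by fact
  have F0: "w A \<in> Ob C" if "A \<in> Obj M" for A
    using F that by (auto simp: symmetric_functor_def w seq_def)
  have G0: "p X \<in> Obj M" if "X \<in> Ob C" for X
    using G that by (auto simp: symmetric_functor_def p seq_def)
  have pw: "p (w A) = A" if "A \<in> Obj M" for A
    using that fun_cong[OF arg_cong[OF GF, of obj_map], of A]
    by (simp add: comp_functor_def id_functor_def compose_def p w)
  have wp: "w (p X) = X" if "X \<in> Ob C" for X
    using that fun_cong[OF arg_cong[OF FG, of obj_map], of X]
    by (simp add: comp_functor_def id_functor_def compose_def p w seq_def)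
  have fg: "arr_map F (arr_map G c) = c" if "c \<in> Arr (seq C)" for c
    using that fun_cong[OF arg_cong[OF FG, of arr_map], of c]
    by (simp add: comp_functor_def id_functor_def compose_def)
  have vu: "v (u c) = c" if "c \<in> Mor C" for c
    using that fg[of "([c], Tgt C c)"] C.Tgt by (simp add: u v seq_def)
  define D :: "('o, 'a) category" where "D = \<lparr>Ob = Obj M, Mor = u ` Mor C,
     Src = (\<lambda>a. p (Src C (v a))), Tgt = (\<lambda>a. p (Tgt C (v a))),
     Ident = (\<lambda>A. u (Ident C (w A))), Cmp = (\<lambda>a b. u (Cmp C (v a) (v b)))\<rparr>"
  have pinj: "p X = p Y \<longleftrightarrow> X = Y" if "X \<in> Ob C" "Y \<in> Ob C" for X Y
    using that wp by metis
  have D: "category D"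
    unfolding D_def
    by standard (auto simp: vu wp pw pinj F0 G0 C.Src C.Tgt C.Ident C.Cmp C.Cmp_Ident_left
        C.Cmp_Ident_right C.Cmp_assoc)
  define H K where H: "H = \<lparr>obj_map = (\<lambda>X \<in> Ob C. p X), arr_map = (\<lambda>(fs, X) \<in> Arr (seq C). (map u fs, p X))\<rparr>"
    and K: "K = \<lparr>obj_map = (\<lambda>X \<in> Ob D. w X), arr_map = (\<lambda>(fs, X) \<in> Arr (seq D). (map v fs, w X))\<rparr>"
  have HF: "symmetric_functor (seq C) (seq D) H"
    unfolding H by (rule symmetric_functor_seq[OF C])
      (auto simp: D_def G0 vu wp C.Src C.Tgt C.Ident C.Cmp)
  have KF: "symmetric_functor (seq D) (seq C) K"
    unfolding K by (rule symmetric_functor_seq[OF D])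
      (auto simp: D_def F0 vu wp pinj C.Src C.Tgt C.Ident C.Cmp)
  have SC: "symmetric_multicategory (seq C)" and SD: "symmetric_multicategory (seq D)"
    using C D by (auto intro: symmetric_multicategory_seq)
  have KH: "comp_functor (seq C) K H = id_functor (seq C)"
  proof -
    have "obj_map (comp_functor (seq C) K H) X = obj_map (id_functor (seq C)) X" for X
      by (auto simp: comp_functor_def id_functor_def compose_def H K seq_def D_def wp G0)
    moreover have "arr_map (comp_functor (seq C) K H) f = arr_map (id_functor (seq C)) f" for f
      by (cases f) (auto simp: comp_functor_def id_functor_def compose_def H K seq_def D_def wp vu G0
          subset_iff intro!: map_idI)
    ultimately show ?thesis
      by (auto intro!: multifunctor.equality)
  qed
  have HK: "comp_functor (seq D) H K = id_functor (seq D)"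
  proof -
    have "obj_map (comp_functor (seq D) H K) X = obj_map (id_functor (seq D)) X" for X
      by (auto simp: comp_functor_def id_functor_def compose_def H K seq_def D_def pw F0)
    moreover have "arr_map (comp_functor (seq D) H K) f = arr_map (id_functor (seq D)) f" for f
    proof (cases "f \<in> Arr (seq D)")
      case True
      obtain fs A where f: "f = (fs, A)"
        by (rule prod.exhaust)
      have A: "A \<in> Obj M" and fs: "\<And>a. a \<in> set fs \<Longrightarrow> a \<in> u ` Mor C \<and> p (Tgt C (v a)) = A"
        using True by (auto simp: f seq_def D_def)
      have "v a \<in> Mor C \<and> Tgt C (v a) = w A \<and> u (v a) = a" if "a \<in> set fs" for a
        using fs[OF that] C.Tgt by (auto simp: vu wp)
      then have "(map v fs, w A) \<in> Arr (seq C)" "map (u \<circ> v) fs = fs"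
        using F0[OF A] by (auto simp: seq_def intro: map_idI)
      then show ?thesis
        using True A by (simp add: f comp_functor_def id_functor_def compose_def H K pw)
    qed (simp add: comp_functor_def id_functor_def compose_def)
    ultimately show ?thesis
      by (auto intro!: multifunctor.equality)
  qed
  have "M \<cong> seq D"
    by (rule isomorphic_trans[OF M SC SD iso])
      (use HF KF KH HK in \<open>auto simp: isomorphic_def isomorphism_def\<close>)
  with D show ?thesis
    unfolding sequential_def by blast
qed

section \<open>The internal hom and the center\<close>

text \<open>
  An arrow \<open>\<alpha> : F\<^sub>1, \<dots>, F\<^sub>n \<rightarrow> F\<close> is a triple \<open>([F\<^sub>1, \<dots>, F\<^sub>n], F, \<alpha>)\<close> with \<open>\<alpha>\<close> extensional.
\<close>

type_synonym ('o, 'a, 'p, 'b) transf =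
  "('o, 'a, 'p, 'b) multifunctor list \<times> ('o, 'a, 'p, 'b) multifunctor \<times> ('o \<Rightarrow> 'b)"

definition component :: "('o, 'a, 'p, 'b) transf \<Rightarrow> 'o \<Rightarrow> 'b" where
  "component = (\<lambda>(Fs, F, \<alpha>). \<alpha>)"

definition natural ::
  "('o, 'a) multicategory \<Rightarrow> ('p, 'b) multicategory \<Rightarrow> ('o, 'a, 'p, 'b) transf \<Rightarrow> bool"
where
  "natural M N = (\<lambda>(Fs, F, \<alpha>).
     (\<forall>G \<in> set Fs. symmetric_functor M N G) \<and> symmetric_functor M N F \<and>
     \<alpha> \<in> Obj M \<rightarrow>\<^sub>E Arr N \<and>
     (\<forall>A \<in> Obj M. Dom N (\<alpha> A) = map (\<lambda>G. obj_map G A) Fs \<and> Cod N (\<alpha> A) = obj_map F A) \<and>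
     (\<forall>f \<in> Arr M.
        Comp N (arr_map F f) (map \<alpha> (Dom M f)) =
        Act N (transpose_perm (length (Dom M f)) (length Fs))
          (Comp N (\<alpha> (Cod M f)) (map (\<lambda>G. arr_map G f) Fs))))"

definition hom :: "('o, 'a) multicategory \<Rightarrow> ('p, 'b) multicategory \<Rightarrow>
  (('o, 'a, 'p, 'b) multifunctor, ('o, 'a, 'p, 'b) transf) multicategory"
where
  "hom M N = \<lparr>
     Obj = {F. symmetric_functor M N F},
     Arr = {\<alpha>. natural M N \<alpha>},
     Dom = (\<lambda>(Fs, F, \<alpha>). Fs),
     Cod = (\<lambda>(Fs, F, \<alpha>). F),
     Idt = (\<lambda>F. ([F], F, \<lambda>A \<in> Obj M. Idt N (obj_map F A))),
     Comp = (\<lambda>(Fs, F, \<alpha>) \<beta>s. (concat (map fst \<beta>s), F,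
       \<lambda>A \<in> Obj M. Comp N (\<alpha> A) (map (\<lambda>\<beta>. component \<beta> A) \<beta>s))),
     Act = (\<lambda>\<sigma> (Fs, F, \<alpha>). (permute_list \<sigma> Fs, F, \<lambda>A \<in> Obj M. Act N \<sigma> (\<alpha> A)))\<rparr>"

definition full_sub :: "'o set \<Rightarrow> ('o, 'a) multicategory \<Rightarrow> ('o, 'a) multicategory" where
  "full_sub S M = M\<lparr>Obj := S, Arr := {f \<in> Arr M. set (Dom M f) \<subseteq> S \<and> Cod M f \<in> S}\<rparr>"

definition center :: "('o, 'a) multicategory \<Rightarrow>
  (('o, 'a, 'o, 'a) multifunctor, ('o, 'a, 'o, 'a) transf) multicategory"
where
  "center M = full_sub {id_functor M} (hom M M)"

definition central_monoid :: "('o, 'a) multicategory \<Rightarrow>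
  (unit, unit list \<times> unit, ('o, 'a, 'o, 'a) multifunctor, ('o, 'a, 'o, 'a) transf) multifunctor
  \<Rightarrow> bool"
where
  "central_monoid M U \<longleftrightarrow>
     symmetric_functor one_seq (hom M M) U \<and> obj_map U () = id_functor M"

definition central_unital_magma ::
  "('o, 'a) multicategory \<Rightarrow> ('o, 'a, 'o, 'a) transf \<Rightarrow> ('o, 'a, 'o, 'a) transf \<Rightarrow> bool"
where
  "central_unital_magma M m0 m2 \<longleftrightarrow>
     (let Z = center M; idt = Idt Z (id_functor M) in
        m0 \<in> Arr Z \<and> length (Dom Z m0) = 0 \<and> m2 \<in> Arr Z \<and> length (Dom Z m2) = 2 \<and>
        Comp Z m2 [m0, idt] = idt \<and> Comp Z m2 [idt, m0] = idt)"

text \<open>The functor \<open>[1\<^sub>\<blacktriangleright>, M] \<rightarrow> M\<close> forgetting the monoid structure.\<close>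

definition forget_monoid :: "('o, 'a) multicategory \<Rightarrow>
  ((unit, unit list \<times> unit, 'o, 'a) multifunctor, (unit, unit list \<times> unit, 'o, 'a) transf, 'o, 'a)
  multifunctor"
where
  "forget_monoid M = \<lparr>
     obj_map = (\<lambda>F \<in> Obj (hom one_seq M). obj_map F ()),
     arr_map = (\<lambda>\<alpha> \<in> Arr (hom one_seq M). component \<alpha> ())\<rparr>"

section \<open>The Boardman--Vogt tensor product\<close>

text \<open>
  Formal expressions for the arrows of \<open>M \<otimes> N\<close>: \<open>GenL f X\<close> is \<open>f\<^sub>X\<close> and \<open>GenR A h\<close> is \<open>h\<^sub>A\<close>.
\<close>

datatype ('o, 'a, 'p, 'b) bv_term =
    GenL 'a 'p
  | GenR 'o 'b
  | TIdt "'o \<times> 'p"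
  | TComp "('o, 'a, 'p, 'b) bv_term" "('o, 'a, 'p, 'b) bv_term list"
  | TAct "nat \<Rightarrow> nat" "('o, 'a, 'p, 'b) bv_term"

context
  fixes M :: "('o, 'a) multicategory" and N :: "('p, 'b) multicategory"
begin

fun tdom :: "('o, 'a, 'p, 'b) bv_term \<Rightarrow> ('o \<times> 'p) list" where
  "tdom (GenL f X) = map (\<lambda>A. (A, X)) (Dom M f)"
| "tdom (GenR A h) = map (\<lambda>X. (A, X)) (Dom N h)"
| "tdom (TIdt P) = [P]"
| "tdom (TComp s ts) = concat (map tdom ts)"
| "tdom (TAct \<sigma> t) = permute_list \<sigma> (tdom t)"

fun tcod :: "('o, 'a, 'p, 'b) bv_term \<Rightarrow> 'o \<times> 'p" where
  "tcod (GenL f X) = (Cod M f, X)"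
| "tcod (GenR A h) = (A, Cod N h)"
| "tcod (TIdt P) = P"
| "tcod (TComp s ts) = tcod s"
| "tcod (TAct \<sigma> t) = tcod t"

fun twf :: "('o, 'a, 'p, 'b) bv_term \<Rightarrow> bool" where
  "twf (GenL f X) \<longleftrightarrow> f \<in> Arr M \<and> X \<in> Obj N"
| "twf (GenR A h) \<longleftrightarrow> A \<in> Obj M \<and> h \<in> Arr N"
| "twf (TIdt P) \<longleftrightarrow> P \<in> Obj M \<times> Obj N"
| "twf (TComp s ts) \<longleftrightarrow> twf s \<and> (\<forall>t \<in> set ts. twf t) \<and> map tcod ts = tdom s"
| "twf (TAct \<sigma> t) \<longleftrightarrow> twf t \<and> \<sigma> permutes {..<length (tdom t)}"

text \<open>
  The least congruence on well-formed expressions containing the laws of a symmetric multicategory,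
  the functoriality of the \<open>(-)\<^sub>X\<close> and \<open>(-)\<^sub>A\<close>, and the interchange law.
\<close>

inductive bv_eq :: "('o, 'a, 'p, 'b) bv_term \<Rightarrow> ('o, 'a, 'p, 'b) bv_term \<Rightarrow> bool" where
  refl: "twf t \<Longrightarrow> bv_eq t t"
| sym: "bv_eq s t \<Longrightarrow> bv_eq t s"
| trans: "\<lbrakk>bv_eq s t; bv_eq t u\<rbrakk> \<Longrightarrow> bv_eq s u"
| cong_TComp: "\<lbrakk>bv_eq s t; list_all2 bv_eq ss ts; twf (TComp s ss); twf (TComp t ts)\<rbrakk> \<Longrightarrow>
    bv_eq (TComp s ss) (TComp t ts)"
| cong_TAct: "\<lbrakk>bv_eq s t; twf (TAct \<sigma> s); twf (TAct \<sigma> t)\<rbrakk> \<Longrightarrow> bv_eq (TAct \<sigma> s) (TAct \<sigma> t)"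
| TComp_TIdt_left: "twf t \<Longrightarrow> bv_eq (TComp (TIdt (tcod t)) [t]) t"
| TComp_TIdt_right: "twf t \<Longrightarrow> bv_eq (TComp t (map TIdt (tdom t))) t"
| TComp_assoc: "\<lbrakk>twf (TComp s ts); list_all2 (\<lambda>t us. twf (TComp t us)) ts uss\<rbrakk> \<Longrightarrow>
    bv_eq (TComp (TComp s ts) (concat uss)) (TComp s (map2 TComp ts uss))"
| TAct_id: "twf t \<Longrightarrow> bv_eq (TAct id t) t"
| TAct_TAct: "\<lbrakk>twf (TAct \<sigma> t); twf (TAct \<tau> t)\<rbrakk> \<Longrightarrow>
    bv_eq (TAct \<tau> (TAct \<sigma> t)) (TAct (\<sigma> \<circ> \<tau>) t)"
| TComp_TAct_left: "\<lbrakk>twf (TComp s ts); twf (TAct \<sigma> s)\<rbrakk> \<Longrightarrow>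
    bv_eq (TComp (TAct \<sigma> s) (permute_list \<sigma> ts))
      (TAct (block_perm \<sigma> (map (length \<circ> tdom) ts)) (TComp s ts))"
| TComp_TAct_right: "\<lbrakk>twf (TComp s ts); list_all2 (\<lambda>\<sigma> t. twf (TAct \<sigma> t)) \<sigma>s ts\<rbrakk> \<Longrightarrow>
    bv_eq (TComp s (map2 TAct \<sigma>s ts))
      (TAct (sum_perm \<sigma>s (map (length \<circ> tdom) ts)) (TComp s ts))"
| GenL_Idt: "\<lbrakk>A \<in> Obj M; X \<in> Obj N\<rbrakk> \<Longrightarrow> bv_eq (GenL (Idt M A) X) (TIdt (A, X))"
| GenL_Comp: "\<lbrakk>composable M f gs; X \<in> Obj N\<rbrakk> \<Longrightarrow>
    bv_eq (GenL (Comp M f gs) X) (TComp (GenL f X) (map (\<lambda>g. GenL g X) gs))"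
| GenL_Act: "\<lbrakk>f \<in> Arr M; dom_permutes M \<sigma> f; X \<in> Obj N\<rbrakk> \<Longrightarrow>
    bv_eq (GenL (Act M \<sigma> f) X) (TAct \<sigma> (GenL f X))"
| GenR_Idt: "\<lbrakk>A \<in> Obj M; X \<in> Obj N\<rbrakk> \<Longrightarrow> bv_eq (GenR A (Idt N X)) (TIdt (A, X))"
| GenR_Comp: "\<lbrakk>A \<in> Obj M; composable N h ks\<rbrakk> \<Longrightarrow>
    bv_eq (GenR A (Comp N h ks)) (TComp (GenR A h) (map (GenR A) ks))"
| GenR_Act: "\<lbrakk>A \<in> Obj M; h \<in> Arr N; dom_permutes N \<sigma> h\<rbrakk> \<Longrightarrow>
    bv_eq (GenR A (Act N \<sigma> h)) (TAct \<sigma> (GenR A h))"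
| interchange: "\<lbrakk>f \<in> Arr M; h \<in> Arr N\<rbrakk> \<Longrightarrow>
    bv_eq (TComp (GenL f (Cod N h)) (map (\<lambda>A. GenR A h) (Dom M f)))
      (TAct (transpose_perm (length (Dom M f)) (length (Dom N h)))
        (TComp (GenR (Cod M f) h) (map (GenL f) (Dom N h))))"

definition bv_rel :: "('o, 'a, 'p, 'b) bv_term rel" where
  "bv_rel = {(s, t). bv_eq s t}"

abbreviation bv_class :: "('o, 'a, 'p, 'b) bv_term \<Rightarrow> ('o, 'a, 'p, 'b) bv_term set" where
  "bv_class t \<equiv> bv_rel `` {t}"

definition bv_rep :: "('o, 'a, 'p, 'b) bv_term set \<Rightarrow> ('o, 'a, 'p, 'b) bv_term" where
  "bv_rep c = (SOME t. t \<in> c)"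

definition tensor :: "('o \<times> 'p, ('o, 'a, 'p, 'b) bv_term set) multicategory" where
  "tensor = \<lparr>
     Obj = Obj M \<times> Obj N,
     Arr = {t. twf t} // bv_rel,
     Dom = (\<lambda>c. tdom (bv_rep c)),
     Cod = (\<lambda>c. tcod (bv_rep c)),
     Idt = (\<lambda>P. bv_class (TIdt P)),
     Comp = (\<lambda>c cs. bv_class (TComp (bv_rep c) (map bv_rep cs))),
     Act = (\<lambda>\<sigma> c. bv_class (TAct \<sigma> (bv_rep c)))\<rparr>"

end

text \<open>The functor \<open>M \<rightarrow> 1\<^sub>\<blacktriangleright> \<otimes> M\<close> sending \<open>f\<close> to \<open>f\<^sub>\<star>\<close>.\<close>

definition tensor_unit_map :: "('o, 'a) multicategory \<Rightarrow>
  ('o, 'a, unit \<times> 'o, (unit, unit list \<times> unit, 'o, 'a) bv_term set) multifunctor"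
where
  "tensor_unit_map M = \<lparr>
     obj_map = (\<lambda>A \<in> Obj M. ((), A)),
     arr_map = (\<lambda>f \<in> Arr M. bv_class one_seq M (GenR () f))\<rparr>"

end

(*
  A unital magma (z, m) in the center gives f(m, ..., m) = \<sigma> m(f, f) for every arrow f. Precomposing
  with identities and units z splits off one input of f after another, so that f is the iterated
  product of its components f(z, ..., z, 1, z, ..., z), and every family of unary arrows into a common
  object arises from exactly one f. Hence M is sequential. In a sequential multicategory the arrows
  \<langle>1, ..., 1\<rangle> form a natural family of commutative monoids, one on each object, and there are no other
  commutative monoids. Such a family is what a central monoid, an inverse of [one_seq, M] \<rightarrow> M and an
  inverse of M \<rightarrow> one_seq \<otimes> M each provide. Conversely it makes the first functor invertible by uniqueness, and
  the second by an Eckmann-Hilton argument in one_seq \<otimes> M, which identifies both monoid structures there.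
*)
theory Submission
  imports Defs
begin

section \<open>Rearrangements of lists\<close>

text \<open>All six conditions meet in one notion, \<open>natural_monoids\<close>: a commutative
  monoid on every object whose operations commute with every arrow of \<open>M\<close>. The obstacle
  in rebuilding \<open>M\<close> from unary arrows is the permutation in the interchange law.
  Plugging in units disposes of it: the inputs that remain either keep their order
  (\<open>block_perm_split\<close>) or reduce to a single one, so the permutation becomes the
  identity. A magma suffices there because only the unit laws are used to cancel; associativity and
  commutativity come afterwards, from the identities of the category \<open>unary M\<close>. The
  splitting is stated for a single arrow, with unit laws only at the objects it meets, because in
  \<open>tensor one_seq M\<close> it has to be applied to two monoids on one object before all
  arrows are known to commute with them. Arrows of the tensor product are classes of formal
  expressions, so they are compared with arrows of \<open>M\<close> by a recursive evaluation that
  respects the generating relations.\<close>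

lemma concat_map_upt_blocks:
  "concat (map (\<lambda>i. map (d i) [0..<m]) [0..<n]) = map (\<lambda>p. d (p div m) (p mod m)) [0..<n * m]"
proof (induction n)
  case (Suc n)
  have "map (\<lambda>p. d (p div m) (p mod m)) [n * m..<n * m + m] = map (d n) [0..<m]"
    by (rule nth_equalityI) auto
  then show ?case
    using Suc upt_add_eq_append[of 0 "n * m" m] by (simp add: add.commute)
qed simp

lemma transpose_perm_less:
  assumes "p < m * (n::nat)"
  shows "(p mod n) * m + p div n < m * n"
proof -
  have "n > 0"
    using assms by (auto intro: Nat.gr0I)
  then have "p div n < m" and "p mod n < n"
    using assms by (auto simp: less_mult_imp_div_less)
  then have "(p mod n) * m + p div n < (p mod n) * m + m" "Suc (p mod n) * m \<le> n * m"
    by (simp_all only: add_less_cancel_left mult_le_mono1 Suc_leI)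
  then show ?thesis
    by (simp add: mult.commute)
qed

text \<open>Writing \<open>p = i * m + j\<close> with \<open>j < m\<close> turns a transposition
  into the exchange of quotient and remainder; doing so with both shapes restores
  \<open>p\<close>.\<close>

lemma transpose_perm_inverse: "transpose_perm m n (transpose_perm n m p) = p"
proof (cases "p < m * n")
  case True
  then have "m > 0"
    by (auto intro: Nat.gr0I)
  then have "p mod m < m" "p div m < n"
    using True by (auto simp: less_mult_imp_div_less mult.commute)
  then show ?thesis
    using True transpose_perm_less[of p n m] by (simp add: transpose_perm_def mult.commute)
qed (simp add: transpose_perm_def mult.commute)

lemma transpose_perm_comp: "transpose_perm m n \<circ> transpose_perm n m = id"
  by (simp add: fun_eq_iff transpose_perm_inverse)

lemma transpose_perm_permutes: "transpose_perm m n permutes {..<m * n}"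
proof -
  have "bij (transpose_perm m n)"
    by (intro o_bij[of "transpose_perm n m"] transpose_perm_comp)
  then show ?thesis
    by (simp add: permutes_def bij_iff transpose_perm_def)
qed

text \<open>A table without rows or without columns has nothing to transpose. Hence the interchange
  law carries no permutation when a unit or a nullary arrow is involved.\<close>

lemma transpose_perm_degenerate [simp]:
  "transpose_perm 0 n = id" "transpose_perm n 0 = id"
  by (auto simp: transpose_perm_def)

lemma permute_list_transpose_perm:
  "permute_list (transpose_perm m n) (concat (map (\<lambda>i. map (d i) [0..<m]) [0..<n])) =
   concat (map (\<lambda>j. map (\<lambda>i. d i j) [0..<n]) [0..<m])"
proof -
  have "d (transpose_perm m n p div m) (transpose_perm m n p mod m) = d (p mod n) (p div n)"
    "transpose_perm m n p < m * n" if "p < m * n" for p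
  proof -
    have "p div n < m"
      using that by (simp add: less_mult_imp_div_less)
    then show "d (transpose_perm m n p div m) (transpose_perm m n p mod m) = d (p mod n) (p div n)"
      using that by (simp add: transpose_perm_def)
    show "transpose_perm m n p < m * n"
      using that transpose_perm_less[OF that] by (simp add: transpose_perm_def)
  qed
  then show ?thesis
    by (simp add: concat_map_upt_blocks permute_list_def mult.commute[of n m])
qed

lemma permute_list_transpose_perm_lists:
  "permute_list (transpose_perm (length xs) (length ys)) (concat (map (\<lambda>y. map (\<lambda>x. g x y) xs) ys)) =
   concat (map (\<lambda>x. map (g x) ys) xs)"
proof -
  have "map (\<lambda>i. map (\<lambda>j. g (xs ! j) (ys ! i)) [0..<length xs]) [0..<length ys] =
      map (\<lambda>y. map (\<lambda>x. g x y) xs) ys"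
    "map (\<lambda>j. map (\<lambda>i. g (xs ! j) (ys ! i)) [0..<length ys]) [0..<length xs] = map (\<lambda>x. map (g x) ys) xs"
    by (intro nth_equalityI; simp)+
  then show ?thesis
    using permute_list_transpose_perm[of "length xs" "length ys" "\<lambda>i j. g (xs ! j) (ys ! i)"] by simp
qed

lemma permute_list_transpose_perm_replicate:
  "permute_list (transpose_perm (length xs) n) (concat (replicate n xs)) =
   concat (map (replicate n) xs)"
  using permute_list_transpose_perm_lists[of xs "[0..<n]" "\<lambda>x _. x"]
  by (simp add: map_replicate_const)

text \<open>The lists are the two rows of a table, and its columns are the pairs. This is the shape
  of the interchange law for a binary operation.\<close>

lemma permute_list_transpose_perm_append:
  assumes "length ys = length xs"
  shows "permute_list (transpose_perm (length xs) 2) (xs @ ys) = concat (map2 (\<lambda>x y. [x, y]) xs ys)"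
proof -
  have "map (\<lambda>j. map (\<lambda>i. [xs, ys] ! i ! j) [0..<2]) [0..<length xs] = map2 (\<lambda>x y. [x, y]) xs ys"
    using assms by (intro nth_equalityI) (auto simp: numeral_2_eq_2)
  moreover have "concat (map (\<lambda>i. map ((!) ([xs, ys] ! i)) [0..<length xs]) [0..<2]) = xs @ ys"
    using map_nth[of ys] assms by (simp add: numeral_2_eq_2 map_nth)
  ultimately show ?thesis
    using permute_list_transpose_perm[of "length xs" 2 "\<lambda>i j. [xs, ys] ! i ! j"] by metis
qed

text \<open>The hypothesis makes \<open>is\<close> a distinct enumeration of \<open>{..<n}\<close>.
  Multisets are convenient here because neither moving blocks nor permuting inside them changes the
  multiset of a concatenation.\<close>

lemma list_perm_permutes:
  assumes "mset is = mset [0..<n]"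
  shows "list_perm is permutes {..<n}"
proof -
  have n: "length is = n"
    using mset_eq_length[OF assms] by simp
  have "distinct is"
    using mset_eq_imp_distinct_iff[OF assms] by simp
  moreover have "set is = {..<n}"
    using mset_eq_setD[OF assms] by (simp add: atLeast0LessThan)
  ultimately have "bij_betw ((!) is) {..<n} {..<n}"
    by (intro bij_betw_nth) (simp_all add: n)
  moreover have "list_perm is p = is ! p" if "p \<in> {..<n}" for p
    using that by (simp add: list_perm_def n)
  ultimately have "bij_betw (list_perm is) {..<n} {..<n}"
    using bij_betw_cong[of "{..<n}" "list_perm is" "(!) is"] by simp
  then show ?thesis
    by (rule bij_imp_permutes) (simp add: list_perm_def n)
qed

lemma list_perm_upt [simp]: "list_perm [0..<n] = id"
  by (auto simp: list_perm_def)

lemma concat_index_blocks: "concat (index_blocks ns) = [0..<sum_list ns]"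
proof -
  have "concat (map (\<lambda>i. [sum_list (take i ns)..<sum_list (take (Suc i) ns)]) [0..<k]) =
      [0..<sum_list (take k ns)]" if "k \<le> length ns" for k
    using that
  proof (induction k)
    case (Suc k)
    then show ?case
      using upt_add_eq_append[of 0 "sum_list (take k ns)" "ns ! k"]
      by (simp add: take_Suc_conv_app_nth)
  qed simp
  from this[of "length ns"] show ?thesis
    by (simp add: index_blocks_def)
qed

lemma length_index_blocks [simp]: "length (index_blocks ns) = length ns"
  by (simp add: index_blocks_def)

lemma length_nth_index_blocks: "i < length ns \<Longrightarrow> length (index_blocks ns ! i) = ns ! i"
  by (simp add: index_blocks_def take_Suc_conv_app_nth)

text \<open>By \<open>map_nth_index_blocks\<close>, looking up the index blocks in the concatenation
  recovers \<open>xss\<close>; when the concatenation is \<open>[0..<n]\<close>, each lookup returns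
  the index itself.\<close>

lemma index_blocks_eqI:
  assumes "concat xss = [0..<n]"
  shows "index_blocks (map length xss) = xss"
proof -
  let ?I = "index_blocks (map length xss)"
  have n: "sum_list (map length xss) = n"
    using assms by (metis length_concat length_upt diff_zero)
  have "map (map ((!) [0..<n])) ?I = ?I"
  proof (intro map_idI)
    fix ks k assume "ks \<in> set ?I" "k \<in> set ks"
    then have "k \<in> set (concat ?I)"
      by auto
    then show "[0..<n] ! k = k"
      by (simp add: concat_index_blocks n)
  qed
  then show ?thesis
    using map_nth_index_blocks[of xss] assms by simp
qed

lemma block_perm_permutes:
  assumes "\<sigma> permutes {..<length ns}"
  shows "block_perm \<sigma> ns permutes {..<sum_list ns}"
proof -
  let ?is = "concat (permute_list \<sigma> (index_blocks ns))"
  have "mset ?is = mset (concat (index_blocks ns))"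
    using assms by (simp add: mset_concat flip: sum_mset_sum_list permute_list_map)
  then have "mset ?is = mset [0..<sum_list ns]"
    by (simp only: concat_index_blocks)
  then show ?thesis
    unfolding block_perm_def by (rule list_perm_permutes)
qed

lemma sum_perm_permutes:
  assumes "list_all2 (\<lambda>\<sigma> n. \<sigma> permutes {..<n}) \<sigma>s ns"
  shows "sum_perm \<sigma>s ns permutes {..<sum_list ns}"
proof -
  let ?is = "concat (map2 permute_list \<sigma>s (index_blocks ns))"
  have l: "length \<sigma>s = length ns"
    using assms by (rule list_all2_lengthD)
  have "map mset (map2 permute_list \<sigma>s (index_blocks ns)) = map mset (index_blocks ns)"
    using assms l by (intro nth_equalityI)
      (auto simp: list_all2_conv_all_nth length_nth_index_blocks)
  then have "mset ?is = mset (concat (index_blocks ns))"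
    by (metis mset_concat)
  then have "mset ?is = mset [0..<sum_list ns]"
    by (simp only: concat_index_blocks)
  then show ?thesis
    unfolding sum_perm_def by (rule list_perm_permutes)
qed

lemma permutes_singleton_id: "\<sigma> permutes {..<1::nat} \<Longrightarrow> \<sigma> = id"
  by (simp add: lessThan_Suc)

text \<open>The numbers are the arities in the two rows \<open>1, ..., 1, z\<close> and
  \<open>z, ..., z, 1\<close>, where \<open>z\<close> has no inputs. Pairing the rows column by
  column moves only empty blocks past the others, so the inputs \<open>0, ..., k\<close> stay in
  order.\<close>

lemma block_perm_split:
  "block_perm (transpose_perm (Suc k) 2) (replicate k 1 @ 0 # replicate k 0 @ [1]) = id"
proof -
  define r0 r1 :: "nat list list" where r: "r0 = map (\<lambda>i. [i]) [0..<k] @ [[]]" "r1 = replicate k [] @ [[k]]"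
  have c: "concat (r0 @ r1) = [0..<Suc k]"
    by (simp add: r concat_map_singleton)
  have "replicate k 1 @ 0 # replicate k 0 @ [1] = map length (r0 @ r1)"
    by (simp add: r comp_def map_replicate_const)
  moreover have "permute_list (transpose_perm (Suc k) 2) (r0 @ r1) = concat (map2 (\<lambda>x y. [x, y]) r0 r1)"
    using permute_list_transpose_perm_append[of r1 r0] by (simp add: r)
  moreover have "map2 (\<lambda>x y. [x, y]) r0 r1 = map (\<lambda>i. [[i], []]) [0..<k] @ [[[], [k]]]"
    by (rule nth_equalityI) (auto simp: r nth_append)
  moreover have "concat (concat (map (\<lambda>i. [[i], []]) [0..<k] @ [[[], [k]]])) = [0..<Suc k]"
    by (induction k) auto
  ultimately show ?thesis
    unfolding block_perm_def by (simp only: index_blocks_eqI[OF c] list_perm_upt)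
qed

section \<open>Splitting an arrow along unital magmas\<close>

lemma concat_update_replicate_Nil:
  "i < n \<Longrightarrow> concat ((replicate n [])[i := xs]) = xs"
  by (simp add: upd_conv_take_nth_drop)

context symmetric_multicategory
begin

lemma Comp_closed:
  assumes "composable M f gs"
  shows "Comp M f gs \<in> Arr M" "Dom M (Comp M f gs) = concat (map (Dom M) gs)"
    "Cod M (Comp M f gs) = Cod M f"
  using Comp[OF assms] by auto

lemma Comp_nullary: "f \<in> Arr M \<Longrightarrow> Dom M f = [] \<Longrightarrow> Comp M f [] = f"
  using Comp_Idt_right[of f] by simp

lemma Comp_unary_Idt: "f \<in> Arr M \<Longrightarrow> Dom M f = [A] \<Longrightarrow> Comp M f [Idt M A] = f"
  using Comp_Idt_right[of f] by simp

text \<open>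
  If \<open>f\<close> commutes with binary operations \<open>m\<close> having \<open>z\<close> as a unit, then
  \<open>f(m, \<dots>, m) = \<sigma> m(f, f)\<close> can be precomposed with \<open>(1, z), \<dots>, (1, z), (z, 1)\<close>. The left side becomes
  \<open>f\<close>, and the right side becomes the product of two arrows that have \<open>z\<close> in complementary positions.
\<close>

lemma Comp_mult_split:
  assumes f: "f \<in> Arr M" and Df: "Dom M f = As @ [B]"
    and z: "\<And>A. A \<in> set (Cod M f # Dom M f) \<Longrightarrow>
      z A \<in> Arr M \<and> Dom M (z A) = [] \<and> Cod M (z A) = A"
    and m: "\<And>A. A \<in> set (Cod M f # Dom M f) \<Longrightarrow>
      m A \<in> Arr M \<and> Dom M (m A) = [A, A] \<and> Cod M (m A) = A"
    and right: "\<And>A. A \<in> set As \<Longrightarrow> Comp M (m A) [Idt M A, z A] = Idt M A"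
    and left: "Comp M (m B) [z B, Idt M B] = Idt M B"
    and natural: "Comp M f (map m (Dom M f)) =
      Act M (transpose_perm (length (Dom M f)) 2) (Comp M (m (Cod M f)) [f, f])"
  shows "f = Comp M (m (Cod M f))
    [Comp M f (map (Idt M) As @ [z B]), Comp M f (map z As @ [Idt M B])]"
proof -
  let ?C = "Cod M f" and ?k = "length As"
  let ?r = "map (Idt M) As @ [z B]" and ?s = "map z As @ [Idt M B]"
  let ?q = "Comp M (m ?C) [f, f]" and ?\<sigma> = "transpose_perm (Suc ?k) 2"
  have O: "set As \<subseteq> Obj M" "B \<in> Obj M" "?C \<in> Obj M"
    using Dom[OF f] Cod[OF f] by (auto simp: Df)
  have rs: "composable M f ?r" "composable M f ?s"
    using f O z Idt by (auto simp: composable_def Df subset_iff map_idI)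
  have q: "composable M (m ?C) [f, f]"
    using f m by (auto simp: composable_def)
  have qrs: "composable M ?q (?r @ ?s)"
    using rs Comp[OF q] by (auto simp: composable_def)
  have "length (Dom M ?q) = Suc ?k * 2"
    using Comp[OF q] by (simp add: Df)
  then have \<sigma>: "dom_permutes M ?\<sigma> ?q"
    unfolding dom_permutes_def by (simp only: transpose_perm_permutes)
  have Ddom: "map (length \<circ> Dom M) (?r @ ?s) = replicate ?k 1 @ 0 # replicate ?k 0 @ [1]"
    using O z Idt by (auto simp: Df subset_iff simp flip: map_replicate_const)
  \<comment> \<open>The rows \<open>?r\<close> and \<open>?s\<close> read column by column: under
    each input of \<open>f\<close> stands a pair that the unit laws of \<open>m\<close> reduce to an
    identity.\<close>
  let ?hss = "map (\<lambda>A. [Idt M A, z A]) As @ [[z B, Idt M B]]"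
  have perm: "permute_list ?\<sigma> (?r @ ?s) = concat ?hss"
    using permute_list_transpose_perm_append[of ?s ?r]
    by (simp add: zip_map_map zip_same_conv_map comp_def case_prod_beta)
  have "f = Comp M f (map (Idt M) (Dom M f))"
    using Comp_Idt_right[OF f] by simp
  also have "map (Idt M) (Dom M f) = map2 (Comp M) (map m (Dom M f)) ?hss"
    using left right by (simp add: Df zip_map_map zip_same_conv_map comp_def case_prod_beta)
  also have "Comp M f \<dots> = Comp M (Comp M f (map m (Dom M f))) (concat ?hss)"
  proof (rule Comp_assoc[symmetric])
    show "composable M f (map m (Dom M f))"
      using f m by (auto simp: composable_def map_idI)
    show "list_all2 (composable M) (map m (Dom M f)) ?hss"
      using m z O Idt by (auto simp: Df list_all2_append list_all2_map1 list_all2_map2 list_all2_same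
          composable_def subset_iff)
  qed
  also have "\<dots> = Comp M (Act M ?\<sigma> ?q) (permute_list ?\<sigma> (?r @ ?s))"
    unfolding natural perm by (simp add: Df)
  also have "\<dots> = Act M (block_perm ?\<sigma> (map (length \<circ> Dom M) (?r @ ?s))) (Comp M ?q (?r @ ?s))"
    by (rule Comp_Act_left[OF qrs \<sigma>])
  also have "\<dots> = Comp M ?q (?r @ ?s)"
    using Comp_closed(1)[OF qrs] by (simp only: Ddom block_perm_split Act_id)
  also have "\<dots> = Comp M (m ?C) [Comp M f ?r, Comp M f ?s]"
    using Comp_assoc[OF q, of "[?r, ?s]"] rs by simp
  finally show ?thesis .
qed

end

text \<open>The pointwise content of a central unital magma: only the components are kept, without
  the functors that arrows of the internal hom record.\<close>

locale natural_unital_magma = symmetric_multicategory M for M :: "('o, 'a) multicategory" +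
  fixes z m :: "'o \<Rightarrow> 'a"
  assumes unit: "A \<in> Obj M \<Longrightarrow> z A \<in> Arr M \<and> Dom M (z A) = [] \<and> Cod M (z A) = A"
    and mult: "A \<in> Obj M \<Longrightarrow> m A \<in> Arr M \<and> Dom M (m A) = [A, A] \<and> Cod M (m A) = A"
    and mult_right: "A \<in> Obj M \<Longrightarrow> Comp M (m A) [Idt M A, z A] = Idt M A"
    and mult_left: "A \<in> Obj M \<Longrightarrow> Comp M (m A) [z A, Idt M A] = Idt M A"
    and unit_natural: "f \<in> Arr M \<Longrightarrow> Comp M f (map z (Dom M f)) = z (Cod M f)"
    and mult_natural: "f \<in> Arr M \<Longrightarrow> Comp M f (map m (Dom M f)) =
      Act M (transpose_perm (length (Dom M f)) 2) (Comp M (m (Cod M f)) [f, f])"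
begin

text \<open>The rows of an identity matrix, with identity arrows on the diagonal and units
  elsewhere. Composing an arrow with row \<open>i\<close> leaves exactly its input \<open>i\<close>
  open.\<close>

definition rows :: "'o list \<Rightarrow> 'a list list" where
  "rows As = map (\<lambda>i. (map z As)[i := Idt M (As ! i)]) [0..<length As]"

definition comps :: "'a \<Rightarrow> 'a list" where
  "comps f = map (Comp M f) (rows (Dom M f))"

lemma length_comps [simp]: "length (comps f) = length (Dom M f)"
  by (simp add: comps_def rows_def)

lemma rows_simps [simp]: "rows [] = []" "rows [A] = [[Idt M A]]"
  by (simp_all add: rows_def)

text \<open>The identity matrix of a concatenation is block diagonal, with units in the off-diagonal
  blocks.\<close>

lemma rows_append:
  "rows (As @ Bs) = map (\<lambda>r. r @ map z Bs) (rows As) @ map (\<lambda>r. map z As @ r) (rows Bs)"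
  by (rule nth_equalityI) (auto simp: rows_def nth_append list_update_append)

lemma rowsD:
  assumes "r \<in> set (rows As)" "set As \<subseteq> Obj M"
  shows "set r \<subseteq> Arr M" "map (Cod M) r = As" "\<exists>A. concat (map (Dom M) r) = [A]"
proof -
  obtain i where i: "i < length As" "r = (map z As)[i := Idt M (As ! i)]"
    using assms(1) by (auto simp: rows_def)
  have A: "As ! i \<in> Obj M"
    using i(1) assms(2) by auto
  show "set r \<subseteq> Arr M"
    unfolding i(2) using assms(2) A unit Idt by (intro set_update_subsetI) auto
  have "map (Cod M) (map z As) = As"
    using assms(2) unit by (auto simp: subset_iff intro!: map_idI)
  then show "map (Cod M) r = As"
    using A Idt by (simp add: i(2) map_update list_update_id del: map_map)
  have "map (Dom M) (map z As) = replicate (length As) []"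
    using assms(2) unit by (auto simp flip: map_replicate_const)
  then show "\<exists>A. concat (map (Dom M) r) = [A]"
    using A Idt i(1) by (simp add: i(2) map_update concat_update_replicate_Nil del: map_map)
qed

lemma composable_rows: "f \<in> Arr M \<Longrightarrow> r \<in> set (rows (Dom M f)) \<Longrightarrow> composable M f r"
  using rowsD Dom by (simp add: composable_def)

lemma compsD:
  assumes "f \<in> Arr M" "c \<in> set (comps f)"
  shows "c \<in> Arr M" "length (Dom M c) = 1" "Cod M c = Cod M f"
proof -
  obtain r where r: "r \<in> set (rows (Dom M f))" "c = Comp M f r"
    using assms(2) by (auto simp: comps_def)
  show "c \<in> Arr M" "length (Dom M c) = 1" "Cod M c = Cod M f"
    using Comp_closed[OF composable_rows[OF assms(1) r(1)]] rowsD(3)[OF r(1) Dom[OF assms(1)]] r(2)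
    by auto
qed

lemma Dom_comps:
  assumes "f \<in> Arr M"
  shows "map (\<lambda>c. hd (Dom M c)) (comps f) = Dom M f"
proof (rule nth_equalityI)
  fix i assume "i < length (map (\<lambda>c. hd (Dom M c)) (comps f))"
  then have i: "i < length (Dom M f)"
    by simp
  let ?r = "(map z (Dom M f))[i := Idt M (Dom M f ! i)]"
  have r: "?r \<in> set (rows (Dom M f))"
    using i by (auto simp: rows_def)
  have "map (Dom M) (map z (Dom M f)) = replicate (length (Dom M f)) []"
    using Dom[OF assms] unit by (auto simp flip: map_replicate_const)
  then have "concat (map (Dom M) ?r) = [Dom M f ! i]"
    using i Idt Dom[OF assms] by (simp add: map_update concat_update_replicate_Nil subset_iff del: map_map)
  then show "map (\<lambda>c. hd (Dom M c)) (comps f) ! i = Dom M f ! i"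
    using i Comp_closed(2)[OF composable_rows[OF assms r]] by (simp add: comps_def rows_def)
qed simp

text \<open>Associativity carries the unit law from the identity of an object to every arrow into
  that object: \<open>c\<close> is fed into the identity and nothing into the unit.\<close>

lemma mult_right_arr:
  assumes c: "c \<in> Arr M"
  shows "Comp M (m (Cod M c)) [c, z (Cod M c)] = c"
proof -
  let ?A = "Cod M c"
  have A: "?A \<in> Obj M"
    by (rule Cod[OF c])
  have "Comp M (Comp M (m ?A) [Idt M ?A, z ?A]) (concat [[c], []]) =
      Comp M (m ?A) (map2 (Comp M) [Idt M ?A, z ?A] [[c], []])"
    by (rule Comp_assoc) (use A c unit mult Idt in \<open>auto simp: composable_def\<close>)
  then show ?thesis
    using A c unit by (simp add: mult_right Comp_Idt_left Comp_nullary)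
qed

lemma mult_left_arr:
  assumes c: "c \<in> Arr M"
  shows "Comp M (m (Cod M c)) [z (Cod M c), c] = c"
proof -
  let ?A = "Cod M c"
  have A: "?A \<in> Obj M"
    by (rule Cod[OF c])
  have "Comp M (Comp M (m ?A) [z ?A, Idt M ?A]) (concat [[], [c]]) =
      Comp M (m ?A) (map2 (Comp M) [z ?A, Idt M ?A] [[], [c]])"
    by (rule Comp_assoc) (use A c unit mult Idt in \<open>auto simp: composable_def\<close>)
  then show ?thesis
    using A c unit by (simp add: mult_left Comp_Idt_left Comp_nullary)
qed

text \<open>By associativity the identities absorb the entries of \<open>r\<close>, while
  \<open>z B\<close> receives the empty list. So the components of \<open>f\<close> with its last
  input closed are the components of \<open>f\<close> at the other inputs.\<close>

lemma Comp_restrict: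
  assumes f: "f \<in> Arr M" and Df: "Dom M f = As @ [B]" and r: "r \<in> set (rows As)"
  shows "Comp M (Comp M f (map (Idt M) As @ [z B])) r = Comp M f (r @ [z B])"
proof -
  have O: "set As \<subseteq> Obj M" "B \<in> Obj M"
    using Dom[OF f] by (auto simp: Df)
  note r' = rowsD[OF r O(1)]
  have l: "length r = length As"
    using r'(2) by auto
  have "Comp M (Comp M f (map (Idt M) As @ [z B])) (concat (map (\<lambda>x. [x]) r @ [[]])) =
      Comp M f (map2 (Comp M) (map (Idt M) As @ [z B]) (map (\<lambda>x. [x]) r @ [[]]))"
  proof (rule Comp_assoc)
    show "composable M f (map (Idt M) As @ [z B])"
      using f O unit Idt by (auto simp: composable_def Df subset_iff map_idI)
    show "list_all2 (composable M) (map (Idt M) As @ [z B]) (map (\<lambda>x. [x]) r @ [[]])"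
    proof -
      have "composable M (Idt M (As ! i)) [r ! i]" if "i < length As" for i
      proof -
        have "r ! i \<in> Arr M" "Cod M (r ! i) = As ! i" "As ! i \<in> Obj M"
          using that l r'(1) O(1) arg_cong[OF r'(2), of "\<lambda>xs. xs ! i"] by auto
        then show ?thesis
          using Idt by (simp add: composable_def)
      qed
      then have "list_all2 (composable M) (map (Idt M) As) (map (\<lambda>x. [x]) r)"
        using l by (simp add: list_all2_conv_all_nth)
      moreover have "composable M (z B) []"
        using unit[OF O(2)] by (simp add: composable_def)
      ultimately show ?thesis
        by (simp add: list_all2_append l)
    qed
  qed
  moreover have "map2 (Comp M) (map (Idt M) As) (map (\<lambda>x. [x]) r) = r"
  proof (rule nth_equalityI)
    fix i assume "i < length (map2 (Comp M) (map (Idt M) As) (map (\<lambda>x. [x]) r))"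
    then have i: "i < length As" "i < length r"
      by simp_all
    then have "r ! i \<in> Arr M" "Cod M (r ! i) = As ! i"
      using r'(1) arg_cong[OF r'(2), of "\<lambda>xs. xs ! i"] by auto
    then show "map2 (Comp M) (map (Idt M) As) (map (\<lambda>x. [x]) r) ! i = r ! i"
      using i Comp_Idt_left[of "r ! i"] by simp
  qed (simp add: l)
  ultimately show ?thesis
    using l O unit by (simp add: Comp_nullary concat_map_singleton)
qed

text \<open>Here \<open>g\<close> is \<open>f\<close> with the last input closed by a unit and
  \<open>h\<close> is \<open>f\<close> with all other inputs closed; \<open>Comp_mult_split\<close>
  says that their product is \<open>f\<close>. This is the inductive step in recovering an arrow
  from its components.\<close>

lemma comps_snoc:
  assumes f: "f \<in> Arr M" and Df: "Dom M f = As @ [B]"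
  obtains g h where "g \<in> Arr M" "h \<in> Arr M" "Dom M g = As" "Cod M g = Cod M f"
    "f = Comp M (m (Cod M f)) [g, h]" "comps f = comps g @ [h]"
proof
  let ?r = "map (Idt M) As @ [z B]" and ?s = "map z As @ [Idt M B]"
  have O: "set As \<subseteq> Obj M" "B \<in> Obj M"
    using Dom[OF f] by (auto simp: Df)
  have rs: "composable M f ?r" "composable M f ?s"
    using f O unit Idt by (auto simp: composable_def Df subset_iff map_idI)
  show *: "Comp M f ?r \<in> Arr M" "Comp M f ?s \<in> Arr M" "Cod M (Comp M f ?r) = Cod M f"
    using Comp_closed rs by auto
  have "concat (map (Dom M) (map (Idt M) As)) = As"
    using O(1) Idt by (induction As) auto
  then show D: "Dom M (Comp M f ?r) = As"
    using Comp_closed(2)[OF rs(1)] unit[OF O(2)] by simp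
  show "f = Comp M (m (Cod M f)) [Comp M f ?r, Comp M f ?s]"
    using Dom[OF f] Cod[OF f] unit mult mult_left mult_right mult_natural[OF f]
    by (intro Comp_mult_split[OF f Df]) (auto simp: Df)
  show "comps f = comps (Comp M f ?r) @ [Comp M f ?s]"
    using Comp_restrict[OF f Df] by (simp add: comps_def D Df rows_append)
qed

section \<open>Arrows correspond to lists of unary arrows with a common codomain\<close>

lemma comps_inject:
  assumes "f \<in> Arr M" "g \<in> Arr M" "Cod M f = Cod M g" "comps f = comps g"
  shows "f = g"
proof -
  have "Dom M f = Dom M g"
    using assms by (metis Dom_comps)
  then show ?thesis
    using assms
  proof (induction "Dom M f" arbitrary: f g rule: rev_induct)
    case Nil
    \<comment> \<open>Naturality of the unit at an arrow without inputs says that this arrow is the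
      unit of its codomain.\<close>
    then show ?case
      using unit_natural[of f] unit_natural[of g] by (simp add: Comp_nullary)
  next
    case (snoc B As)
    obtain f1 f2 where 1: "f1 \<in> Arr M" "f2 \<in> Arr M" "Dom M f1 = As" "Cod M f1 = Cod M f"
        "f = Comp M (m (Cod M f)) [f1, f2]" "comps f = comps f1 @ [f2]"
      using comps_snoc[of f As B] snoc by metis
    obtain g1 g2 where 2: "g1 \<in> Arr M" "g2 \<in> Arr M" "Dom M g1 = As" "Cod M g1 = Cod M g"
        "g = Comp M (m (Cod M g)) [g1, g2]" "comps g = comps g1 @ [g2]"
      using comps_snoc[of g As B] snoc by metis
    have "f1 = g1"
      using snoc(1)[of f1 g1] snoc 1 2 by simp
    then show ?case
      using 1(5,6) 2(5,6) snoc by simp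
  qed
qed

text \<open>The list is multiplied up from the left. In the product \<open>m C\<close> of
  \<open>f\<close> and \<open>g\<close>, closing the input of \<open>g\<close> by a unit leaves the
  components of \<open>f\<close>, and closing all inputs of \<open>f\<close> leaves
  \<open>g\<close>, each time by a unit law.\<close>

lemma comps_surjective:
  assumes "C \<in> Obj M" "\<And>g. g \<in> set gs \<Longrightarrow> g \<in> Arr M \<and> length (Dom M g) = 1 \<and> Cod M g = C"
  shows "\<exists>f \<in> Arr M. Cod M f = C \<and> comps f = gs"
  using assms(2)
proof (induction gs rule: rev_induct)
  case Nil
  have "z C \<in> Arr M \<and> Cod M (z C) = C \<and> comps (z C) = []"
    using unit[OF assms(1)] by (simp add: comps_def)
  then show ?case
    by blast
next
  case (snoc g gs)
  have "\<exists>f \<in> Arr M. Cod M f = C \<and> comps f = gs"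
    by (rule snoc.IH) (use snoc.prems in auto)
  then obtain f where f: "f \<in> Arr M" "Cod M f = C" "comps f = gs"
    by blast
  have g: "g \<in> Arr M" "Cod M g = C"
    using snoc.prems by auto
  have "length (Dom M g) = 1"
    using snoc.prems by auto
  then obtain B where B: "Dom M g = [B]"
    by (auto simp: length_Suc_conv)
  have BO: "B \<in> Obj M"
    using Dom[OF g(1)] B by simp
  have h: "composable M (m C) [f, g]"
    using f g mult[OF assms(1)] by (simp add: composable_def)
  let ?h = "Comp M (m C) [f, g]"
  have eq: "Comp M ?h (r @ s) = Comp M (m C) [Comp M f r, Comp M g s]"
    if "composable M f r" "composable M g s" for r s
    using Comp_assoc[OF h, of "[r, s]"] that by simp
  have gz: "composable M g [z B]" "composable M g [Idt M B]" "composable M f (map z (Dom M f))"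
    using f g B BO unit Idt Dom[OF f(1)] by (auto simp: composable_def map_idI subset_iff)
  have "Comp M ?h (r @ [z B]) = Comp M f r" if "r \<in> set (rows (Dom M f))" for r
    using eq[OF composable_rows[OF f(1) that] gz(1)] unit_natural[OF g(1)] g f B
      mult_right_arr[of "Comp M f r"] Comp_closed[OF composable_rows[OF f(1) that]] by simp
  moreover have "Comp M ?h (map z (Dom M f) @ [Idt M B]) = g"
    using eq[OF gz(3,2)] unit_natural[OF f(1)] g f B mult_left_arr[of g] by (simp add: Comp_unary_Idt)
  moreover have "Dom M ?h = Dom M f @ [B]"
    using Comp_closed(2)[OF h] B by simp
  ultimately have "comps ?h = gs @ [g]"
    using f(3) by (auto simp: comps_def rows_append)
  then show ?case
    using Comp_closed[OF h] mult[OF assms(1)] by auto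
qed

section \<open>Components of identities, composites and permuted arrows\<close>

lemma comps_Idt: "A \<in> Obj M \<Longrightarrow> comps (Idt M A) = [Idt M A]"
  using Idt[of A] by (simp add: comps_def Comp_unary_Idt)

text \<open>A row of the composite leaves one input of one inner arrow open; all other inner arrows
  receive only units and become units by naturality, so \<open>f\<close> itself is evaluated at one
  of its rows. The prefix \<open>ps\<close> holds the inner arrows that are already closed in this
  way, and the induction moves \<open>g\<close> from \<open>gs\<close> to \<open>ps\<close>.\<close>

lemma comps_Comp_aux:
  assumes "composable M f (ps @ gs)"
  shows "map (\<lambda>r. Comp M (Comp M f (ps @ gs)) (map z (concat (map (Dom M) ps)) @ r))
      (rows (concat (map (Dom M) gs))) =
    concat (map2 (\<lambda>c g. map (\<lambda>k. Comp M c [k]) (comps g))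
      (map (\<lambda>r. Comp M f (map z (map (Cod M) ps) @ r)) (rows (map (Cod M) gs))) gs)"
  using assms
proof (induction gs arbitrary: ps)
  case (Cons g gs)
  let ?D = "\<lambda>gs. concat (map (Dom M) gs)"
  have f: "f \<in> Arr M" "Dom M f = map (Cod M) (ps @ g # gs)"
    and A: "set ps \<subseteq> Arr M" "g \<in> Arr M" "set gs \<subseteq> Arr M"
    using Cons.prems by (auto simp: composable_def)
  have zC: "map2 (Comp M) hs (map (map z) (map (Dom M) hs)) = map z (map (Cod M) hs)"
    if "set hs \<subseteq> Arr M" for hs
    using that unit_natural by (auto simp: zip_map2 zip_same_conv_map subset_iff)
  have zc: "list_all2 (composable M) hs (map (map z) (map (Dom M) hs))" if "set hs \<subseteq> Arr M" for hs
    using that Dom unit by (auto simp: list_all2_map2 composable_def list_all2_same subset_iff map_idI)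
  have zz: "list_all2 (composable M) (map z Bs) (map (\<lambda>_. []) Bs)"
    "map2 (Comp M) (map z Bs) (map (\<lambda>_. []) Bs) = map z Bs"
    "set (map z Bs) \<subseteq> Arr M" "map (Cod M) (map z Bs) = Bs"
    if "set Bs \<subseteq> Obj M" for Bs
    using that unit by (auto simp: list_all2_map1 list_all2_map2 list_all2_same composable_def subset_iff
        zip_map_map zip_same_conv_map Comp_nullary map_idI)
  \<comment> \<open>The row of \<open>f\<close> with its identity at the position of
    \<open>g\<close>.\<close>
  let ?e = "map z (map (Cod M) ps) @ Idt M (Cod M g) # map z (map (Cod M) gs)"
  have O: "set (map (Cod M) ps) \<subseteq> Obj M" "Cod M g \<in> Obj M" "set (map (Cod M) gs) \<subseteq> Obj M"
    using A Cod by auto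
  have first: "Comp M (Comp M f (ps @ g # gs)) (map z (?D ps) @ r @ map z (?D gs)) =
      Comp M (Comp M f ?e) [Comp M g r]" if r: "r \<in> set (rows (Dom M g))" for r
  proof -
    have c: "composable M g r"
      by (rule composable_rows[OF A(2) r])
    let ?hss = "map (map z) (map (Dom M) ps) @ r # map (map z) (map (Dom M) gs)"
    have "Comp M (Comp M f (ps @ g # gs)) (concat ?hss) = Comp M f (map2 (Comp M) (ps @ g # gs) ?hss)"
      by (rule Comp_assoc[OF Cons.prems]) (use zc A c in \<open>simp add: list_all2_append\<close>)
    also have "map2 (Comp M) (ps @ g # gs) ?hss =
        map z (map (Cod M) ps) @ Comp M g r # map z (map (Cod M) gs)"
      using zC A by simp
    \<comment> \<open>The arguments are factored through \<open>?e\<close>: each unit is composed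
      with nothing, and the identity with the remaining arrow.\<close>
    also have "\<dots> = map2 (Comp M) ?e (map (\<lambda>_. []) (map (Cod M) ps) @ [Comp M g r] # map (\<lambda>_. []) (map (Cod M) gs))"
      using zz(2)[OF O(1)] zz(2)[OF O(3)] Comp_Idt_left[OF Comp_closed(1)[OF c]] Comp_closed(3)[OF c] by simp
    also have "Comp M f \<dots> = Comp M (Comp M f ?e)
        (concat (map (\<lambda>_. []) (map (Cod M) ps) @ [Comp M g r] # map (\<lambda>_. []) (map (Cod M) gs)))"
    proof (rule Comp_assoc[symmetric])
      show "composable M f ?e"
        using f zz(3,4)[OF O(1)] zz(3,4)[OF O(3)] Idt[OF O(2)] by (simp add: composable_def)
      show "list_all2 (composable M) ?e (map (\<lambda>_. []) (map (Cod M) ps) @ [Comp M g r] # map (\<lambda>_. []) (map (Cod M) gs))"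
        using zz(1)[OF O(1)] zz(1)[OF O(3)] Idt[OF O(2)] Comp_closed[OF c]
        by (simp add: list_all2_append composable_def)
    qed
    finally show ?thesis
      by (simp add: map_concat comp_def map_replicate_const)
  qed
  have "map (\<lambda>r. Comp M (Comp M f (ps @ g # gs)) (map z (?D ps) @ r)) (rows (?D (g # gs))) =
      map (\<lambda>r. Comp M (Comp M f ?e) [Comp M g r]) (rows (Dom M g)) @
      map (\<lambda>r. Comp M (Comp M f ((ps @ [g]) @ gs)) (map z (?D (ps @ [g])) @ r)) (rows (?D gs))"
    using first by (simp add: rows_append)
  also have "map (\<lambda>r. Comp M (Comp M f ?e) [Comp M g r]) (rows (Dom M g)) =
      map (\<lambda>k. Comp M (Comp M f ?e) [k]) (comps g)"
    by (simp add: comps_def)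
  also have "map (\<lambda>r. Comp M (Comp M f ((ps @ [g]) @ gs)) (map z (?D (ps @ [g])) @ r)) (rows (?D gs)) =
      concat (map2 (\<lambda>c g. map (\<lambda>k. Comp M c [k]) (comps g))
        (map (\<lambda>r. Comp M f (map z (map (Cod M) (ps @ [g])) @ r)) (rows (map (Cod M) gs))) gs)"
    by (rule Cons.IH) (use Cons.prems in simp)
  finally show ?case
    using rows_append[of "[Cod M g]" "map (Cod M) gs"] by (simp add: comp_def)
qed simp

lemma comps_Comp:
  assumes "composable M f gs"
  shows "comps (Comp M f gs) = concat (map2 (\<lambda>c g. map (\<lambda>k. Comp M c [k]) (comps g)) (comps f) gs)"
  using comps_Comp_aux[of f "[]" gs] assms Comp_closed(2)[OF assms]
  by (simp add: comps_def composable_def)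

text \<open>Row \<open>i\<close> for the permuted domain is the permutation of row
  \<open>\<sigma> i\<close> for the old one. Equivariance then leaves a block permutation of one
  single input, which is the identity.\<close>

lemma comps_Act:
  assumes f: "f \<in> Arr M" and \<sigma>: "dom_permutes M \<sigma> f"
  shows "comps (Act M \<sigma> f) = permute_list \<sigma> (comps f)"
proof (rule nth_equalityI)
  have D: "Dom M (Act M \<sigma> f) = permute_list \<sigma> (Dom M f)"
    using Act[OF f \<sigma>] by simp
  then show "length (comps (Act M \<sigma> f)) = length (permute_list \<sigma> (comps f))"
    by simp
  fix i assume "i < length (comps (Act M \<sigma> f))"
  then have i: "i < length (Dom M f)"
    by (simp add: D)
  have p: "\<sigma> permutes {..<length (Dom M f)}"
    using \<sigma> by (simp add: dom_permutes_def)
  then have si: "\<sigma> i < length (Dom M f)"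
    using i by (meson lessThan_iff permutes_in_image)
  let ?As = "Dom M f"
  let ?r = "(map z ?As)[\<sigma> i := Idt M (?As ! \<sigma> i)]"
  have r: "?r \<in> set (rows ?As)"
    using si by (auto simp: rows_def)
  have pr: "(map z (permute_list \<sigma> ?As))[i := Idt M (permute_list \<sigma> ?As ! i)] = permute_list \<sigma> ?r"
  proof (rule nth_equalityI)
    fix j assume "j < length ((map z (permute_list \<sigma> ?As))[i := Idt M (permute_list \<sigma> ?As ! i)])"
    then have "j < length ?As" "\<sigma> i = \<sigma> j \<longleftrightarrow> i = j"
      using permutes_inj[OF p] by (auto simp: inj_eq)
    moreover from this have "\<sigma> j < length ?As"
      using p by (meson lessThan_iff permutes_in_image)
    ultimately show "(map z (permute_list \<sigma> ?As))[i := Idt M (permute_list \<sigma> ?As ! i)] ! j = permute_list \<sigma> ?r ! j"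
      using p i by (simp add: permute_list_nth nth_list_update)
  qed simp
  note c = composable_rows[OF f r]
  obtain A where A: "concat (map (Dom M) ?r) = [A]"
    using rowsD(3)[OF r Dom[OF f]] by blast
  have s: "sum_list (map (length \<circ> Dom M) ?r) = 1"
    using arg_cong[OF A, of length] by (simp add: length_concat comp_def del: map_update)
  have "\<sigma> permutes {..<length (map (length \<circ> Dom M) ?r)}"
    using p by simp
  from block_perm_permutes[OF this] have b: "block_perm \<sigma> (map (length \<circ> Dom M) ?r) = id"
    unfolding s by (rule permutes_singleton_id)
  have "comps (Act M \<sigma> f) ! i = Comp M (Act M \<sigma> f) (permute_list \<sigma> ?r)"
    using i pr by (simp add: comps_def rows_def D)
  also have "\<dots> = Comp M f ?r"
    using Comp_Act_left[OF c \<sigma>] Comp_closed(1)[OF c] by (simp only: b Act_id)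
  also have "\<dots> = permute_list \<sigma> (comps f) ! i"
    using p i si by (simp add: permute_list_nth) (simp add: comps_def rows_def)
  finally show "comps (Act M \<sigma> f) ! i = permute_list \<sigma> (comps f) ! i" .
qed

end

section \<open>Isomorphisms\<close>

lemma symmetric_functorD:
  assumes "symmetric_functor M N F"
  shows "A \<in> Obj M \<Longrightarrow> obj_map F A \<in> Obj N"
    and "f \<in> Arr M \<Longrightarrow> arr_map F f \<in> Arr N"
    and "f \<in> Arr M \<Longrightarrow> Dom N (arr_map F f) = map (obj_map F) (Dom M f)"
    and "f \<in> Arr M \<Longrightarrow> Cod N (arr_map F f) = obj_map F (Cod M f)"
    and "A \<in> Obj M \<Longrightarrow> arr_map F (Idt M A) = Idt N (obj_map F A)"
    and "composable M f gs \<Longrightarrow> arr_map F (Comp M f gs) = Comp N (arr_map F f) (map (arr_map F) gs)"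
    and "\<lbrakk>f \<in> Arr M; dom_permutes M \<sigma> f\<rbrakk> \<Longrightarrow> arr_map F (Act M \<sigma> f) = Act N \<sigma> (arr_map F f)"
  using assms by (auto simp: symmetric_functor_def)

lemma symmetric_functor_undefined:
  assumes "symmetric_functor M N F"
  shows "A \<notin> Obj M \<Longrightarrow> obj_map F A = undefined" "f \<notin> Arr M \<Longrightarrow> arr_map F f = undefined"
  using assms unfolding symmetric_functor_def by (blast dest: PiE_arb)+

lemma isomorphismE:
  assumes "isomorphism M N F"
  obtains G where "symmetric_functor M N F" "symmetric_functor N M G"
    "\<And>A. A \<in> Obj M \<Longrightarrow> obj_map G (obj_map F A) = A" "\<And>f. f \<in> Arr M \<Longrightarrow> arr_map G (arr_map F f) = f"
    "\<And>A. A \<in> Obj N \<Longrightarrow> obj_map F (obj_map G A) = A" "\<And>f. f \<in> Arr N \<Longrightarrow> arr_map F (arr_map G f) = f"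
proof -
  obtain G where FG: "symmetric_functor M N F" "symmetric_functor N M G"
    and 1: "comp_functor M G F = id_functor M" and 2: "comp_functor N F G = id_functor N"
    using assms by (auto simp: isomorphism_def)
  show thesis
  proof (rule that[OF FG])
    show "obj_map G (obj_map F A) = A" if "A \<in> Obj M" for A
      using that fun_cong[OF arg_cong[OF 1, of obj_map], of A]
      by (simp add: comp_functor_def id_functor_def compose_def)
    show "arr_map G (arr_map F f) = f" if "f \<in> Arr M" for f
      using that fun_cong[OF arg_cong[OF 1, of arr_map], of f]
      by (simp add: comp_functor_def id_functor_def compose_def)
    show "obj_map F (obj_map G A) = A" if "A \<in> Obj N" for A
      using that fun_cong[OF arg_cong[OF 2, of obj_map], of A]
      by (simp add: comp_functor_def id_functor_def compose_def)
    show "arr_map F (arr_map G f) = f" if "f \<in> Arr N" for f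
      using that fun_cong[OF arg_cong[OF 2, of arr_map], of f]
      by (simp add: comp_functor_def id_functor_def compose_def)
  qed
qed

lemma isomorphismI:
  assumes "symmetric_functor M N F" "symmetric_functor N M G"
    "\<And>A. A \<in> Obj M \<Longrightarrow> obj_map G (obj_map F A) = A" "\<And>f. f \<in> Arr M \<Longrightarrow> arr_map G (arr_map F f) = f"
    "\<And>A. A \<in> Obj N \<Longrightarrow> obj_map F (obj_map G A) = A" "\<And>f. f \<in> Arr N \<Longrightarrow> arr_map F (arr_map G f) = f"
  shows "isomorphism M N F"
proof -
  have "comp_functor M G F = id_functor M" "comp_functor N F G = id_functor N"
    using assms by (auto simp: comp_functor_def id_functor_def compose_def intro!: restrict_ext)
  then show ?thesis
    using assms(1,2) by (auto simp: isomorphism_def)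
qed

text \<open>Every law of the inverse follows by applying \<open>F\<close> and cancelling. That the
  operations of \<open>N\<close> stay inside its carriers is also read off through \<open>F\<close>,
  which allows \<open>N\<close> to be an internal hom without first establishing its multicategory
  laws.\<close>

lemma isomorphism_if_bij:
  assumes M: "symmetric_multicategory M" and F: "symmetric_functor M N F"
    and bo: "bij_betw (obj_map F) (Obj M) (Obj N)" and ba: "bij_betw (arr_map F) (Arr M) (Arr N)"
  shows "isomorphism M N F"
proof -
  interpret symmetric_multicategory M by fact
  let ?o = "inv_into (Obj M) (obj_map F)" and ?a = "inv_into (Arr M) (arr_map F)"
  note F' = symmetric_functorD[OF F]
  have o: "A \<in> Obj M \<Longrightarrow> ?o (obj_map F A) = A" and a: "f \<in> Arr M \<Longrightarrow> ?a (arr_map F f) = f" for A f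
    using bo ba by (auto simp: bij_betw_def inv_into_f_f)
  have o': "B \<in> Obj N \<Longrightarrow> ?o B \<in> Obj M \<and> obj_map F (?o B) = B"
    and a': "g \<in> Arr N \<Longrightarrow> ?a g \<in> Arr M \<and> arr_map F (?a g) = g" for B g
    using bo ba by (auto simp: bij_betw_def inv_into_into f_inv_into_f)
  have Da: "Dom N g = map (obj_map F) (Dom M (?a g))" "Cod N g = obj_map F (Cod M (?a g))"
    if "g \<in> Arr N" for g
    using that a' F'(3,4) by metis+
  have D: "Dom M (?a g) = map ?o (Dom N g)" "Cod M (?a g) = ?o (Cod N g)" if g: "g \<in> Arr N" for g
    using Da[OF g] o Dom[of "?a g"] Cod[of "?a g"] a'[OF g] by (auto simp: subset_iff map_idI)
  let ?G = "\<lparr>obj_map = restrict ?o (Obj N), arr_map = restrict ?a (Arr N)\<rparr>"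
  have ON: "set (Dom N g) \<subseteq> Obj N" "Cod N g \<in> Obj N" if "g \<in> Arr N" for g
    using Da[OF that] Dom[of "?a g"] Cod[of "?a g"] a'[OF that] F'(1) by auto
  have "symmetric_functor N M ?G"
    unfolding symmetric_functor_def
  proof (intro conjI ballI allI impI)
    show "obj_map ?G \<in> Obj N \<rightarrow>\<^sub>E Obj M" "arr_map ?G \<in> Arr N \<rightarrow>\<^sub>E Arr M"
      using o' a' by auto
  next
    fix g assume g: "g \<in> Arr N"
    show "Dom M (arr_map ?G g) = map (obj_map ?G) (Dom N g)"
      using D[OF g] ON[OF g] g by (auto simp: subset_iff)
    show "Cod M (arr_map ?G g) = obj_map ?G (Cod N g)"
      using D[OF g] ON[OF g] g by auto
  next
    fix B assume B: "B \<in> Obj N"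
    have "arr_map F (Idt M (?o B)) = Idt N B"
      using o'[OF B] F'(5) by auto
    moreover have "Idt M (?o B) \<in> Arr M"
      using o'[OF B] Idt by auto
    ultimately show "arr_map ?G (Idt N B) = Idt M (obj_map ?G B)"
      using B F'(2) a by (metis (no_types, lifting) multifunctor.simps(1,2) restrict_apply')
  next
    fix g hs assume c: "composable N g hs"
    have g: "g \<in> Arr N" "set hs \<subseteq> Arr N" "map (Cod N) hs = Dom N g"
      using c by (auto simp: composable_def)
    have "map (Cod M) (map ?a hs) = map ?o (map (Cod N) hs)"
      using g(2) D by auto
    then have cM: "composable M (?a g) (map ?a hs)"
      using g D[OF g(1)] a' by (auto simp: composable_def)
    have "map (arr_map F) (map ?a hs) = hs"
      using g(2) a' by (auto simp: subset_iff map_idI)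
    then have "arr_map F (Comp M (?a g) (map ?a hs)) = Comp N g hs"
      using F'(6)[OF cM] a'[OF g(1)] by simp
    then have "Comp N g hs \<in> Arr N" "?a (Comp N g hs) = Comp M (?a g) (map ?a hs)"
      using Comp[OF cM] F'(2) a by metis+
    moreover have "map ?a hs = map (arr_map ?G) hs"
      using g(2) by auto
    ultimately show "arr_map ?G (Comp N g hs) = Comp M (arr_map ?G g) (map (arr_map ?G) hs)"
      using g(1) by simp
  next
    fix g \<sigma> assume g: "g \<in> Arr N" and \<sigma>: "dom_permutes N \<sigma> g"
    have \<sigma>': "dom_permutes M \<sigma> (?a g)"
      using \<sigma> D[OF g] by (simp add: dom_permutes_def)
    then have "arr_map F (Act M \<sigma> (?a g)) = Act N \<sigma> g"
      using F'(7) a'[OF g] by simp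
    then have "Act N \<sigma> g \<in> Arr N" "?a (Act N \<sigma> g) = Act M \<sigma> (?a g)"
      using Act[OF _ \<sigma>'] a'[OF g] F'(2) a by metis+
    then show "arr_map ?G (Act N \<sigma> g) = Act M \<sigma> (arr_map ?G g)"
      using g by simp
  qed
  from F this show ?thesis
    by (rule isomorphismI) (use o a o' a' F' in auto)
qed

section \<open>Commutative monoids\<close>

text \<open>The unbiased form, with one operation for each arity: \<open>one_seq\<close> has a
  single arrow of each arity, \<open>\<nu> n\<close> is its image, and the last three clauses
  express preservation of identities, composition and permutations.\<close>

definition commutative_monoid :: "('o, 'a) multicategory \<Rightarrow> 'o \<Rightarrow> (nat \<Rightarrow> 'a) \<Rightarrow> bool" where
  "commutative_monoid M A \<nu> \<longleftrightarrow> A \<in> Obj M \<and>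
     (\<forall>n. \<nu> n \<in> Arr M \<and> Dom M (\<nu> n) = replicate n A \<and> Cod M (\<nu> n) = A) \<and>
     \<nu> 1 = Idt M A \<and>
     (\<forall>ns. Comp M (\<nu> (length ns)) (map \<nu> ns) = \<nu> (sum_list ns)) \<and>
     (\<forall>n \<sigma>. \<sigma> permutes {..<n} \<longrightarrow> Act M \<sigma> (\<nu> n) = \<nu> n)"

lemma commutative_monoidD:
  assumes "commutative_monoid M A \<nu>"
  shows "A \<in> Obj M" "\<nu> n \<in> Arr M" "Dom M (\<nu> n) = replicate n A" "Cod M (\<nu> n) = A"
    "\<nu> 1 = Idt M A" "Comp M (\<nu> (length ns)) (map \<nu> ns) = \<nu> (sum_list ns)"
    "\<sigma> permutes {..<n} \<Longrightarrow> Act M \<sigma> (\<nu> n) = \<nu> n"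
  using assms unfolding commutative_monoid_def by blast+

lemma commutative_monoid_image:
  assumes F: "symmetric_functor M N F" and \<nu>: "commutative_monoid M A \<nu>"
  shows "commutative_monoid N (obj_map F A) (\<lambda>n. arr_map F (\<nu> n))"
proof -
  note \<nu> = commutative_monoidD[OF \<nu>]
  have "composable M (\<nu> (length ns)) (map \<nu> ns)" for ns
    using \<nu>(2-4) by (auto simp: composable_def comp_def map_replicate_const)
  then have "Comp N (arr_map F (\<nu> (length ns))) (map (\<lambda>n. arr_map F (\<nu> n)) ns) = arr_map F (\<nu> (sum_list ns))"
    for ns
    using symmetric_functorD(6)[OF F] by (simp add: comp_def flip: \<nu>(6))
  moreover have "Act N \<sigma> (arr_map F (\<nu> n)) = arr_map F (\<nu> n)" if "\<sigma> permutes {..<n}" for n \<sigma>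
    using symmetric_functorD(7)[OF F, of "\<nu> n" \<sigma>] \<nu>(2,3,7) that by (simp add: dom_permutes_def)
  ultimately show ?thesis
    unfolding commutative_monoid_def using \<nu>(1-5) symmetric_functorD(1-5)[OF F] by (simp add: map_replicate)
qed

text \<open>A central monoid with its functors unpacked; the orientation of the interchange law is
  that of naturality in the center.\<close>

definition natural_monoids :: "('o, 'a) multicategory \<Rightarrow> (nat \<Rightarrow> 'o \<Rightarrow> 'a) \<Rightarrow> bool" where
  "natural_monoids M \<mu> \<longleftrightarrow> (\<forall>A \<in> Obj M. commutative_monoid M A (\<lambda>n. \<mu> n A)) \<and>
     (\<forall>f \<in> Arr M. \<forall>n. Comp M f (map (\<mu> n) (Dom M f)) =
        Act M (transpose_perm (length (Dom M f)) n) (Comp M (\<mu> n (Cod M f)) (replicate n f)))"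

lemma natural_monoidsD:
  assumes "natural_monoids M \<mu>"
  shows "A \<in> Obj M \<Longrightarrow> commutative_monoid M A (\<lambda>n. \<mu> n A)"
    and "f \<in> Arr M \<Longrightarrow> Comp M f (map (\<mu> n) (Dom M f)) =
      Act M (transpose_perm (length (Dom M f)) n) (Comp M (\<mu> n (Cod M f)) (replicate n f))"
  using assms unfolding natural_monoids_def by blast+

section \<open>Symmetric functors out of the terminal symmetric multicategory\<close>

lemma unit_list_eq_iff: "xs = ys \<longleftrightarrow> length xs = length ys" for xs ys :: "unit list"
  by (auto simp: list_eq_iff_nth_eq)

lemma one_seq_simps [simp]:
  "Obj one_seq = UNIV" "Arr one_seq = UNIV" "Dom one_seq (us, x) = us" "Cod one_seq f = ()"
  "Idt one_seq x = ([()], ())" "Act one_seq \<sigma> (us, x) = (us, ())"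
  by (auto simp: seq_def terminal_category_def unit_list_eq_iff)

lemma Dom_one_seq: "Dom one_seq f = fst f"
  by (cases f) simp

lemma composable_one_seq: "composable one_seq f gs \<longleftrightarrow> length gs = length (fst f)"
  by (auto simp: composable_def Dom_one_seq unit_list_eq_iff)

lemma one_seq_arr: "f = (replicate (length (fst f)) (), ())" for f :: "unit list \<times> unit"
  by (cases f) (simp add: unit_list_eq_iff)

lemma Comp_one_seq:
  assumes "length gs = length (fst f)"
  shows "Comp one_seq f gs = (replicate (sum_list (map (length \<circ> fst) gs)) (), ())"
proof -
  have "map length (map2 (\<lambda>f g. map (Cmp terminal_category f) (fst g)) (fst f) gs) = map (length \<circ> fst) gs"
    using assms by (intro nth_equalityI) auto
  then show ?thesis
    by (cases f) (simp add: seq_def unit_list_eq_iff length_concat del: map_map)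
qed

text \<open>Arrows of \<open>one_seq\<close> are determined by their arity and its carriers are
  whole types, so \<open>F\<close> amounts to an object and a sequence of operations.\<close>

lemma symmetric_functor_one_seq_iff:
  "symmetric_functor one_seq M F \<longleftrightarrow>
     commutative_monoid M (obj_map F ()) (\<lambda>n. arr_map F (replicate n (), ()))"
  (is "_ \<longleftrightarrow> commutative_monoid M ?A ?\<nu>")
proof
  assume F: "symmetric_functor one_seq M F"
  have "Comp M (?\<nu> (length ns)) (map ?\<nu> ns) = ?\<nu> (sum_list ns)" for ns
    using symmetric_functorD(6)[OF F, of "(replicate (length ns) (), ())" "map (\<lambda>n. (replicate n (), ())) ns"]
    by (simp add: composable_one_seq Comp_one_seq comp_def)
  then show "commutative_monoid M ?A ?\<nu>"
    using symmetric_functorD(1-4,5,7)[OF F]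
    by (auto simp: commutative_monoid_def dom_permutes_def map_replicate)
next
  define \<nu> where "\<nu> = ?\<nu>"
  assume "commutative_monoid M ?A ?\<nu>"
  note \<nu> = commutative_monoidD[OF this[folded \<nu>_def]]
  have \<nu>': "arr_map F f = \<nu> (length (fst f))" for f
    unfolding \<nu>_def by (rule arg_cong[OF one_seq_arr])
  show "symmetric_functor one_seq M F"
    unfolding symmetric_functor_def
  proof (intro conjI ballI allI impI)
    fix f gs assume "composable one_seq f gs"
    then have l: "length gs = length (fst f)"
      by (simp add: composable_one_seq)
    have "arr_map F (Comp one_seq f gs) = \<nu> (sum_list (map (length \<circ> fst) gs))"
      by (simp add: Comp_one_seq[OF l] \<nu>')
    also have "\<dots> = Comp M (\<nu> (length gs)) (map (\<lambda>g. \<nu> (length (fst g))) gs)"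
      by (simp add: comp_def flip: \<nu>(6))
    also have "\<dots> = Comp M (arr_map F f) (map (arr_map F) gs)"
      using l ext[of "arr_map F", OF \<nu>'] by simp
    finally show "arr_map F (Comp one_seq f gs) = Comp M (arr_map F f) (map (arr_map F) gs)" .
  next
    fix f \<sigma> assume "dom_permutes one_seq \<sigma> f"
    then have "Act M \<sigma> (arr_map F f) = arr_map F f"
      unfolding \<nu>' by (intro \<nu>(7)) (simp add: dom_permutes_def Dom_one_seq)
    then show "arr_map F (Act one_seq \<sigma> f) = Act M \<sigma> (arr_map F f)"
      by (cases f) simp
  next
    show "arr_map F \<in> Arr one_seq \<rightarrow>\<^sub>E Arr M"
      using \<nu>(2) \<nu>' by auto
  next
    fix f
    have "map (obj_map F) (Dom one_seq f) = replicate (length (fst f)) ?A"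
      by (simp add: Dom_one_seq list_eq_iff_nth_eq)
    then show "Dom M (arr_map F f) = map (obj_map F) (Dom one_seq f)"
      using \<nu>(3) \<nu>' by simp
    show "Cod M (arr_map F f) = obj_map F (Cod one_seq f)"
      using \<nu>(4) \<nu>' by simp
  qed (use \<nu>(1,5) in \<open>auto simp: \<nu>'\<close>)
qed

text \<open>The operations are the arrows with identities as components. Precomposing
  \<open>f\<close> with them repeats each component of \<open>f\<close> in place, while
  postcomposing repeats the whole list of components; transposition turns one list into the
  other.\<close>

lemma natural_monoids_seq:
  assumes "category C"
  shows "natural_monoids (seq C) (\<lambda>n X. (replicate n (Ident C X), X))"
proof -
  interpret category C by fact
  let ?h = "\<lambda>f g. map (Cmp C f) (fst g)"
  have 1: "Cmp C (Ident C X) (Ident C X) = Ident C X" if "X \<in> Ob C" for X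
    using that Ident Cmp_Ident_left[of "Ident C X"] by simp
  have 2: "concat (map2 ?h (replicate (length ns) (Ident C X)) (map (\<lambda>n. (replicate n (Ident C X), X)) ns))
      = replicate (sum_list ns) (Ident C X)" if "X \<in> Ob C" for ns X
    using that by (induction ns) (auto simp: 1 replicate_add)
  have 3: "Comp (seq C) f (map (\<lambda>X. (replicate n (Ident C X), X)) (Dom (seq C) f)) =
     Act (seq C) (transpose_perm (length (Dom (seq C) f)) n)
      (Comp (seq C) (replicate n (Ident C (Cod (seq C) f)), Cod (seq C) f) (replicate n f))"
    if f: "f \<in> Arr (seq C)" for f n
  proof -
    obtain fs X where fs: "f = (fs, X)"
      by fastforce
    have X: "X \<in> Ob C" "\<And>f. f \<in> set fs \<Longrightarrow> f \<in> Mor C \<and> Tgt C f = X"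
      using f by (auto simp: fs seq_def)
    have "map2 ?h fs (map (\<lambda>X. (replicate n (Ident C X), X)) (map (Src C) fs)) = map (replicate n) fs"
      using X Cmp_Ident_right by (intro nth_equalityI) (auto simp: map_replicate)
    moreover have "map (Cmp C (Ident C X)) fs = fs"
      using X Cmp_Ident_left by (intro map_idI) auto
    then have "map2 ?h (replicate n (Ident C X)) (replicate n (fs, X)) = replicate n fs"
      by (simp add: zip_replicate)
    moreover have "concat (map (replicate n) fs) = permute_list (transpose_perm (length fs) n) (concat (replicate n fs))"
      by (rule permute_list_transpose_perm_replicate[symmetric])
    ultimately show ?thesis
      unfolding fs by (simp only: seq_def multicategory.simps case_prod_conv snd_conv length_map)
  qed
  have "Act (seq C) \<sigma> (replicate n (Ident C X), X) = (replicate n (Ident C X), X)"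
    if "\<sigma> permutes {..<n}" for n \<sigma> X
    using that by (auto simp: seq_def permute_list_nth intro!: nth_equalityI) (metis lessThan_iff nth_replicate permutes_in_image)
  with 3 show ?thesis
    unfolding natural_monoids_def commutative_monoid_def
    by (auto simp: seq_def 2 Ident)
qed

text \<open>The operations are pulled back along the inverse \<open>G\<close>, and the interchange
  law of \<open>f\<close> is the image under \<open>G\<close> of that of its counterpart in
  \<open>N\<close>.\<close>

lemma natural_monoids_transport:
  assumes M: "symmetric_multicategory M" and N: "symmetric_multicategory N"
    and iso: "isomorphism M N F" and \<mu>: "natural_monoids N \<mu>"
  shows "\<exists>\<mu>. natural_monoids M \<mu>"
proof -
  interpret M: symmetric_multicategory M by fact
  interpret N: symmetric_multicategory N by fact
  obtain G where F: "symmetric_functor M N F" and G: "symmetric_functor N M G"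
    and inv: "\<And>A. A \<in> Obj M \<Longrightarrow> obj_map G (obj_map F A) = A" "\<And>f. f \<in> Arr M \<Longrightarrow> arr_map G (arr_map F f) = f"
    using iso by (rule isomorphismE) (rule that)
  note F' = symmetric_functorD[OF F] and G' = symmetric_functorD[OF G]
  let ?\<mu> = "\<lambda>n A. arr_map G (\<mu> n (obj_map F A))"
  have m: "commutative_monoid N B (\<lambda>n. \<mu> n B)" if "B \<in> Obj N" for B
    using \<mu> that by (simp add: natural_monoids_def)
  have "commutative_monoid M A (\<lambda>n. ?\<mu> n A)" if A: "A \<in> Obj M" for A
    using commutative_monoid_image[OF G m[OF F'(1)[OF A]]] inv(1)[OF A] by simp
  moreover have "Comp M f (map (?\<mu> n) (Dom M f)) =
      Act M (transpose_perm (length (Dom M f)) n) (Comp M (?\<mu> n (Cod M f)) (replicate n f))"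
    if f: "f \<in> Arr M" for f n
  proof -
    let ?g = "arr_map F f" and ?t = "transpose_perm (length (Dom M f)) n"
    have g: "?g \<in> Arr N" "arr_map G ?g = f" "Dom N ?g = map (obj_map F) (Dom M f)"
       "Cod N ?g = obj_map F (Cod M f)"
      using F' inv f by auto
    note \<nu> = commutative_monoidD[OF m]
    have c1: "composable N ?g (map (\<mu> n) (Dom N ?g))"
      using \<nu> N.Dom[OF g(1)] g(1) by (auto simp: composable_def subset_iff map_idI)
    have c2: "composable N (\<mu> n (Cod N ?g)) (replicate n ?g)"
      using \<nu> N.Cod[OF g(1)] g(1) by (auto simp: composable_def map_replicate)
    have t: "dom_permutes N ?t (Comp N (\<mu> n (Cod N ?g)) (replicate n ?g))"
      using N.Comp[OF c2] transpose_perm_permutes[of "length (Dom M f)" n] g(3)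
      by (simp add: dom_permutes_def length_concat sum_list_replicate mult.commute)
    have "Comp M f (map (?\<mu> n) (Dom M f)) = arr_map G (Comp N ?g (map (\<mu> n) (Dom N ?g)))"
      using G'(6)[OF c1] g by (simp add: comp_def)
    also have "Comp N ?g (map (\<mu> n) (Dom N ?g)) = Act N ?t (Comp N (\<mu> n (Cod N ?g)) (replicate n ?g))"
      using natural_monoidsD(2)[OF \<mu> g(1)] g(3) by simp
    also have "arr_map G \<dots> = Act M ?t (Comp M (?\<mu> n (Cod M f)) (replicate n f))"
      using G'(7)[OF _ t] N.Comp[OF c2] G'(6)[OF c2] g by simp
    finally show ?thesis .
  qed
  ultimately show ?thesis
    by (auto simp: natural_monoids_def intro!: exI[of _ ?\<mu>])
qed

lemma (in symmetric_multicategory) natural_monoids_imp_magma: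
  assumes \<mu>: "natural_monoids M \<mu>"
  shows "natural_unital_magma M (\<mu> 0) (\<mu> 2)"
proof
  fix A assume "A \<in> Obj M"
  then have "commutative_monoid M A (\<lambda>n. \<mu> n A)"
    using \<mu> by (simp add: natural_monoids_def)
  note \<nu> = commutative_monoidD[OF this]
  show "\<mu> 0 A \<in> Arr M \<and> Dom M (\<mu> 0 A) = [] \<and> Cod M (\<mu> 0 A) = A"
    "\<mu> 2 A \<in> Arr M \<and> Dom M (\<mu> 2 A) = [A, A] \<and> Cod M (\<mu> 2 A) = A"
    using \<nu>(2-4) by (auto simp: numeral_2_eq_2)
  show "Comp M (\<mu> 2 A) [Idt M A, \<mu> 0 A] = Idt M A" "Comp M (\<mu> 2 A) [\<mu> 0 A, Idt M A] = Idt M A"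
    using \<nu>(6)[of "[1, 0]"] \<nu>(6)[of "[0, 1]"] \<nu>(5) by (simp_all add: numeral_2_eq_2)
next
  fix f assume f: "f \<in> Arr M"
  then have n: "Comp M f (map (\<mu> n) (Dom M f)) =
      Act M (transpose_perm (length (Dom M f)) n) (Comp M (\<mu> n (Cod M f)) (replicate n f))" for n
    using \<mu> by (simp add: natural_monoids_def)
  have "commutative_monoid M (Cod M f) (\<lambda>n. \<mu> n (Cod M f))"
    using \<mu> Cod[OF f] by (simp add: natural_monoids_def)
  note \<nu> = commutative_monoidD[OF this]
  show "Comp M f (map (\<mu> 0) (Dom M f)) = \<mu> 0 (Cod M f)"
    using n[of 0] \<nu>(2,3)[of 0] by (simp add: Comp_nullary Act_id)
  show "Comp M f (map (\<mu> 2) (Dom M f)) =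
      Act M (transpose_perm (length (Dom M f)) 2) (Comp M (\<mu> 2 (Cod M f)) [f, f])"
    using n[of 2] by (simp add: numeral_2_eq_2)
qed

section \<open>Reconstruction from the category of unary arrows\<close>

lemma (in symmetric_multicategory) category_unary: "category (unary M)"
proof
  have un: "f \<in> Mor (unary M) \<longleftrightarrow> f \<in> Arr M \<and> Dom M f = [Src (unary M) f]" for f
    by (cases "Dom M f") (auto simp: unary_def)
  have cm: "composable M f [g]" if "f \<in> Mor (unary M)" "g \<in> Mor (unary M)" "Src (unary M) f = Tgt (unary M) g"
    for f g
    using that un by (auto simp: composable_def unary_def)
  fix f g h assume fgh: "f \<in> Mor (unary M)" "g \<in> Mor (unary M)" "h \<in> Mor (unary M)"
    "Src (unary M) f = Tgt (unary M) g" "Src (unary M) g = Tgt (unary M) h"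
  then show "Cmp (unary M) (Cmp (unary M) f g) h = Cmp (unary M) f (Cmp (unary M) g h)"
    using Comp_assoc[OF cm[of f g], of "[[h]]"] cm[of g h] by (simp add: unary_def)
next
  fix f g assume "f \<in> Mor (unary M)" "g \<in> Mor (unary M)" "Src (unary M) f = Tgt (unary M) g"
  moreover from this have "composable M f [g]"
    by (cases "Dom M f") (auto simp: composable_def unary_def)
  ultimately show "Cmp (unary M) f g \<in> Mor (unary M) \<and> Src (unary M) (Cmp (unary M) f g) = Src (unary M) g \<and>
      Tgt (unary M) (Cmp (unary M) f g) = Tgt (unary M) f"
    using Comp by (auto simp: unary_def)
next
  fix f assume f: "f \<in> Mor (unary M)"
  then obtain A where A: "f \<in> Arr M" "Dom M f = [A]"
    by (auto simp: unary_def length_Suc_conv)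
  then show "Cmp (unary M) f (Ident (unary M) (Src (unary M) f)) = f"
    using Comp_unary_Idt by (auto simp: unary_def)
  show "Src (unary M) f \<in> Ob (unary M)" "Tgt (unary M) f \<in> Ob (unary M)"
    using Dom[OF A(1)] Cod[OF A(1)] A by (auto simp: unary_def)
  show "Cmp (unary M) (Ident (unary M) (Tgt (unary M) f)) f = f"
    using Comp_Idt_left[OF A(1)] by (simp add: unary_def)
next
  fix X assume "X \<in> Ob (unary M)"
  then show "Ident (unary M) X \<in> Mor (unary M) \<and> Src (unary M) (Ident (unary M) X) = X \<and>
      Tgt (unary M) (Ident (unary M) X) = X"
    using Idt by (simp add: unary_def)
qed

text \<open>The isomorphism is the identity on objects and takes an arrow to its list of components.
  The codomain is stored alongside since the empty list does not determine it.\<close>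

lemma (in natural_unital_magma) isomorphic_seq_unary: "M \<cong> seq (unary M)"
proof -
  let ?N = "seq (unary M)"
  define F where "F = \<lparr>obj_map = (\<lambda>A \<in> Obj M. A), arr_map = (\<lambda>f \<in> Arr M. (comps f, Cod M f))\<rparr>"
  have arr: "g \<in> Arr ?N \<longleftrightarrow> snd g \<in> Obj M \<and> (\<forall>c \<in> set (fst g). c \<in> Arr M \<and> length (Dom M c) = 1 \<and> Cod M c = snd g)" for g
    by (auto simp: seq_def unary_def case_prod_beta)
  have Farr: "(comps f, Cod M f) \<in> Arr ?N" if "f \<in> Arr M" for f
    using that compsD Cod by (auto simp: arr)
  have "symmetric_functor M ?N F"
    unfolding symmetric_functor_def
  proof (intro conjI ballI allI impI)
    show "obj_map F \<in> Obj M \<rightarrow>\<^sub>E Obj ?N"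
      by (auto simp: F_def seq_def unary_def)
    show "arr_map F \<in> Arr M \<rightarrow>\<^sub>E Arr ?N"
      using Farr by (auto simp: F_def)
  next
    fix f assume f: "f \<in> Arr M"
    have "map (obj_map F) (Dom M f) = Dom M f"
      using Dom[OF f] by (intro map_idI) (auto simp: F_def)
    then show "Dom ?N (arr_map F f) = map (obj_map F) (Dom M f)"
      using f Dom_comps[OF f] by (simp add: F_def seq_def unary_def)
    show "Cod ?N (arr_map F f) = obj_map F (Cod M f)"
      using f Cod[OF f] by (simp add: F_def seq_def)
  next
    fix A assume "A \<in> Obj M"
    then show "arr_map F (Idt M A) = Idt ?N (obj_map F A)"
      using Idt[of A] by (simp add: F_def comps_Idt seq_def unary_def)
  next
    fix f gs assume c: "composable M f gs"
    then have f: "f \<in> Arr M" "set gs \<subseteq> Arr M"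
      by (auto simp: composable_def)
    have "length (comps f) = length gs"
      using c by (metis composable_def length_comps length_map)
    then have "map2 (\<lambda>f g. map (Cmp (unary M) f) (fst g)) (comps f) (map (arr_map F) gs) =
        map2 (\<lambda>c g. map (\<lambda>k. Comp M c [k]) (comps g)) (comps f) gs"
      using f(2) by (intro nth_equalityI) (auto simp: F_def unary_def subset_iff)
    then show "arr_map F (Comp M f gs) = Comp ?N (arr_map F f) (map (arr_map F) gs)"
      using f(1) Comp_closed[OF c] by (simp add: F_def comps_Comp[OF c] seq_def)
  next
    fix f \<sigma> assume "f \<in> Arr M" "dom_permutes M \<sigma> f"
    then show "arr_map F (Act M \<sigma> f) = Act ?N \<sigma> (arr_map F f)"
      using Act[of f \<sigma>] by (simp add: F_def comps_Act seq_def)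
  qed
  moreover have "bij_betw (obj_map F) (Obj M) (Obj ?N)"
    by (simp add: F_def seq_def unary_def bij_betw_def inj_on_def)
  moreover have "bij_betw (arr_map F) (Arr M) (Arr ?N)"
  proof (rule bij_betw_imageI)
    show "inj_on (arr_map F) (Arr M)"
      by (auto simp: inj_on_def F_def intro: comps_inject)
    have "g \<in> arr_map F ` Arr M" if g: "g \<in> Arr ?N" for g
    proof -
      obtain f where f: "f \<in> Arr M" "Cod M f = snd g" "comps f = fst g"
        using comps_surjective[of "snd g" "fst g"] g arr by auto
      then have "arr_map F f = g"
        by (simp add: F_def)
      with f show ?thesis
        by blast
    qed
    then show "arr_map F ` Arr M = Arr ?N"
      using Farr by (auto simp: F_def)
  qed
  ultimately have "isomorphism M ?N F"
    by (intro isomorphism_if_bij symmetric_multicategory_axioms)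
  then show ?thesis
    by (auto simp: isomorphic_def)
qed

lemma natural_monoids_if_sequential:
  fixes M :: "('o, 'a) multicategory"
  assumes "symmetric_multicategory M" "sequential M"
  shows "\<exists>\<mu>. natural_monoids M \<mu>"
proof -
  obtain C :: "('o, 'a) category" and F where "category C" "isomorphism M (seq C) F"
    using assms(2) unfolding sequential_def isomorphic_def by blast
  then show ?thesis
    using natural_monoids_transport[OF assms(1) symmetric_multicategory_seq _ natural_monoids_seq] by blast
qed

section \<open>Central monoids and central unital magmas\<close>

context symmetric_multicategory
begin

lemma length_Dom_Comp_replicate:
  assumes "f \<in> Arr M" "g \<in> Arr M" "Dom M g = replicate n (Cod M f)"
  shows "Comp M g (replicate n f) \<in> Arr M" "length (Dom M (Comp M g (replicate n f))) = n * length (Dom M f)"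
proof -
  have "composable M g (replicate n f)"
    using assms by (auto simp: composable_def map_replicate)
  from Comp_closed[OF this]
  show "Comp M g (replicate n f) \<in> Arr M"
    "length (Dom M (Comp M g (replicate n f))) = n * length (Dom M f)"
    by (simp_all add: length_concat map_replicate sum_list_replicate)
qed

lemma length_Dom_Comp_map:
  assumes f: "f \<in> Arr M" and \<mu>: "\<And>A. A \<in> Obj M \<Longrightarrow> commutative_monoid M A (\<lambda>n. \<mu> n A)"
  shows "Comp M f (map (\<mu> n) (Dom M f)) \<in> Arr M"
    "length (Dom M (Comp M f (map (\<mu> n) (Dom M f)))) = n * length (Dom M f)"
proof -
  have c: "composable M f (map (\<mu> n) (Dom M f))"
    using f Dom[OF f] commutative_monoidD(2,4)[OF \<mu>] by (auto simp: composable_def subset_iff map_idI)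
  have "map (length \<circ> Dom M) (map (\<mu> n) (Dom M f)) = replicate (length (Dom M f)) n"
    using Dom[OF f] commutative_monoidD(3)[OF \<mu>] by (auto simp: subset_iff simp flip: map_replicate_const)
  then show "Comp M f (map (\<mu> n) (Dom M f)) \<in> Arr M"
    "length (Dom M (Comp M f (map (\<mu> n) (Dom M f)))) = n * length (Dom M f)"
    using Comp_closed[OF c] by (simp_all add: length_concat sum_list_replicate mult.commute comp_assoc)
qed

lemma Act_transpose_perm_inverse:
  assumes "f \<in> Arr M" "length (Dom M f) = m * n"
  shows "Act M (transpose_perm n m) (Act M (transpose_perm m n) f) = f"
  using assms transpose_perm_permutes[of m n] transpose_perm_permutes[of n m]
  by (simp add: Act_Act dom_permutes_def transpose_perm_comp Act_id mult.commute)

text \<open>Read in this direction, the interchange law says that \<open>f\<close> is a homomorphism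
  of monoids. This is naturality in \<open>hom one_seq M\<close> and also the orientation of the
  interchange relation in \<open>tensor one_seq M\<close>.\<close>

lemma natural_monoids_inverse:
  assumes \<mu>: "natural_monoids M \<mu>" and f: "f \<in> Arr M"
  shows "Comp M (\<mu> n (Cod M f)) (replicate n f) =
    Act M (transpose_perm n (length (Dom M f))) (Comp M f (map (\<mu> n) (Dom M f)))"
proof -
  note \<nu> = commutative_monoidD[OF natural_monoidsD(1)[OF \<mu> Cod[OF f]]]
  show ?thesis
    unfolding natural_monoidsD(2)[OF \<mu> f]
    using length_Dom_Comp_replicate[OF f \<nu>(2,3)] by (simp add: Act_transpose_perm_inverse mult.commute)
qed

lemma symmetric_functor_id: "symmetric_functor M M (id_functor M)"
proof -
  have "map (arr_map (id_functor M)) gs = gs" if "composable M f gs" for f gs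
    using that by (intro map_idI) (auto simp: id_functor_def composable_def)
  moreover have "map (obj_map (id_functor M)) (Dom M f) = Dom M f" if "f \<in> Arr M" for f
    using Dom[OF that] by (intro map_idI) (auto simp: id_functor_def)
  moreover have "f \<in> Arr M" if "composable M f gs" for f gs
    using that by (simp add: composable_def)
  ultimately show ?thesis
    using Cod Idt Comp Act by (simp add: symmetric_functor_def) (simp add: id_functor_def)
qed

lemma central_monoid_if_natural_monoids:
  assumes \<mu>: "natural_monoids M \<mu>"
  shows "\<exists>U. central_monoid M U"
proof -
  let ?I = "id_functor M" and ?H = "hom M M"
  \<comment> \<open>The components are restricted to objects because arrows of the internal hom are
    extensional families.\<close>
  let ?\<nu> = "\<lambda>n. (replicate n ?I, ?I, restrict (\<mu> n) (Obj M))"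
  note \<nu> = commutative_monoidD[OF natural_monoidsD(1)[OF \<mu>]]
  have "natural M M (?\<nu> n)" for n
  proof -
    have "map (restrict (\<mu> n) (Obj M)) (Dom M f) = map (\<mu> n) (Dom M f)" if "f \<in> Arr M" for f
      using Dom[OF that] by auto
    note m = this
    have "Comp M (arr_map ?I f) (map (restrict (\<mu> n) (Obj M)) (Dom M f)) =
        Act M (transpose_perm (length (Dom M f)) (length (replicate n ?I)))
          (Comp M (restrict (\<mu> n) (Obj M) (Cod M f)) (map (\<lambda>G. arr_map G f) (replicate n ?I)))"
      if "f \<in> Arr M" for f
      using natural_monoidsD(2)[OF \<mu> that] that Cod[OF that]
      by (simp add: m id_functor_def map_replicate)
    then show ?thesis
      using \<nu>(2-4) symmetric_functor_id by (auto simp: natural_def id_functor_def map_replicate)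
  qed
  moreover have "Comp ?H (?\<nu> (length ns)) (map ?\<nu> ns) = ?\<nu> (sum_list ns)" for ns
  proof -
    have "concat (map (\<lambda>n. replicate n ?I) ns) = replicate (sum_list ns) ?I"
      by (induction ns) (simp_all add: replicate_add)
    then show ?thesis
      using \<nu>(6) by (auto simp: hom_def component_def comp_def intro!: restrict_ext)
  qed
  moreover have "Act ?H \<sigma> (?\<nu> n) = ?\<nu> n" if "\<sigma> permutes {..<n}" for \<sigma> n
  proof -
    have "permute_list \<sigma> (replicate n ?I) = replicate n ?I"
      by (simp add: list_eq_iff_nth_eq permute_list_nth that) (metis lessThan_iff nth_replicate permutes_in_image that)
    then show ?thesis
      using \<nu>(7) that by (auto simp: hom_def intro!: restrict_ext)
  qed
  moreover have "?\<nu> 1 = Idt ?H ?I"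
    using \<nu>(5) by (auto simp: hom_def id_functor_def intro!: restrict_ext)
  ultimately have "commutative_monoid ?H ?I ?\<nu>"
    using symmetric_functor_id unfolding commutative_monoid_def by (simp add: hom_def)
  then have "central_monoid M \<lparr>obj_map = \<lambda>_. ?I, arr_map = \<lambda>f. ?\<nu> (length (fst f))\<rparr>"
    by (simp add: central_monoid_def symmetric_functor_one_seq_iff)
  then show ?thesis ..
qed

lemma central_unital_magma_if_central_monoid:
  assumes U: "central_monoid M U"
  shows "\<exists>m0 m2. central_unital_magma M m0 m2"
proof -
  let ?I = "id_functor M" and ?H = "hom M M"
  define \<nu> where "\<nu> = (\<lambda>n. arr_map U (replicate n (), ()))"
  have "commutative_monoid ?H ?I \<nu>"
    using U unfolding central_monoid_def symmetric_functor_one_seq_iff \<nu>_def by metis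
  note \<nu> = commutative_monoidD[OF this]
  have "\<nu> n \<in> Arr (center M)" for n
    using \<nu>(2-4) by (auto simp: center_def full_sub_def)
  moreover have "Dom (center M) = Dom ?H" "Comp (center M) = Comp ?H" "Idt (center M) = Idt ?H"
    by (simp_all add: center_def full_sub_def)
  ultimately have "central_unital_magma M (\<nu> 0) (\<nu> 2)"
    using \<nu>(3,5) \<nu>(6)[of "[0, 1]"] \<nu>(6)[of "[1, 0]"]
    by (simp add: central_unital_magma_def numeral_2_eq_2)
  then show ?thesis
    by blast
qed

lemma natural_unital_magma_if_central:
  assumes "central_unital_magma M m0 m2"
  shows "natural_unital_magma M (component m0) (component m2)"
proof -
  let ?I = "id_functor M"
  obtain \<alpha> where 0: "m0 = ([], ?I, \<alpha>)" "natural M M ([], ?I, \<alpha>)"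
    using assms by (cases m0) (auto simp: central_unital_magma_def center_def full_sub_def hom_def Let_def)
  obtain \<beta> where 2: "m2 = ([?I, ?I], ?I, \<beta>)" "natural M M ([?I, ?I], ?I, \<beta>)"
    using assms by (cases m2)
      (auto simp: central_unital_magma_def center_def full_sub_def hom_def Let_def length_Suc_conv numeral_2_eq_2)
  have "Comp M (\<beta> A) [\<alpha> A, Idt M A] = Idt M A" "Comp M (\<beta> A) [Idt M A, \<alpha> A] = Idt M A" if "A \<in> Obj M" for A
  proof -
    have "(\<lambda>A \<in> Obj M. Comp M (\<beta> A) [\<alpha> A, (\<lambda>A \<in> Obj M. Idt M (obj_map ?I A)) A]) =
        (\<lambda>A \<in> Obj M. Idt M (obj_map ?I A))"
      "(\<lambda>A \<in> Obj M. Comp M (\<beta> A) [(\<lambda>A \<in> Obj M. Idt M (obj_map ?I A)) A, \<alpha> A]) =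
        (\<lambda>A \<in> Obj M. Idt M (obj_map ?I A))"
      using assms
      by (simp_all add: central_unital_magma_def center_def full_sub_def hom_def Let_def 0 2 component_def)
    from this[THEN fun_cong, of A] show
      "Comp M (\<beta> A) [\<alpha> A, Idt M A] = Idt M A" "Comp M (\<beta> A) [Idt M A, \<alpha> A] = Idt M A"
      using that by (simp_all add: id_functor_def)
  qed
  moreover have "Comp M f (map \<alpha> (Dom M f)) = \<alpha> (Cod M f)" if f: "f \<in> Arr M" for f
  proof -
    have "\<alpha> (Cod M f) \<in> Arr M" "Dom M (\<alpha> (Cod M f)) = []"
      using 0(2) Cod[OF f] by (auto simp: natural_def)
    then show ?thesis
      using 0(2) f by (simp add: natural_def id_functor_def Comp_nullary Act_id)
  qed
  moreover have "Comp M f (map \<beta> (Dom M f)) =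
      Act M (transpose_perm (length (Dom M f)) 2) (Comp M (\<beta> (Cod M f)) [f, f])" if f: "f \<in> Arr M" for f
    using 2(2) f by (auto simp: natural_def id_functor_def numeral_2_eq_2)
  ultimately show ?thesis
    using 0 2 by unfold_locales (auto simp: component_def natural_def id_functor_def)
qed

end

section \<open>The monoids of a sequential multicategory\<close>

text \<open>All components of \<open>\<nu> n\<close> are identities, so the unit laws already determine a commutative monoid.\<close>

lemma (in natural_unital_magma) commutative_monoid_unique:
  assumes "commutative_monoid M A \<nu>" "commutative_monoid M A \<nu>'"
  shows "\<nu> = \<nu>'"
proof -
  have comps_\<nu>: "comps (\<nu> n) = replicate n (Idt M A)" if "commutative_monoid M A \<nu>" for \<nu> n
  proof (rule nth_equalityI)
    note \<nu> = commutative_monoidD[OF that]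
    \<comment> \<open>Nullary arrows into \<open>A\<close> have no components, so there is only one;
      the entries of a row are therefore operations of the monoid itself.\<close>
    have "comps (\<nu> 0) = comps (z A)"
      using \<nu>(3) unit[OF \<nu>(1)] by (simp add: comps_def)
    then have z: "z A = \<nu> 0"
      using \<nu> unit[OF \<nu>(1)] by (intro comps_inject) auto
    fix i assume "i < length (comps (\<nu> n))"
    then have i: "i < n"
      using \<nu>(3) by simp
    \<comment> \<open>The row is the image under \<open>\<nu>\<close> of the list with
      \<open>1\<close> at position \<open>i\<close> and \<open>0\<close> elsewhere. Its sum is
      \<open>1\<close>, so the composition law yields \<open>\<nu> 1\<close>, the identity.\<close>
    have "comps (\<nu> n) ! i = Comp M (\<nu> n) (map \<nu> ((replicate n 0)[i := 1]))"
      using i \<nu>(3,5) by (simp add: comps_def rows_def map_update z map_replicate)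
    also have "\<dots> = \<nu> (sum_list ((replicate n 0)[i := 1]))"
      using \<nu>(6)[of "(replicate n 0)[i := 1]"] by simp
    also have "sum_list ((replicate n 0)[i := 1]) = (1 :: nat)"
      using i by (simp add: sum_list_update sum_list_replicate)
    finally show "comps (\<nu> n) ! i = replicate n (Idt M A) ! i"
      using \<nu>(5) i by simp
  qed (use commutative_monoidD(3)[OF that] in simp)
  have "\<nu> n = \<nu>' n" for n
    using assms comps_\<nu> by (intro comps_inject) (auto simp: commutative_monoid_def)
  then show ?thesis ..
qed

context symmetric_multicategory
begin

text \<open>The inverse \<open>K\<close> equips each object with its only commutative monoid and
  regards each arrow as a homomorphism. As \<open>one_seq\<close> has one object, a transformation
  has one component, and its source and target functors are forced by uniqueness. Bijectivity is
  checked for \<open>K\<close>, whose source \<open>M\<close> is the known multicategory, and the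
  inverse of \<open>K\<close> is then identified with the forgetful functor.\<close>

lemma isomorphism_forget_monoid:
  assumes \<mu>: "natural_monoids M \<mu>"
  shows "isomorphism (hom one_seq M) M (forget_monoid M)"
proof -
  interpret natural_unital_magma M "\<mu> 0" "\<mu> 2"
    by (rule natural_monoids_imp_magma[OF \<mu>])
  let ?H = "hom one_seq M"
  define mon where "mon = (\<lambda>A. \<lparr>obj_map = (\<lambda>_ :: unit. A), arr_map = (\<lambda>f :: unit list \<times> unit. \<mu> (length (fst f)) A)\<rparr>)"
  have mon: "symmetric_functor one_seq M (mon A)" if "A \<in> Obj M" for A
    using natural_monoidsD(1)[OF \<mu> that] by (simp add: symmetric_functor_one_seq_iff mon_def)
  have mon_unique: "G = mon (obj_map G ())" "obj_map G () \<in> Obj M" if G: "symmetric_functor one_seq M G" for G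
  proof -
    show A: "obj_map G () \<in> Obj M"
      using symmetric_functorD(1)[OF G] by simp
    have "(\<lambda>n. arr_map G (replicate n (), ())) = (\<lambda>n. \<mu> n (obj_map G ()))"
      using G natural_monoidsD(1)[OF \<mu> A]
      by (intro commutative_monoid_unique) (auto simp: symmetric_functor_one_seq_iff)
    then have "arr_map G f = \<mu> (length (fst f)) (obj_map G ())" for f
      using fun_cong one_seq_arr[of f] by metis
    then show "G = mon (obj_map G ())"
      by (auto simp: mon_def intro!: multifunctor.equality)
  qed
  have restrict_unit [simp]: "restrict \<alpha> UNIV = \<alpha>" for \<alpha> :: "unit \<Rightarrow> 'a"
    by auto
  have natural: "natural one_seq M (map mon (Dom M f), mon (Cod M f), \<lambda>_. f)" if f: "f \<in> Arr M" for f
  proof -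
    show ?thesis
      using f natural_monoids_inverse[OF \<mu> f] Dom[OF f] Cod[OF f] mon
      by (auto simp: natural_def Dom_one_seq map_replicate_const) (auto simp: mon_def comp_def)
  qed
  define K where "K = \<lparr>obj_map = (\<lambda>A \<in> Obj M. mon A),
    arr_map = (\<lambda>f \<in> Arr M. (map mon (Dom M f), mon (Cod M f), \<lambda>_ :: unit. f))\<rparr>"
  have K: "symmetric_functor M ?H K"
    unfolding symmetric_functor_def
  proof (intro conjI ballI allI impI)
    show "obj_map K \<in> Obj M \<rightarrow>\<^sub>E Obj ?H" "arr_map K \<in> Arr M \<rightarrow>\<^sub>E Arr ?H"
      using mon natural by (auto simp: K_def hom_def)
  next
    fix f assume f: "f \<in> Arr M"
    then show "Dom ?H (arr_map K f) = map (obj_map K) (Dom M f)" "Cod ?H (arr_map K f) = obj_map K (Cod M f)"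
      using Dom[OF f] Cod[OF f] by (auto simp: K_def hom_def)
  next
    fix A assume "A \<in> Obj M"
    then show "arr_map K (Idt M A) = Idt ?H (obj_map K A)"
      using Idt by (auto simp: K_def hom_def mon_def)
  next
    fix f gs assume c: "composable M f gs"
    then have gs: "f \<in> Arr M" "set gs \<subseteq> Arr M"
      by (auto simp: composable_def)
    have "map fst (map (arr_map K) gs) = map (map mon) (map (Dom M) gs)"
      "map (\<lambda>\<beta>. component \<beta> ()) (map (arr_map K) gs) = gs"
      using gs(2) by (auto simp: K_def component_def subset_iff intro!: map_idI)
    moreover have "arr_map K h = (map mon (Dom M h), mon (Cod M h), \<lambda>_. h)" if "h \<in> Arr M" for h
      using that by (simp add: K_def)
    ultimately show "arr_map K (Comp M f gs) = Comp ?H (arr_map K f) (map (arr_map K) gs)"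
      using gs(1) Comp_closed[OF c] by (simp add: hom_def map_concat del: map_map)
  next
    fix f \<sigma> assume "f \<in> Arr M" "dom_permutes M \<sigma> f"
    then show "arr_map K (Act M \<sigma> f) = Act ?H \<sigma> (arr_map K f)"
      using Act[of f \<sigma>] by (simp add: K_def hom_def permute_list_map dom_permutes_def)
  qed
  have KO: "obj_map K A = mon A" "obj_map (mon A) () = A" if "A \<in> Obj M" for A
    using that by (simp_all add: K_def mon_def)
  have bo: "bij_betw (obj_map K) (Obj M) (Obj ?H)"
  proof (rule bij_betwI[where g = "\<lambda>G. obj_map G ()"])
    show "obj_map K \<in> Obj M \<rightarrow> Obj ?H"
      using symmetric_functorD(1)[OF K] by auto
    show "(\<lambda>G. obj_map G ()) \<in> Obj ?H \<rightarrow> Obj M"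
      using mon_unique by (auto simp: hom_def)
    show "obj_map (obj_map K A) () = A" if "A \<in> Obj M" for A
      using that by (simp add: KO)
    show "obj_map K (obj_map G ()) = G" if "G \<in> Obj ?H" for G
      using that mon_unique[of G] KO by (simp add: hom_def)
  qed
  have ba: "bij_betw (arr_map K) (Arr M) (Arr ?H)"
  proof (rule bij_betwI[where g = "\<lambda>\<alpha>. component \<alpha> ()"])
    show "arr_map K \<in> Arr M \<rightarrow> Arr ?H"
      using symmetric_functorD(2)[OF K] by auto
    show "(\<lambda>\<alpha>. component \<alpha> ()) \<in> Arr ?H \<rightarrow> Arr M"
      by (auto simp: hom_def natural_def component_def)
    show "component (arr_map K f) () = f" if "f \<in> Arr M" for f
      using that by (simp add: K_def component_def)
    show "arr_map K (component \<alpha> ()) = \<alpha>" if \<alpha>: "\<alpha> \<in> Arr ?H" for \<alpha>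
    proof -
      obtain Gs G a where a: "\<alpha> = (Gs, G, a)"
        by (rule prod_cases3)
      have n: "\<And>G. G \<in> set Gs \<Longrightarrow> symmetric_functor one_seq M G" "symmetric_functor one_seq M G"
        "a () \<in> Arr M" "Dom M (a ()) = map (\<lambda>G. obj_map G ()) Gs" "Cod M (a ()) = obj_map G ()"
        using \<alpha> by (auto simp: a hom_def natural_def)
      have "map mon (Dom M (a ())) = Gs"
        using n(1) mon_unique(1) by (auto simp: n(4) intro!: map_idI)
      moreover have "(\<lambda>_. a ()) = a"
        by auto
      ultimately show ?thesis
        using n(3,5) mon_unique(1)[OF n(2)] by (simp add: a component_def K_def)
    qed
  qed
  have "isomorphism M ?H K"
    by (rule isomorphism_if_bij[OF symmetric_multicategory_axioms K bo ba])
  then obtain G where G: "symmetric_functor ?H M G"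
    "\<And>A. A \<in> Obj M \<Longrightarrow> obj_map G (obj_map K A) = A" "\<And>f. f \<in> Arr M \<Longrightarrow> arr_map G (arr_map K f) = f"
    "\<And>A. A \<in> Obj ?H \<Longrightarrow> obj_map K (obj_map G A) = A" "\<And>f. f \<in> Arr ?H \<Longrightarrow> arr_map K (arr_map G f) = f"
    by (rule isomorphismE) (rule that)
  note G' = symmetric_functorD[OF G(1)]
  \<comment> \<open>On the carrier this cancels \<open>K\<close>; off the carrier both functors are
    \<open>undefined\<close> by extensionality.\<close>
  have "obj_map G F = obj_map (forget_monoid M) F" for F
  proof (cases "F \<in> Obj ?H")
    case True
    then show ?thesis
      using KO[OF G'(1)[OF True]] G(4) by (simp add: forget_monoid_def)
  next
    case False
    then show ?thesis
      using symmetric_functor_undefined(1)[OF G(1)] by (simp add: forget_monoid_def)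
  qed
  moreover have "arr_map G \<alpha> = arr_map (forget_monoid M) \<alpha>" for \<alpha>
  proof (cases "\<alpha> \<in> Arr ?H")
    case True
    have "component (arr_map K (arr_map G \<alpha>)) () = arr_map G \<alpha>"
      using G'(2)[OF True] by (simp add: K_def component_def)
    then show ?thesis
      using True G(5) by (simp add: forget_monoid_def)
  next
    case False
    then show ?thesis
      using symmetric_functor_undefined(2)[OF G(1)] by (simp add: forget_monoid_def)
  qed
  ultimately have "G = forget_monoid M"
    by (auto intro!: multifunctor.equality)
  then show ?thesis
    using isomorphismI[OF G(1) K G(4,5,2,3)] by simp
qed

text \<open>The inverse \<open>G\<close> selects a monoid on each object. Since forgetting undoes
  \<open>G\<close>, the transformation \<open>G\<close> assigns to \<open>f\<close> has
  \<open>f\<close> as its component, so naturality at the arrow of arity \<open>n\<close> is the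
  interchange law up to inverting the transposition.\<close>

lemma natural_monoids_if_isomorphism_forget_monoid:
  assumes iso: "isomorphism (hom one_seq M) M (forget_monoid M)"
  shows "\<exists>\<mu>. natural_monoids M \<mu>"
proof -
  let ?H = "hom one_seq M" and ?F = "forget_monoid M"
  obtain G where G: "symmetric_functor M ?H G"
    "\<And>A. A \<in> Obj M \<Longrightarrow> obj_map ?F (obj_map G A) = A" "\<And>f. f \<in> Arr M \<Longrightarrow> arr_map ?F (arr_map G f) = f"
    using iso by (rule isomorphismE) (rule that)
  note G' = symmetric_functorD[OF G(1)]
  define \<mu> where "\<mu> = (\<lambda>n A. arr_map (obj_map G A) (replicate n (), ()))"
  have \<mu>: "commutative_monoid M A (\<lambda>n. \<mu> n A)" if A: "A \<in> Obj M" for A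
  proof -
    have "symmetric_functor one_seq M (obj_map G A)"
      using G'(1)[OF A] by (simp add: hom_def)
    moreover have "obj_map (obj_map G A) () = A"
      using G(2)[OF A] G'(1)[OF A] by (simp add: forget_monoid_def)
    ultimately show ?thesis
      by (simp add: symmetric_functor_one_seq_iff \<mu>_def)
  qed
  moreover have "Comp M f (map (\<mu> n) (Dom M f)) =
      Act M (transpose_perm (length (Dom M f)) n) (Comp M (\<mu> n (Cod M f)) (replicate n f))"
    if f: "f \<in> Arr M" for f n
  proof -
    obtain Fs F \<alpha> where Gf: "arr_map G f = (Fs, F, \<alpha>)"
      by (rule prod_cases3)
    have "natural one_seq M (Fs, F, \<alpha>)" "Fs = map (obj_map G) (Dom M f)" "F = obj_map G (Cod M f)"
      using G'(2-4)[OF f] by (auto simp: Gf hom_def)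
    moreover have "\<alpha> () = f"
      using G(3)[OF f] G'(2)[OF f] by (simp add: Gf forget_monoid_def component_def)
    moreover have "Comp M (arr_map F g) (map \<alpha> (Dom one_seq g)) =
        Act M (transpose_perm (length (Dom one_seq g)) (length Fs))
          (Comp M (\<alpha> (Cod one_seq g)) (map (\<lambda>G. arr_map G g) Fs))" for g
      using \<open>natural one_seq M (Fs, F, \<alpha>)\<close> by (cases g) (simp add: natural_def)
    note this[of "(replicate n (), ())"]
    ultimately have "Comp M (\<mu> n (Cod M f)) (replicate n f) =
        Act M (transpose_perm n (length (Dom M f))) (Comp M f (map (\<mu> n) (Dom M f)))"
      by (simp add: \<mu>_def comp_def map_replicate)
    moreover have "Comp M f (map (\<mu> n) (Dom M f)) \<in> Arr M"
      "length (Dom M (Comp M f (map (\<mu> n) (Dom M f)))) = n * length (Dom M f)"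
      using length_Dom_Comp_map[OF f, of \<mu> n] \<mu> by auto
    ultimately show ?thesis
      by (simp add: Act_transpose_perm_inverse)
  qed
  ultimately show ?thesis
    by (auto simp: natural_monoids_def)
qed

end

section \<open>The tensor product as a symmetric multicategory\<close>

locale multicategory_pair = M: symmetric_multicategory M + N: symmetric_multicategory N
  for M :: "('o, 'a) multicategory" and N :: "('p, 'b) multicategory"
begin

abbreviation "wt \<equiv> twf M N"
abbreviation "dm \<equiv> tdom M N"
abbreviation "cd \<equiv> tcod M N"
abbreviation "eq \<equiv> bv_eq M N"
abbreviation "cls \<equiv> bv_class M N"
abbreviation "rep \<equiv> bv_rep"
abbreviation "T \<equiv> tensor M N"

lemma wf_Obj: "wt t \<Longrightarrow> set (dm t) \<subseteq> Obj M \<times> Obj N \<and> cd t \<in> Obj M \<times> Obj N"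
proof (induction t)
  case (GenL f X)
  then show ?case
    using M.Dom M.Cod by auto
next
  case (GenR A h)
  then show ?case
    using N.Dom N.Cod by auto
qed auto

lemma wf_TComp_TComp:
  assumes "list_all2 (\<lambda>t us. wt (TComp t us)) ts uss"
  shows "map cd (concat uss) = concat (map dm ts)" "\<forall>u \<in> set (concat uss). wt u"
    "\<forall>v \<in> set (map2 TComp ts uss). wt v" "map cd (map2 TComp ts uss) = map cd ts"
    "concat (map dm (map2 TComp ts uss)) = concat (map dm (concat uss))"
  using assms by (induction rule: list_all2_induct) auto

text \<open>This lets domain and codomain descend to classes. The case of \<open>interchange\<close>
  compares the same table of pairs listed by rows and by columns.\<close>

lemma eqD: "eq s t \<Longrightarrow> wt s \<and> wt t \<and> dm s = dm t \<and> cd s = cd t"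
proof (induction rule: bv_eq.induct)
  case (cong_TComp s t ss ts)
  have "map dm ss = map dm ts"
    using cong_TComp.IH(2) by (induction rule: list_all2_induct) auto
  with cong_TComp show ?case
    by simp
next
  case (TComp_TIdt_right t)
  then show ?case
    using wf_Obj[of t] by (auto simp: comp_def subset_iff concat_map_singleton)
next
  case (TComp_assoc s ts uss)
  then show ?case
    using wf_TComp_TComp[OF TComp_assoc(2)] by simp
next
  case (TAct_TAct \<sigma> t \<tau>)
  then show ?case
    by (auto simp: permutes_compose permute_list_compose)
next
  case (TComp_TAct_left s ts \<sigma>)
  have l: "length (dm s) = length ts"
    using TComp_TAct_left(1) by (metis length_map twf.simps(4))
  then have \<sigma>: "\<sigma> permutes {..<length (map dm ts)}"
    using TComp_TAct_left(2) by simp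
  have "concat (map dm (permute_list \<sigma> ts)) =
      permute_list (block_perm \<sigma> (map length (map dm ts))) (concat (map dm ts))"
    using permute_block_perm[OF \<sigma>] \<sigma> by (simp add: permute_list_map)
  moreover have "block_perm \<sigma> (map length (map dm ts)) permutes {..<length (concat (map dm ts))}"
    unfolding length_concat by (rule block_perm_permutes) (use \<sigma> in simp)
  moreover have "map cd (permute_list \<sigma> ts) = permute_list \<sigma> (dm s)"
    using TComp_TAct_left(1) \<sigma> by (simp flip: permute_list_map)
  ultimately show ?case
    using TComp_TAct_left \<sigma> l by (simp add: comp_def)
next
  case (TComp_TAct_right s ts \<sigma>s)
  have a: "list_all2 (\<lambda>\<sigma> xs. \<sigma> permutes {..<length xs}) \<sigma>s (map dm ts)"
    "list_all2 (\<lambda>\<sigma> n. \<sigma> permutes {..<n}) \<sigma>s (map length (map dm ts))"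
    using TComp_TAct_right(2) by (auto simp: list_all2_map2 elim!: list_all2_mono)
  have b: "map dm (map2 TAct \<sigma>s ts) = map2 permute_list \<sigma>s (map dm ts)"
    "map cd (map2 TAct \<sigma>s ts) = map cd ts" "\<forall>u \<in> set (map2 TAct \<sigma>s ts). wt u"
    using TComp_TAct_right(2) by (induction rule: list_all2_induct) auto
  have "sum_perm \<sigma>s (map length (map dm ts)) permutes {..<length (concat (map dm ts))}"
    unfolding length_concat by (rule sum_perm_permutes[OF a(2)])
  then show ?case
    using TComp_TAct_right(1) b permute_sum_perm[OF a(1)] by (simp add: comp_def)
next
  case (GenL_Idt A X)
  then show ?case
    using M.Idt by simp
next
  case (GenL_Comp f gs X)
  have "map (\<lambda>A. (A, X)) (map (Cod M) gs) = map (\<lambda>A. (A, X)) (Dom M f)" "f \<in> Arr M" "set gs \<subseteq> Arr M"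
    using GenL_Comp(1) by (simp_all add: composable_def)
  then show ?case
    using GenL_Comp M.Comp[OF GenL_Comp(1)] by (auto simp: comp_def map_concat)
next
  case (GenL_Act f \<sigma> X)
  then show ?case
    using M.Act[of f \<sigma>] by (simp add: dom_permutes_def permute_list_map)
next
  case (GenR_Idt A X)
  then show ?case
    using N.Idt by simp
next
  case (GenR_Comp A h ks)
  have "map (Pair A) (map (Cod N) ks) = map (Pair A) (Dom N h)" "h \<in> Arr N" "set ks \<subseteq> Arr N"
    using GenR_Comp(2) by (simp_all add: composable_def)
  then show ?case
    using GenR_Comp N.Comp[OF GenR_Comp(2)] by (auto simp: comp_def map_concat)
next
  case (GenR_Act A h \<sigma>)
  then show ?case
    using N.Act[of h \<sigma>] by (simp add: dom_permutes_def permute_list_map)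
next
  case (interchange f h)
  let ?t = "transpose_perm (length (Dom M f)) (length (Dom N h))"
  have "permute_list ?t (concat (map (\<lambda>X. map (\<lambda>A. (A, X)) (Dom M f)) (Dom N h))) =
      concat (map (\<lambda>A. map (Pair A) (Dom N h)) (Dom M f))"
    by (rule permute_list_transpose_perm_lists)
  moreover have "length (concat (map (\<lambda>X. map (\<lambda>A. (A, X)) (Dom M f)) (Dom N h))) =
      length (Dom M f) * length (Dom N h)"
    by (simp add: length_concat comp_def sum_list_triv)
  ultimately show ?case
    using interchange M.Dom[OF interchange(1)] M.Cod[OF interchange(1)] N.Dom[OF interchange(2)]
      N.Cod[OF interchange(2)] transpose_perm_permutes[of "length (Dom M f)" "length (Dom N h)"]
    by (auto simp: comp_def)
qed (use wf_Obj in auto)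

section \<open>Passing from expressions to classes\<close>

lemma cls_eq_iff: "wt s \<Longrightarrow> cls s = cls t \<longleftrightarrow> eq s t"
  by (auto simp: bv_rel_def intro: bv_eq.refl bv_eq.sym bv_eq.trans)

lemma eq_rep: "wt t \<Longrightarrow> eq t (rep (cls t))"
  unfolding bv_rep_def by (rule someI2[of _ t]) (auto simp: bv_rel_def intro: bv_eq.refl)

lemma rep_cls: "wt t \<Longrightarrow> wt (rep (cls t)) \<and> dm (rep (cls t)) = dm t \<and> cd (rep (cls t)) = cd t"
  using eqD[OF eq_rep] by metis

lemma Arr_T: "Arr T = cls ` {t. wt t}"
  by (auto simp: tensor_def quotient_def)

lemma Obj_T: "Obj T = Obj M \<times> Obj N"
  by (simp add: tensor_def)

lemma Idt_T: "Idt T P = cls (TIdt P)"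
  by (simp add: tensor_def)

lemma Dom_cls: "wt t \<Longrightarrow> Dom T (cls t) = dm t"
  using rep_cls by (simp add: tensor_def)

lemma Cod_cls: "wt t \<Longrightarrow> Cod T (cls t) = cd t"
  using rep_cls by (simp add: tensor_def)

text \<open>The congruence rule makes the composite independent of the representatives that
  \<open>bv_rep\<close> chooses.\<close>

lemma Comp_cls:
  assumes "wt (TComp s ts)"
  shows "Comp T (cls s) (map cls ts) = cls (TComp s ts)"
proof -
  have r: "list_all2 eq ts (map rep (map cls ts))"
    using assms by (simp add: list_all2_map2 list_all2_same eq_rep)
  have "map cd (map rep (map cls ts)) = map cd ts"
    unfolding map_map by (intro map_cong) (use assms rep_cls in auto)
  then have w: "wt (TComp (rep (cls s)) (map rep (map cls ts)))"
    using assms rep_cls by (simp del: map_map)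
  have s: "eq s (rep (cls s))"
    using assms by (intro eq_rep) simp
  have "eq (TComp s ts) (TComp (rep (cls s)) (map rep (map cls ts)))"
    by (rule bv_eq.cong_TComp[OF s r assms w])
  then have "cls (TComp (rep (cls s)) (map rep (map cls ts))) = cls (TComp s ts)"
    using cls_eq_iff[OF assms] by metis
  then show ?thesis
    by (simp add: tensor_def)
qed

lemma Act_cls:
  assumes "wt (TAct \<sigma> t)"
  shows "Act T \<sigma> (cls t) = cls (TAct \<sigma> t)"
proof -
  have t: "eq t (rep (cls t))"
    using assms by (intro eq_rep) simp
  have "eq (TAct \<sigma> t) (TAct \<sigma> (rep (cls t)))"
    by (rule bv_eq.cong_TAct[OF t assms]) (use assms rep_cls in simp)
  then have "cls (TAct \<sigma> (rep (cls t))) = cls (TAct \<sigma> t)"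
    using cls_eq_iff[OF assms] by metis
  then show ?thesis
    by (simp add: tensor_def)
qed

lemma arr_T_cases:
  assumes "c \<in> Arr T"
  obtains t where "wt t" "c = cls t"
  using assms by (auto simp: Arr_T)

lemma arrs_T_cases:
  assumes "set cs \<subseteq> Arr T"
  obtains ts where "\<forall>t \<in> set ts. wt t" "cs = map cls ts"
proof -
  have "\<exists>ts. (\<forall>t \<in> set ts. wt t) \<and> cs = map cls ts"
    using assms
  proof (induction cs)
    case (Cons c cs)
    then obtain t ts where "wt t" "c = cls t" "\<forall>t \<in> set ts. wt t" "cs = map cls ts"
      by (auto elim: arr_T_cases)
    then show ?case
      by (intro exI[of _ "t # ts"]) simp
  qed simp
  with that show thesis
    by blast
qed

lemma composable_T_cases:
  assumes "composable T c cs"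
  obtains s ts where "wt (TComp s ts)" "c = cls s" "cs = map cls ts"
proof -
  obtain s where s: "wt s" "c = cls s"
    using assms by (auto simp: composable_def elim: arr_T_cases)
  obtain ts where ts: "\<forall>t \<in> set ts. wt t" "cs = map cls ts"
    using assms by (auto simp: composable_def elim: arrs_T_cases)
  have "map cd ts = map (Cod T) cs"
    using ts Cod_cls by simp
  also have "\<dots> = dm s"
    using assms s Dom_cls by (simp add: composable_def)
  finally show thesis
    using that s ts by simp
qed

lemma composable_T_lists_cases:
  assumes "list_all2 (composable T) (map cls ts) css" "\<forall>t \<in> set ts. wt t"
  obtains uss where "list_all2 (\<lambda>t us. wt (TComp t us)) ts uss" "css = map (map cls) uss"
proof -
  have "\<exists>uss. list_all2 (\<lambda>t us. wt (TComp t us)) ts uss \<and> css = map (map cls) uss"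
    using assms
  proof (induction ts arbitrary: css)
    case (Cons t ts)
    then obtain cs css' where css: "css = cs # css'" "composable T (cls t) cs"
        "list_all2 (composable T) (map cls ts) css'"
      by (auto simp: list_all2_Cons1)
    obtain us where us: "\<forall>t \<in> set us. wt t" "cs = map cls us"
      using css(2) by (auto simp: composable_def elim: arrs_T_cases)
    have "map cd us = map (Cod T) cs"
      using us Cod_cls by simp
    also have "\<dots> = dm t"
      using css(2) Cons.prems Dom_cls by (simp add: composable_def)
    finally have "wt (TComp t us)"
      using us Cons.prems by simp
    moreover obtain uss where "list_all2 (\<lambda>t us. wt (TComp t us)) ts uss" "css' = map (map cls) uss"
      using Cons.IH[OF css(3)] Cons.prems by auto
    ultimately show ?case
      using us css by (intro exI[of _ "us # uss"]) simp
  qed simp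
  with that show thesis
    by blast
qed

lemma dom_permutes_cls: "wt t \<Longrightarrow> dom_permutes T \<sigma> (cls t) \<longleftrightarrow> wt (TAct \<sigma> t)"
  by (simp add: dom_permutes_def Dom_cls)

text \<open>Each equational law is a generating rule of \<open>bv_eq\<close> read on
  representatives; the typing conditions come from \<open>eqD\<close> and
  \<open>wf_Obj\<close>.\<close>

lemma symmetric_multicategory_tensor: "symmetric_multicategory T"
proof
  have clsI: "cls s = cls t" if "eq s t" for s t
    using that cls_eq_iff eqD by blast
  have arrI: "wt t \<Longrightarrow> cls t \<in> Arr T" for t
    by (auto simp: Arr_T)
  {
    fix c assume "c \<in> Arr T"
    then obtain t where t: "wt t" "c = cls t"
      by (rule arr_T_cases)
    show "set (Dom T c) \<subseteq> Obj T" "Cod T c \<in> Obj T"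
      using wf_Obj[OF t(1)] t by (simp_all add: Dom_cls Cod_cls Obj_T)
    have "wt (TComp (TIdt (cd t)) [t])" "wt (TComp t (map TIdt (dm t)))" "wt (TAct id t)"
      using bv_eq.TComp_TIdt_left bv_eq.TComp_TIdt_right bv_eq.TAct_id t(1) eqD by blast+
    note w = this
    show "Comp T (Idt T (Cod T c)) [c] = c"
      using Comp_cls[OF w(1)] clsI[OF bv_eq.TComp_TIdt_left[OF t(1)]] t by (simp add: Cod_cls Idt_T)
    have "map (Idt T) (Dom T c) = map cls (map TIdt (dm t))"
      using t by (simp add: Idt_T Dom_cls)
    then show "Comp T c (map (Idt T) (Dom T c)) = c"
      using Comp_cls[OF w(2)] clsI[OF bv_eq.TComp_TIdt_right[OF t(1)]] t(2) by metis
    show "Act T id c = c"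
      using Act_cls[OF w(3)] clsI[OF bv_eq.TAct_id[OF t(1)]] t(2) by simp
    fix \<sigma> assume \<sigma>: "dom_permutes T \<sigma> c"
    then have w\<sigma>: "wt (TAct \<sigma> t)"
      using dom_permutes_cls t by simp
    then show "Act T \<sigma> c \<in> Arr T \<and> Dom T (Act T \<sigma> c) = permute_list \<sigma> (Dom T c) \<and>
        Cod T (Act T \<sigma> c) = Cod T c"
      unfolding t(2) Act_cls[OF w\<sigma>] Dom_cls[OF w\<sigma>] Cod_cls[OF w\<sigma>] Dom_cls[OF t(1)] Cod_cls[OF t(1)]
      using arrI by simp
    fix \<tau> assume "dom_permutes T \<tau> c"
    then have w\<tau>: "wt (TAct \<tau> t)"
      using dom_permutes_cls t by simp
    note e = bv_eq.TAct_TAct[OF w\<sigma> w\<tau>]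
    have "Act T \<tau> (Act T \<sigma> c) = cls (TAct \<tau> (TAct \<sigma> t))"
      using eqD[OF e] by (simp only: t(2) Act_cls[OF w\<sigma>] Act_cls)
    also have "\<dots> = Act T (\<sigma> \<circ> \<tau>) c"
      unfolding clsI[OF e] t(2) by (rule Act_cls[symmetric]) (use eqD[OF e] in blast)
    finally show "Act T \<tau> (Act T \<sigma> c) = Act T (\<sigma> \<circ> \<tau>) c" .
  next
    fix P assume "P \<in> Obj T"
    then have w: "wt (TIdt P)"
      by (simp add: Obj_T)
    then show "Idt T P \<in> Arr T \<and> Dom T (Idt T P) = [P] \<and> Cod T (Idt T P) = P"
      using arrI by (simp add: Idt_T Dom_cls[OF w] Cod_cls[OF w])
  next
    fix c cs assume "composable T c cs"
    then obtain s ts where st: "wt (TComp s ts)" "c = cls s" "cs = map cls ts"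
      by (rule composable_T_cases)
    have w: "wt s" "\<forall>t \<in> set ts. wt t"
      using st(1) by simp_all
    have "map (Dom T) cs = map dm ts"
      using w(2) Dom_cls by (simp add: st(3))
    moreover have Cc: "Comp T c cs = cls (TComp s ts)"
      unfolding st(2,3) by (rule Comp_cls[OF st(1)])
    ultimately show "Comp T c cs \<in> Arr T \<and> Dom T (Comp T c cs) = concat (map (Dom T) cs) \<and>
        Cod T (Comp T c cs) = Cod T c"
      using arrI[OF st(1)] Dom_cls[OF st(1)] Cod_cls[OF st(1)] Cod_cls[OF w(1)] st(2) by simp
    have ld: "map (length \<circ> Dom T) cs = map (length \<circ> dm) ts"
      using w(2) Dom_cls by (simp add: st(3))
    {
      fix dss assume "list_all2 (composable T) cs dss"
      then obtain uss where uss: "list_all2 (\<lambda>t us. wt (TComp t us)) ts uss" "dss = map (map cls) uss"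
        unfolding st(3) using w(2) by (rule composable_T_lists_cases)
      note e = bv_eq.TComp_assoc[OF st(1) uss(1)]
      have "map2 (Comp T) cs dss = map cls (map2 TComp ts uss)"
        using uss(1) unfolding st(3) uss(2)
      proof (induction rule: list_all2_induct)
        case (Cons t us ts uss)
        then show ?case
          by (simp only: list.map zip_Cons_Cons case_prod_conv Comp_cls)
      qed simp
      moreover have "Comp T (Comp T c cs) (concat dss) = cls (TComp (TComp s ts) (concat uss))"
        unfolding st uss(2) Comp_cls[OF st(1)] by (subst Comp_cls[symmetric]) (use eqD[OF e] in \<open>auto simp: map_concat\<close>)
      moreover have "Comp T c (map cls (map2 TComp ts uss)) = cls (TComp s (map2 TComp ts uss))"
        unfolding st(2) by (rule Comp_cls) (use eqD[OF e] in blast)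
      ultimately show "Comp T (Comp T c cs) (concat dss) = Comp T c (map2 (Comp T) cs dss)"
        using clsI[OF e] by simp
    next
      fix \<sigma> assume "dom_permutes T \<sigma> c"
      then have w\<sigma>: "wt (TAct \<sigma> s)"
        using dom_permutes_cls w(1) st(2) by simp
      note e = bv_eq.TComp_TAct_left[OF st(1) w\<sigma>]
      have "length ts = length (dm s)"
        using st(1) by (metis length_map twf.simps(4))
      then have "permute_list \<sigma> cs = map cls (permute_list \<sigma> ts)"
        using w\<sigma> by (simp add: st(3) permute_list_map)
      then have "Comp T (Act T \<sigma> c) (permute_list \<sigma> cs) = cls (TComp (TAct \<sigma> s) (permute_list \<sigma> ts))"
        using eqD[OF e] by (simp only: st(2) Act_cls[OF w\<sigma>] Comp_cls)
      also have "\<dots> = Act T (block_perm \<sigma> (map (length \<circ> Dom T) cs)) (Comp T c cs)"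
        unfolding ld clsI[OF e] Cc by (rule Act_cls[symmetric]) (use eqD[OF e] in blast)
      finally show "Comp T (Act T \<sigma> c) (permute_list \<sigma> cs) =
        Act T (block_perm \<sigma> (map (length \<circ> Dom T) cs)) (Comp T c cs)" .
    next
      fix \<sigma>s assume a: "list_all2 (dom_permutes T) \<sigma>s cs"
      have w\<sigma>s: "list_all2 (\<lambda>\<sigma> t. wt (TAct \<sigma> t)) \<sigma>s ts"
        using a w(2) unfolding st(3)
        by (auto simp: list_all2_map2 list_all2_conv_all_nth dom_permutes_cls simp del: twf.simps)
      note e = bv_eq.TComp_TAct_right[OF st(1) w\<sigma>s]
      have "map2 (Act T) \<sigma>s cs = map cls (map2 TAct \<sigma>s ts)"
        using w\<sigma>s unfolding st(3)
      proof (induction rule: list_all2_induct)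
        case (Cons \<sigma> \<sigma>s t ts)
        then show ?case
          by (simp only: list.map zip_Cons_Cons case_prod_conv Act_cls)
      qed simp
      then have "Comp T c (map2 (Act T) \<sigma>s cs) = cls (TComp s (map2 TAct \<sigma>s ts))"
        using eqD[OF e] by (simp only: st(2) Comp_cls)
      also have "\<dots> = Act T (sum_perm \<sigma>s (map (length \<circ> Dom T) cs)) (Comp T c cs)"
        unfolding ld clsI[OF e] Cc by (rule Act_cls[symmetric]) (use eqD[OF e] in blast)
      finally show "Comp T c (map2 (Act T) \<sigma>s cs) =
        Act T (sum_perm \<sigma>s (map (length \<circ> Dom T) cs)) (Comp T c cs)" .
    }
  }
qed

sublocale T: symmetric_multicategory T
  by (rule symmetric_multicategory_tensor)

lemma cls_eqI: "eq s t \<Longrightarrow> cls s = cls t"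
  using cls_eq_iff eqD by blast

lemma cls_in_Arr: "wt t \<Longrightarrow> cls t \<in> Arr T"
  by (auto simp: Arr_T)

lemma symmetric_functor_GenL:
  assumes X: "X \<in> Obj N"
  shows "symmetric_functor M T
    \<lparr>obj_map = (\<lambda>A \<in> Obj M. (A, X)), arr_map = (\<lambda>f \<in> Arr M. cls (GenL f X))\<rparr>"
    (is "symmetric_functor _ _ ?F")
  unfolding symmetric_functor_def
proof (intro conjI ballI allI impI)
  show "obj_map ?F \<in> Obj M \<rightarrow>\<^sub>E Obj T" "arr_map ?F \<in> Arr M \<rightarrow>\<^sub>E Arr T"
    using X by (auto simp: Obj_T intro!: cls_in_Arr)
next
  fix f assume f: "f \<in> Arr M"
  then have "wt (GenL f X)"
    using X by simp
  then show "Dom T (arr_map ?F f) = map (obj_map ?F) (Dom M f)" "Cod T (arr_map ?F f) = obj_map ?F (Cod M f)"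
    using f M.Dom[OF f] M.Cod[OF f] by (auto simp: Dom_cls Cod_cls)
next
  fix A assume A: "A \<in> Obj M"
  then show "arr_map ?F (Idt M A) = Idt T (obj_map ?F A)"
    using M.Idt cls_eqI[OF bv_eq.GenL_Idt[OF A X]] by (simp add: Idt_T)
next
  fix f gs assume c: "composable M f gs"
  note e = bv_eq.GenL_Comp[OF c X]
  have m: "map (arr_map ?F) gs = map cls (map (\<lambda>g. GenL g X) gs)" "arr_map ?F f = cls (GenL f X)"
    using c by (auto simp: composable_def)
  have "arr_map ?F (Comp M f gs) = cls (TComp (GenL f X) (map (\<lambda>g. GenL g X) gs))"
    using M.Comp_closed(1)[OF c] cls_eqI[OF e] by simp
  then show "arr_map ?F (Comp M f gs) = Comp T (arr_map ?F f) (map (arr_map ?F) gs)"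
    unfolding m using eqD[OF e] by (simp only: Comp_cls)
next
  fix f \<sigma> assume f: "f \<in> Arr M" "dom_permutes M \<sigma> f"
  note e = bv_eq.GenL_Act[OF f X]
  show "arr_map ?F (Act M \<sigma> f) = Act T \<sigma> (arr_map ?F f)"
    using M.Act[OF f] f cls_eqI[OF e] Act_cls[of \<sigma> "GenL f X"] eqD[OF e] by simp
qed

lemma symmetric_functor_GenR:
  assumes A: "A \<in> Obj M"
  shows "symmetric_functor N T
    \<lparr>obj_map = (\<lambda>X \<in> Obj N. (A, X)), arr_map = (\<lambda>h \<in> Arr N. cls (GenR A h))\<rparr>"
    (is "symmetric_functor _ _ ?F")
  unfolding symmetric_functor_def
proof (intro conjI ballI allI impI)
  show "obj_map ?F \<in> Obj N \<rightarrow>\<^sub>E Obj T" "arr_map ?F \<in> Arr N \<rightarrow>\<^sub>E Arr T"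
    using A by (auto simp: Obj_T intro!: cls_in_Arr)
next
  fix h assume h: "h \<in> Arr N"
  then have "wt (GenR A h)"
    using A by simp
  then show "Dom T (arr_map ?F h) = map (obj_map ?F) (Dom N h)" "Cod T (arr_map ?F h) = obj_map ?F (Cod N h)"
    using h N.Dom[OF h] N.Cod[OF h] by (auto simp: Dom_cls Cod_cls)
next
  fix X assume X: "X \<in> Obj N"
  then show "arr_map ?F (Idt N X) = Idt T (obj_map ?F X)"
    using N.Idt cls_eqI[OF bv_eq.GenR_Idt[OF A X]] by (simp add: Idt_T)
next
  fix h ks assume c: "composable N h ks"
  note e = bv_eq.GenR_Comp[OF A c]
  have m: "map (arr_map ?F) ks = map cls (map (GenR A) ks)" "arr_map ?F h = cls (GenR A h)"
    using c by (auto simp: composable_def)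
  have "arr_map ?F (Comp N h ks) = cls (TComp (GenR A h) (map (GenR A) ks))"
    using N.Comp_closed(1)[OF c] cls_eqI[OF e] by simp
  then show "arr_map ?F (Comp N h ks) = Comp T (arr_map ?F h) (map (arr_map ?F) ks)"
    unfolding m using eqD[OF e] by (simp only: Comp_cls)
next
  fix h \<sigma> assume h: "h \<in> Arr N" "dom_permutes N \<sigma> h"
  note e = bv_eq.GenR_Act[OF A h]
  show "arr_map ?F (Act N \<sigma> h) = Act T \<sigma> (arr_map ?F h)"
    using N.Act[OF h] h cls_eqI[OF e] Act_cls[of \<sigma> "GenR A h"] eqD[OF e] by simp
qed

lemma cls_interchange:
  assumes "f \<in> Arr M" "h \<in> Arr N"
  shows "Comp T (cls (GenL f (Cod N h))) (map (\<lambda>A. cls (GenR A h)) (Dom M f)) =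
    Act T (transpose_perm (length (Dom M f)) (length (Dom N h)))
      (Comp T (cls (GenR (Cod M f) h)) (map (\<lambda>X. cls (GenL f X)) (Dom N h)))"
proof -
  note e = bv_eq.interchange[OF assms]
  have w: "wt (TComp (GenL f (Cod N h)) (map (\<lambda>A. GenR A h) (Dom M f)))"
    "wt (TAct (transpose_perm (length (Dom M f)) (length (Dom N h)))
      (TComp (GenR (Cod M f) h) (map (GenL f) (Dom N h))))"
    using eqD[OF e] by blast+
  then have w': "wt (TComp (GenR (Cod M f) h) (map (GenL f) (Dom N h)))"
    by simp
  show ?thesis
    using cls_eqI[OF e] Act_cls[OF w(2)] Comp_cls[OF w(1)] Comp_cls[OF w'] by (simp add: comp_def)
qed

end

section \<open>Tensoring with the terminal multicategory\<close>

text \<open>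
  The Eckmann--Hilton argument. A commutative monoid is determined by its operations of arity \<open>0\<close> and
  \<open>2\<close>, so the interchange law matters in these arities only.
\<close>

lemma (in symmetric_multicategory) commutative_monoids_interchange:
  assumes \<nu>: "commutative_monoid M A \<nu>" and \<nu>': "commutative_monoid M A \<nu>'"
    and int: "\<And>k n. Comp M (\<nu> k) (replicate k (\<nu>' n)) =
      Act M (transpose_perm k n) (Comp M (\<nu>' n) (replicate n (\<nu> k)))"
  shows "\<nu> = \<nu>'"
proof -
  note n = commutative_monoidD[OF \<nu>] and n' = commutative_monoidD[OF \<nu>']
  have 0: "\<nu> 0 = \<nu>' 0"
    using int[of 0 0] n(2,3)[of 0] n'(2,3)[of 0] by (simp add: Comp_nullary Act_id)
  have 1: "\<nu> 1 = \<nu>' 1"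
    using n(5) n'(5) by simp
  \<comment> \<open>The splitting is applied to the arrow \<open>\<nu> 2\<close> along the
    multiplication \<open>\<nu>' 2\<close>. Both factors are identities by the unit laws of
    \<open>\<nu>\<close>, so the product is \<open>\<nu>' 2\<close> itself.\<close>
  have "\<nu> 2 = Comp M (\<nu>' 2) [Comp M (\<nu> 2) (map (Idt M) [A] @ [\<nu> 0]), Comp M (\<nu> 2) (map (\<lambda>_. \<nu> 0) [A] @ [Idt M A])]"
    using Comp_mult_split[of "\<nu> 2" "[A]" A "\<lambda>_. \<nu> 0" "\<lambda>_. \<nu>' 2"] n(2-4) n'(2-4)
      n'(6)[of "[1, 0]"] n'(6)[of "[0, 1]"] n'(5) 0 int[of 2 2]
    by (simp add: numeral_2_eq_2)
  also have "\<dots> = \<nu>' 2"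
    using n(6)[of "[1, 0]"] n(6)[of "[0, 1]"] n(5) n'(6)[of "[1, 1]"] n'(5) by (simp add: numeral_2_eq_2)
  finally have 2: "\<nu> 2 = \<nu>' 2" .
  have "\<nu> k = \<nu>' k" for k
  proof (induction k)
    case (Suc k)
    \<comment> \<open>Higher operations are iterated binary ones, by the composition law at the
      arities \<open>k\<close> and \<open>1\<close>.\<close>
    have "\<nu> (Suc k) = Comp M (\<nu> 2) [\<nu> k, \<nu> 1]" "\<nu>' (Suc k) = Comp M (\<nu>' 2) [\<nu>' k, \<nu>' 1]"
      using n(6)[of "[k, 1]"] n'(6)[of "[k, 1]"] by (simp_all add: numeral_2_eq_2)
    then show ?case
      using Suc 1 2 by simp
  qed (rule 0)
  then show ?thesis ..
qed

lemma category_terminal: "category terminal_category"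
  by standard (simp_all add: terminal_category_def)

context symmetric_multicategory
begin

interpretation one: symmetric_multicategory one_seq
  by (rule symmetric_multicategory_seq[OF category_terminal])

interpretation P: multicategory_pair one_seq M ..

text \<open>The inverse of \<open>tensor_unit_map\<close> on expressions: a generator from
  \<open>one_seq\<close> becomes the monoid operation of its arity at \<open>X\<close>, and a
  generator from \<open>M\<close> stands for itself.\<close>

primrec eval :: "(nat \<Rightarrow> 'o \<Rightarrow> 'a) \<Rightarrow> (unit, unit list \<times> unit, 'o, 'a) bv_term \<Rightarrow> 'a" where
  "eval \<mu> (GenL f X) = \<mu> (length (fst f)) X"
| "eval \<mu> (GenR A h) = h"
| "eval \<mu> (TIdt P) = Idt M (snd P)"
| "eval \<mu> (TComp s ts) = Comp M (eval \<mu> s) (map (eval \<mu>) ts)"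
| "eval \<mu> (TAct \<sigma> t) = Act M \<sigma> (eval \<mu> t)"

lemma eval_wf:
  assumes \<mu>: "natural_monoids M \<mu>"
  shows "P.wt t \<Longrightarrow> eval \<mu> t \<in> Arr M \<and> Dom M (eval \<mu> t) = map snd (P.dm t) \<and> Cod M (eval \<mu> t) = snd (P.cd t)"
proof (induction t)
  case (GenL f X)
  then show ?case
    using commutative_monoidD(2-4)[OF natural_monoidsD(1)[OF \<mu>, of X]]
    by (simp add: Dom_one_seq comp_def map_replicate_const)
next
  case (TIdt P)
  then show ?case
    using Idt[of "snd P"] by auto
next
  case (TComp s ts)
  have "map (Cod M) (map (eval \<mu>) ts) = map snd (map P.cd ts)"
    unfolding map_map by (intro map_cong) (use TComp in auto)
  also have "map P.cd ts = P.dm s"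
    using TComp.prems by simp
  finally have c: "composable M (eval \<mu> s) (map (eval \<mu>) ts)"
    using TComp by (auto simp: composable_def)
  have "map (Dom M) (map (eval \<mu>) ts) = map (map snd) (map P.dm ts)"
    using TComp by auto
  then show ?case
    using Comp_closed[OF c] TComp by (simp add: map_concat del: map_map)
next
  case (TAct \<sigma> t)
  then show ?case
    using Act[of "eval \<mu> t" \<sigma>] by (simp add: dom_permutes_def permute_list_map)
qed (simp_all add: comp_def)

lemma eval_composable:
  assumes \<mu>: "natural_monoids M \<mu>" and w: "P.wt (TComp s ts)"
  shows "composable M (eval \<mu> s) (map (eval \<mu>) ts)"
proof -
  have "map (Cod M) (map (eval \<mu>) ts) = map snd (map P.cd ts)"
    unfolding map_map by (intro map_cong) (use w eval_wf[OF \<mu>] in auto)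
  also have "map P.cd ts = P.dm s"
    using w by simp
  finally show ?thesis
    using w eval_wf[OF \<mu>] by (auto simp: composable_def)
qed

lemma eval_dom_permutes:
  assumes "natural_monoids M \<mu>" "P.wt (TAct \<sigma> t)"
  shows "dom_permutes M \<sigma> (eval \<mu> t)"
  using assms(2) eval_wf[OF assms(1)] by (simp add: dom_permutes_def)

text \<open>The rules for \<open>GenL\<close> become the laws of the commutative monoids,
  \<open>interchange\<close> becomes the homomorphism law \<open>natural_monoids_inverse\<close>,
  and the remaining rules hold in \<open>M\<close>.\<close>

lemma eval_eq:
  assumes \<mu>: "natural_monoids M \<mu>"
  shows "P.eq s t \<Longrightarrow> eval \<mu> s = eval \<mu> t"
proof (induction rule: bv_eq.induct)
  case (cong_TComp s t ss ts)
  have "map (eval \<mu>) ss = map (eval \<mu>) ts"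
    using cong_TComp.IH(2) by (induction rule: list_all2_induct) auto
  with cong_TComp show ?case
    by simp
next
  case (TComp_TIdt_left t)
  then show ?case
    using eval_wf[OF \<mu>, of t] Comp_Idt_left[of "eval \<mu> t"] by simp
next
  case (TComp_TIdt_right t)
  then show ?case
    using eval_wf[OF \<mu>, of t] Comp_Idt_right[of "eval \<mu> t"] by (simp add: comp_def)
next
  case (TComp_assoc s ts uss)
  have "list_all2 (composable M) (map (eval \<mu>) ts) (map (map (eval \<mu>)) uss)"
    using TComp_assoc(2) eval_composable[OF \<mu>] by (simp add: list_all2_map1 list_all2_map2 list_all2_conv_all_nth del: twf.simps)
  from Comp_assoc[OF eval_composable[OF \<mu> TComp_assoc(1)] this]
  show ?case
    by (simp add: map_concat zip_map_map comp_def case_prod_beta)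
next
  case (TAct_id t)
  then show ?case
    using eval_wf[OF \<mu>] Act_id by simp
next
  case (TAct_TAct \<sigma> t \<tau>)
  then show ?case
    using eval_wf[OF \<mu>, of t] eval_dom_permutes[OF \<mu>] Act_Act[of "eval \<mu> t" \<sigma> \<tau>] by simp
next
  case (TComp_TAct_left s ts \<sigma>)
  have "length ts = length (P.dm s)"
    using TComp_TAct_left(1) by (metis length_map twf.simps(4))
  moreover have "map (length \<circ> Dom M) (map (eval \<mu>) ts) = map (length \<circ> P.dm) ts"
    using TComp_TAct_left(1) eval_wf[OF \<mu>] by auto
  ultimately show ?case
    using Comp_Act_left[OF eval_composable[OF \<mu> TComp_TAct_left(1)] eval_dom_permutes[OF \<mu> TComp_TAct_left(2)]]
      TComp_TAct_left(2) by (simp add: permute_list_map del: map_map)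
next
  case (TComp_TAct_right s ts \<sigma>s)
  have "list_all2 (dom_permutes M) \<sigma>s (map (eval \<mu>) ts)"
    using TComp_TAct_right(2) eval_dom_permutes[OF \<mu>] by (simp add: list_all2_map2 list_all2_conv_all_nth del: twf.simps)
  moreover have "map (length \<circ> Dom M) (map (eval \<mu>) ts) = map (length \<circ> P.dm) ts"
    using TComp_TAct_right(1) eval_wf[OF \<mu>] by auto
  moreover have "map (eval \<mu>) (map2 TAct \<sigma>s ts) = map2 (Act M) \<sigma>s (map (eval \<mu>) ts)"
    by (simp add: zip_map2 comp_def case_prod_beta)
  ultimately show ?case
    using Comp_Act_right[OF eval_composable[OF \<mu> TComp_TAct_right(1)]] by (simp del: map_map)
next
  case (GenL_Idt A X)
  then show ?case
    using commutative_monoidD(5)[OF natural_monoidsD(1)[OF \<mu>, of X]] by simp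
next
  case (GenL_Comp f gs X)
  then have "length gs = length (fst f)"
    by (simp add: composable_one_seq)
  then show ?case
    using commutative_monoidD(6)[OF natural_monoidsD(1)[OF \<mu> GenL_Comp(2)], of "map (length \<circ> fst) gs"]
    by (simp add: Comp_one_seq comp_def)
next
  case (GenL_Act f \<sigma> X)
  then show ?case
    using commutative_monoidD(7)[OF natural_monoidsD(1)[OF \<mu> GenL_Act(3)], of \<sigma> "length (fst f)"]
    by (cases f) (simp add: dom_permutes_def)
next
  case (interchange f h)
  then show ?case
    using natural_monoids_inverse[OF \<mu> interchange(2), of "length (fst f)"]
    by (simp add: Dom_one_seq comp_def map_replicate_const)
next
  case (GenR_Comp A h ks)
  then show ?case
    by (simp add: comp_def)
qed auto

lemma commutative_monoid_GenL:
  assumes X: "X \<in> Obj M"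
  shows "commutative_monoid P.T ((), X) (\<lambda>n. P.cls (GenL (replicate n (), ()) X))"
  using P.symmetric_functor_GenL[OF X] by (simp add: symmetric_functor_one_seq_iff)

lemma symmetric_functor_tensor_unit_map: "symmetric_functor M P.T (tensor_unit_map M)"
  using P.symmetric_functor_GenR[of "()"] by (simp add: tensor_unit_map_def)

lemma cls_interchange_replicate:
  assumes "h \<in> Arr M"
  shows "Comp P.T (P.cls (GenL (replicate n (), ()) (Cod M h))) (replicate n (P.cls (GenR () h))) =
    Act P.T (transpose_perm n (length (Dom M h)))
      (Comp P.T (P.cls (GenR () h)) (map (\<lambda>X. P.cls (GenL (replicate n (), ()) X)) (Dom M h)))"
  using P.cls_interchange[of "(replicate n (), ())" h] assms by (simp add: map_replicate)

text \<open>Generators from \<open>one_seq\<close> are the only new case. The object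
  \<open>((), X)\<close> carries the monoid coming from \<open>one_seq\<close> and the image of the
  monoid \<open>\<mu>\<close> at \<open>X\<close>; the interchange relation at the arrow
  \<open>\<mu> n X\<close> makes them commute, so they coincide. All other expressions follow by
  functoriality of \<open>GenR ()\<close>.\<close>

lemma cls_eq_GenR_eval:
  assumes \<mu>: "natural_monoids M \<mu>"
  shows "P.wt t \<Longrightarrow> P.cls t = P.cls (GenR () (eval \<mu> t))"
proof (induction t)
  case (GenL f X)
  then have X: "X \<in> Obj M"
    by simp
  let ?l = "\<lambda>n. P.cls (GenL (replicate n (), ()) X)" and ?r = "\<lambda>n. P.cls (GenR () (\<mu> n X))"
  note m = natural_monoidsD(1)[OF \<mu> X]
  note \<nu> = commutative_monoidD[OF m]
  have r: "commutative_monoid P.T ((), X) ?r"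
    using commutative_monoid_image[OF symmetric_functor_tensor_unit_map m] X \<nu>(2) by (simp add: tensor_unit_map_def)
  have "?l = ?r"
  proof (rule P.T.commutative_monoids_interchange[OF commutative_monoid_GenL[OF X] r])
    show "Comp P.T (?l k) (replicate k (?r n)) =
      Act P.T (transpose_perm k n) (Comp P.T (?r n) (replicate n (?l k)))" for k n
      using cls_interchange_replicate[OF \<nu>(2), of k n] \<nu>(3,4) by (simp add: map_replicate)
  qed
  from fun_cong[OF this, of "length (fst f)"] one_seq_arr[of f] show ?case
    by simp
next
  case (TIdt P)
  then show ?case
    using P.cls_eqI[OF bv_eq.GenR_Idt[of "()" one_seq "snd P" M]] by (cases P) simp
next
  case (TComp s ts)
  have c: "composable M (eval \<mu> s) (map (eval \<mu>) ts)"
    by (rule eval_composable[OF \<mu> TComp.prems])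
  have "map P.cls ts = map (\<lambda>t. P.cls (GenR () (eval \<mu> t))) ts" "P.cls s = P.cls (GenR () (eval \<mu> s))"
    using TComp by auto
  moreover have "P.cls (GenR () (Comp M (eval \<mu> s) (map (eval \<mu>) ts))) =
      Comp P.T (P.cls (GenR () (eval \<mu> s))) (map (\<lambda>t. P.cls (GenR () (eval \<mu> t))) ts)"
  proof -
    note e = bv_eq.GenR_Comp[of "()" one_seq, OF _ c]
    show ?thesis
      using P.cls_eqI[OF e] P.Comp_cls[of "GenR () (eval \<mu> s)" "map (GenR ()) (map (eval \<mu>) ts)"] P.eqD[OF e]
      by (simp add: comp_def)
  qed
  moreover note P.Comp_cls[OF TComp.prems]
  ultimately show ?case
    by (simp only: eval.simps)
next
  case (TAct \<sigma> t)
  then have t: "eval \<mu> t \<in> Arr M" "dom_permutes M \<sigma> (eval \<mu> t)"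
    using eval_wf[OF \<mu>] eval_dom_permutes[OF \<mu>] by auto
  note e = bv_eq.GenR_Act[of "()" one_seq, OF _ t]
  show ?case
    using TAct P.cls_eqI[OF e] P.Act_cls[of \<sigma> "GenR () (eval \<mu> t)"] P.Act_cls[OF TAct.prems] P.eqD[OF e]
    by simp
qed simp

text \<open>Evaluation recovers \<open>f\<close> from the class of \<open>GenR () f\<close>, which
  gives injectivity, and every class equals that of its evaluation, which gives
  surjectivity.\<close>

lemma isomorphism_tensor_unit_map:
  assumes \<mu>: "natural_monoids M \<mu>"
  shows "isomorphism M (tensor one_seq M) (tensor_unit_map M)"
proof (rule isomorphism_if_bij[OF symmetric_multicategory_axioms symmetric_functor_tensor_unit_map])
  show "bij_betw (obj_map (tensor_unit_map M)) (Obj M) (Obj P.T)"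
    by (auto simp: bij_betw_def inj_on_def tensor_unit_map_def P.Obj_T)
  show "bij_betw (arr_map (tensor_unit_map M)) (Arr M) (Arr P.T)"
  proof (rule bij_betw_imageI)
    show "inj_on (arr_map (tensor_unit_map M)) (Arr M)"
    proof (rule inj_onI)
      fix f g assume fg: "f \<in> Arr M" "g \<in> Arr M" "arr_map (tensor_unit_map M) f = arr_map (tensor_unit_map M) g"
      then have "P.eq (GenR () f) (GenR () g)"
        by (subst P.cls_eq_iff[symmetric]) (simp_all add: tensor_unit_map_def)
      then show "f = g"
        using eval_eq[OF \<mu>] by fastforce
    qed
    show "arr_map (tensor_unit_map M) ` Arr M = Arr P.T"
    proof
      show "arr_map (tensor_unit_map M) ` Arr M \<subseteq> Arr P.T"
        using symmetric_functorD(2)[OF symmetric_functor_tensor_unit_map] by auto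
      show "Arr P.T \<subseteq> arr_map (tensor_unit_map M) ` Arr M"
      proof
        fix c assume "c \<in> Arr P.T"
        then obtain t where t: "P.wt t" "c = P.cls t"
          by (rule P.arr_T_cases)
        then have "c = arr_map (tensor_unit_map M) (eval \<mu> t)"
          using cls_eq_GenR_eval[OF \<mu> t(1)] eval_wf[OF \<mu> t(1)] by (simp add: tensor_unit_map_def)
        then show "c \<in> arr_map (tensor_unit_map M) ` Arr M"
          using eval_wf[OF \<mu> t(1)] by blast
      qed
    qed
  qed
qed

text \<open>In the tensor product the generators from \<open>one_seq\<close> form a monoid on each
  object, and the relations make them commute with the arrows coming from \<open>M\<close>. Under
  the hypothesis these are all the arrows, so the family is natural there and is transported back to
  \<open>M\<close>.\<close>

lemma natural_monoids_if_isomorphism_tensor_unit_map: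
  assumes iso: "isomorphism M (tensor one_seq M) (tensor_unit_map M)"
  shows "\<exists>\<mu>. natural_monoids M \<mu>"
proof -
  obtain G where G: "symmetric_functor P.T M G"
    "\<And>c. c \<in> Arr P.T \<Longrightarrow> arr_map (tensor_unit_map M) (arr_map G c) = c"
    using iso by (rule isomorphismE) (rule that)
  define \<mu> where "\<mu> = (\<lambda>n (P :: unit \<times> 'o). P.cls (GenL (replicate n (), ()) (snd P)))"
  have m: "commutative_monoid P.T P (\<lambda>n. \<mu> n P)" if "P \<in> Obj P.T" for P :: "unit \<times> 'o"
    using that commutative_monoid_GenL[of "snd P"] by (auto simp: \<mu>_def P.Obj_T)
  moreover have "Comp P.T c (map (\<mu> n) (Dom P.T c)) =
      Act P.T (transpose_perm (length (Dom P.T c)) n) (Comp P.T (\<mu> n (Cod P.T c)) (replicate n c))"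
    if c: "c \<in> Arr P.T" for c n
  proof -
    let ?h = "arr_map G c"
    have h: "?h \<in> Arr M" "P.cls (GenR () ?h) = c"
      using symmetric_functorD(2)[OF G(1) c] G(2)[OF c] by (simp_all add: tensor_unit_map_def)
    have D: "Dom P.T c = map (Pair ()) (Dom M ?h)" "Cod P.T c = ((), Cod M ?h)"
      using P.Dom_cls[of "GenR () ?h"] P.Cod_cls[of "GenR () ?h"] h by simp_all
    have "Comp P.T (\<mu> n (Cod P.T c)) (replicate n c) =
        Act P.T (transpose_perm n (length (Dom P.T c))) (Comp P.T c (map (\<mu> n) (Dom P.T c)))"
      using cls_interchange_replicate[OF h(1), of n] h(2) D by (simp add: \<mu>_def comp_def)
    then show ?thesis
      using P.T.length_Dom_Comp_map[OF c, of \<mu> n] m by (simp add: P.T.Act_transpose_perm_inverse)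
  qed
  ultimately have "natural_monoids P.T \<mu>"
    by (auto simp: natural_monoids_def)
  then show ?thesis
    using natural_monoids_transport[OF symmetric_multicategory_axioms P.symmetric_multicategory_tensor iso] by blast
qed

end

theorem proposition3p7:
  fixes M :: "('o, 'a) multicategory"
  assumes "symmetric_multicategory M"
  shows "(sequential M \<longleftrightarrow> M \<cong> seq (unary M)) \<and>
    (M \<cong> seq (unary M) \<longleftrightarrow> (\<exists>U. central_monoid M U)) \<and>
    ((\<exists>U. central_monoid M U) \<longleftrightarrow> (\<exists>m0 m2. central_unital_magma M m0 m2)) \<and>
    ((\<exists>m0 m2. central_unital_magma M m0 m2) \<longleftrightarrow>
       isomorphism (hom one_seq M) M (forget_monoid M)) \<and>
    (isomorphism (hom one_seq M) M (forget_monoid M) \<longleftrightarrow>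
       isomorphism M (tensor one_seq M) (tensor_unit_map M))"
proof -
  interpret symmetric_multicategory M by fact
  \<comment> \<open>The first four conditions lie on one cycle of implications through
    \<open>?nat\<close>; the two conditions on canonical functors are each equivalent to it.\<close>
  let ?nat = "\<exists>\<mu>. natural_monoids M \<mu>"
  have "M \<cong> seq (unary M) \<Longrightarrow> sequential M"
    using category_unary by (auto simp: sequential_def)
  moreover have "sequential M \<Longrightarrow> ?nat"
    by (rule natural_monoids_if_sequential[OF assms])
  moreover have "?nat \<Longrightarrow> \<exists>U. central_monoid M U"
    using central_monoid_if_natural_monoids by blast
  moreover have "\<exists>U. central_monoid M U \<Longrightarrow> \<exists>m0 m2. central_unital_magma M m0 m2"
    using central_unital_magma_if_central_monoid by blast
  moreover have "\<exists>m0 m2. central_unital_magma M m0 m2 \<Longrightarrow> M \<cong> seq (unary M)"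
    using natural_unital_magma_if_central natural_unital_magma.isomorphic_seq_unary by blast
  moreover have "?nat \<longleftrightarrow> isomorphism (hom one_seq M) M (forget_monoid M)"
    using isomorphism_forget_monoid natural_monoids_if_isomorphism_forget_monoid by blast
  moreover have "?nat \<longleftrightarrow> isomorphism M (tensor one_seq M) (tensor_unit_map M)"
    using isomorphism_tensor_unit_map natural_monoids_if_isomorphism_tensor_unit_map by blast
  ultimately show ?thesis
    by argo
qed

end
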